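(* Let $\Omega\subset\mathbb{R}^2$ be a bounded open set, let $\mu$ be a Radon measure on $\Omega$ with $\mu\in H^{-1}(\Omega)$, and let $h_\mu\in H^1(\Omega)$ be a stationary harmonic function with $\Delta h_\mu=\mu$ in $\Omega$. Let $z_0\in\operatorname{supp}\mu$ be such that $\omega_{h_\mu}(z_0)\neq 0$, and assume $h_\mu(z_0)=0$. Then there exist a neighborhood $V$ of $z_0$ and a harmonic function $H$ in $V$ such that $$h_\mu=|H| \text{ in } V\quad\text{or}\quad h_\mu=-|H|\text{ in }V,$$ and $$\operatorname{supp}\mu_{\lfloor V}=\{z\in V:\ H(z)=0\}.$$ Furthermore $\nabla H(z_0)\neq 0$, and the set $\{z\in V:\ H(z)=0\}$ is a smooth simple curve diffeomorphic to a straight line.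
   Context: $\mathbb{R}^2$ is identified with $\mathbb{C}$. Radon measures may be signed; $\mu_{\lfloor V}$ is the restriction of $\mu$ to $V$; the support of a measure is the complement of the largest open set on which it vanishes. $H^{-1}(\Omega)$ is the dual of $H^1_0(\Omega)$. The equation $\Delta h_\mu=\mu$ is in the sense of distributions. A function $h\in H^1(\Omega)$ is stationary harmonic if $\operatorname{div}T_h=0$ in $\Omega$ in the sense of distributions (row by row), where $$T_h=\begin{pmatrix}\frac12[(\partial_yh)^2-(\partial_xh)^2] & -\partial_xh\,\partial_yh\\ -\partial_xh\,\partial_yh&\frac12[(\partial_xh)^2-(\partial_yh)^2]\end{pmatrix};$$ equivalently, $\omega_h:=(\partial_xh)^2-(\partial_yh)^2-2i\,\partial_xh\,\partial_yh=(\partial_xh-i\partial_yh)^2$ is (a.e. equal to) a holomorphic function in $\Omega$, with which it is identified. Such an $h$ is locally Lipschitz and is identified with its continuous representative. *)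

theory Defs
  imports "HOL-Complex_Analysis.Complex_Analysis"
begin

section \<open>Smooth functions and diffeomorphisms\<close>

definition dir_deriv :: "'a::real_normed_vector \<Rightarrow> ('a \<Rightarrow> 'b::real_normed_vector) \<Rightarrow> 'a \<Rightarrow> 'b"
  where "dir_deriv v f x = frechet_derivative f (at x) v"

text \<open>
  Meant for open \<open>S\<close>. On \<open>complex\<close>, regarded as the plane, all derivatives are real
  Frechet derivatives, so \<open>dir_deriv 1\<close> and \<open>dir_deriv \<i>\<close> are the two partial derivatives.
\<close>

fun Ck_on :: "nat \<Rightarrow> 'a::real_normed_vector set \<Rightarrow> ('a \<Rightarrow> 'b::real_normed_vector) \<Rightarrow> bool" where
  "Ck_on 0 S f \<longleftrightarrow> continuous_on S f"
| "Ck_on (Suc k) S f \<longleftrightarrow> (\<forall>x\<in>S. f differentiable (at x)) \<and> (\<forall>v. Ck_on k S (dir_deriv v f))"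

definition smooth_on :: "'a::real_normed_vector set \<Rightarrow> ('a \<Rightarrow> 'b::real_normed_vector) \<Rightarrow> bool"
  where "smooth_on S f \<longleftrightarrow> (\<forall>k. Ck_on k S f)"

text \<open>Smoothness on an arbitrary subset: local smooth extendability to the ambient space.\<close>

definition smooth_map_on :: "'a::real_normed_vector set \<Rightarrow> ('a \<Rightarrow> 'b::real_normed_vector) \<Rightarrow> bool"
  where "smooth_map_on S f \<longleftrightarrow>
    (\<forall>x\<in>S. \<exists>U F. open U \<and> x \<in> U \<and> smooth_on U F \<and> (\<forall>y\<in>S \<inter> U. F y = f y))"

definition diffeomorphic :: "'a::real_normed_vector set \<Rightarrow> 'b::real_normed_vector set \<Rightarrow> bool"
  where "diffeomorphic S T \<longleftrightarrow>
    (\<exists>f g. smooth_map_on S f \<and> f ` S = T \<and> smooth_map_on T g \<and> g ` T = S \<and>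
       (\<forall>x\<in>S. g (f x) = x) \<and> (\<forall>y\<in>T. f (g y) = y))"

text \<open>An open-ended curve, without self-intersections and with nowhere vanishing velocity.\<close>

definition smooth_simple_curve :: "complex set \<Rightarrow> bool"
  where "smooth_simple_curve C \<longleftrightarrow>
    (\<exists>\<gamma>::real \<Rightarrow> complex. smooth_on UNIV \<gamma> \<and> inj \<gamma> \<and>
       (\<forall>t. vector_derivative \<gamma> (at t) \<noteq> 0) \<and> range \<gamma> = C)"

definition grad :: "(complex \<Rightarrow> real) \<Rightarrow> complex \<Rightarrow> complex"
  where "grad f z = Complex (dir_deriv 1 f z) (dir_deriv \<i> f z)"

definition laplacian :: "(complex \<Rightarrow> real) \<Rightarrow> complex \<Rightarrow> real"
  where "laplacian f z = dir_deriv 1 (dir_deriv 1 f) z + dir_deriv \<i> (dir_deriv \<i> f) z"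

definition harmonic_on :: "complex set \<Rightarrow> (complex \<Rightarrow> real) \<Rightarrow> bool"
  where "harmonic_on V H \<longleftrightarrow> Ck_on 2 V H \<and> (\<forall>z\<in>V. laplacian H z = 0)"


section \<open>Weak derivatives and Sobolev spaces\<close>

definition test_fun :: "complex set \<Rightarrow> (complex \<Rightarrow> real) \<Rightarrow> bool"
  where "test_fun \<Omega> \<phi> \<longleftrightarrow> smooth_on UNIV \<phi> \<and>
    compact (closure (support_on UNIV \<phi>)) \<and> closure (support_on UNIV \<phi>) \<subseteq> \<Omega>"

definition L2_on :: "complex set \<Rightarrow> (complex \<Rightarrow> real) \<Rightarrow> bool"
  where "L2_on \<Omega> f \<longleftrightarrow> f \<in> borel_measurable (lebesgue_on \<Omega>) \<and>
    integrable (lebesgue_on \<Omega>) (\<lambda>z. (f z)\<^sup>2)"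

definition is_weak_deriv ::
    "complex set \<Rightarrow> complex \<Rightarrow> (complex \<Rightarrow> real) \<Rightarrow> (complex \<Rightarrow> real) \<Rightarrow> bool"
  where "is_weak_deriv \<Omega> v u g \<longleftrightarrow> (\<forall>\<phi>. test_fun \<Omega> \<phi> \<longrightarrow>
    (LINT z|lebesgue_on \<Omega>. u z * dir_deriv v \<phi> z) = - (LINT z|lebesgue_on \<Omega>. g z * \<phi> z))"

definition H1_on :: "complex set \<Rightarrow> (complex \<Rightarrow> real) \<Rightarrow> bool"
  where "H1_on \<Omega> u \<longleftrightarrow> L2_on \<Omega> u \<and>
    (\<exists>g. L2_on \<Omega> g \<and> is_weak_deriv \<Omega> 1 u g) \<and>
    (\<exists>g. L2_on \<Omega> g \<and> is_weak_deriv \<Omega> \<i> u g)"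

text \<open>For \<open>H1_on \<Omega> u\<close> the choice is unique up to null sets of \<open>\<Omega>\<close>.\<close>

definition weak_deriv :: "complex set \<Rightarrow> complex \<Rightarrow> (complex \<Rightarrow> real) \<Rightarrow> complex \<Rightarrow> real"
  where "weak_deriv \<Omega> v u = (SOME g. L2_on \<Omega> g \<and> is_weak_deriv \<Omega> v u g)"

definition H1_norm :: "complex set \<Rightarrow> (complex \<Rightarrow> real) \<Rightarrow> real"
  where "H1_norm \<Omega> u = sqrt (LINT z|lebesgue_on \<Omega>.
    (u z)\<^sup>2 + (weak_deriv \<Omega> 1 u z)\<^sup>2 + (weak_deriv \<Omega> \<i> u z)\<^sup>2)"

definition H10_on :: "complex set \<Rightarrow> (complex \<Rightarrow> real) \<Rightarrow> bool"
  where "H10_on \<Omega> u \<longleftrightarrow> H1_on \<Omega> u \<and>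
    (\<exists>\<phi>. (\<forall>n. test_fun \<Omega> (\<phi> n)) \<and> (\<lambda>n. H1_norm \<Omega> (\<lambda>z. u z - \<phi> n z)) \<longlonglongrightarrow> 0)"

text \<open>
  Elements of the dual of \<open>H10_on \<Omega>\<close> act on functions rather than on a.e.-classes; the bound
  forces them to respect a.e. equality.
\<close>

definition Hminus1 :: "complex set \<Rightarrow> ((complex \<Rightarrow> real) \<Rightarrow> real) \<Rightarrow> bool"
  where "Hminus1 \<Omega> L \<longleftrightarrow>
    (\<forall>u v a b. H10_on \<Omega> u \<and> H10_on \<Omega> v \<longrightarrow> L (\<lambda>z. a * u z + b * v z) = a * L u + b * L v) \<and>
    (\<exists>C. \<forall>u. H10_on \<Omega> u \<longrightarrow> \<bar>L u\<bar> \<le> C * H1_norm \<Omega> u)"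


section \<open>Signed Radon measures\<close>

text \<open>
  A signed Radon measure on an open set \<open>\<Omega>\<close> is a difference of two positive Borel measures that
  are finite on the compact subsets of \<open>\<Omega>\<close> (in the plane such measures are automatically regular).
  Both may have infinite total mass, so that their difference need not be defined on every Borel
  set; hence the pair \<open>(P, N)\<close> stands for \<open>P - N\<close>. It is not required to be the Jordan
  decomposition, and all notions below depend on \<open>P - N\<close> only.
\<close>

type_synonym signed_measure = "complex measure \<times> complex measure"

definition radon_on :: "complex set \<Rightarrow> complex measure \<Rightarrow> bool"
  where "radon_on \<Omega> M \<longleftrightarrow> sets M = sets (restrict_space borel \<Omega>) \<and>
    (\<forall>K. compact K \<and> K \<subseteq> \<Omega> \<longrightarrow> emeasure M K < \<infinity>)"

definition signed_radon_on :: "complex set \<Rightarrow> signed_measure \<Rightarrow> bool"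
  where "signed_radon_on \<Omega> \<mu> \<longleftrightarrow> radon_on \<Omega> (fst \<mu>) \<and> radon_on \<Omega> (snd \<mu>)"

definition signed_integral :: "signed_measure \<Rightarrow> (complex \<Rightarrow> real) \<Rightarrow> real"
  where "signed_integral \<mu> f = (LINT z|fst \<mu>. f z) - (LINT z|snd \<mu>. f z)"

definition signed_restrict :: "signed_measure \<Rightarrow> complex set \<Rightarrow> signed_measure"
  where "signed_restrict \<mu> V = (restrict_space (fst \<mu>) V, restrict_space (snd \<mu>) V)"

definition vanishes_on :: "signed_measure \<Rightarrow> complex set \<Rightarrow> bool"
  where "vanishes_on \<mu> U \<longleftrightarrow>
    (\<forall>A\<in>sets borel. A \<subseteq> U \<longrightarrow> emeasure (fst \<mu>) A = emeasure (snd \<mu>) A)"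

text \<open>
  The complement is taken in the open set on which \<open>\<mu>\<close> lives; in particular the support of
  \<open>signed_restrict \<mu> V\<close> is a relatively closed subset of \<open>V\<close>.
\<close>

definition signed_supp :: "signed_measure \<Rightarrow> complex set"
  where "signed_supp \<mu> = space (fst \<mu>) - \<Union>{U. open U \<and> U \<subseteq> space (fst \<mu>) \<and> vanishes_on \<mu> U}"

definition signed_in_Hminus1 :: "complex set \<Rightarrow> signed_measure \<Rightarrow> bool"
  where "signed_in_Hminus1 \<Omega> \<mu> \<longleftrightarrow>
    (\<exists>L. Hminus1 \<Omega> L \<and> (\<forall>\<phi>. test_fun \<Omega> \<phi> \<longrightarrow> L \<phi> = signed_integral \<mu> \<phi>))"

definition distr_laplacian_eq :: "complex set \<Rightarrow> (complex \<Rightarrow> real) \<Rightarrow> signed_measure \<Rightarrow> bool"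
  where "distr_laplacian_eq \<Omega> h \<mu> \<longleftrightarrow> (\<forall>\<phi>. test_fun \<Omega> \<phi> \<longrightarrow>
    (LINT z|lebesgue_on \<Omega>. h z * laplacian \<phi> z) = signed_integral \<mu> \<phi>)"


section \<open>Stationary harmonic functions\<close>

definition stress_tensor :: "complex set \<Rightarrow> (complex \<Rightarrow> real) \<Rightarrow> complex \<Rightarrow> real^2^2"
  where "stress_tensor \<Omega> h z =
    (let p = weak_deriv \<Omega> 1 h z; q = weak_deriv \<Omega> \<i> h z
     in vector [vector [(q\<^sup>2 - p\<^sup>2) / 2, - (p * q)],
                vector [- (p * q), (p\<^sup>2 - q\<^sup>2) / 2]])"

definition stationary_harmonic :: "complex set \<Rightarrow> (complex \<Rightarrow> real) \<Rightarrow> bool"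
  where "stationary_harmonic \<Omega> h \<longleftrightarrow> H1_on \<Omega> h \<and>
    (\<forall>i::2. \<forall>\<phi>. test_fun \<Omega> \<phi> \<longrightarrow>
       (LINT z|lebesgue_on \<Omega>. stress_tensor \<Omega> h z $ i $ 1 * dir_deriv 1 \<phi> z +
                              stress_tensor \<Omega> h z $ i $ 2 * dir_deriv \<i> \<phi> z) = 0)"

text \<open>
  The holomorphic representative of \<open>(\<partial>\<^sub>x h - \<i> \<partial>\<^sub>y h)\<^sup>2\<close>. It exists for stationary harmonic \<open>h\<close>,
  and its values on the open set \<open>\<Omega>\<close> do not depend on the choice.
\<close>

definition omega :: "complex set \<Rightarrow> (complex \<Rightarrow> real) \<Rightarrow> complex \<Rightarrow> complex"
  where "omega \<Omega> h = (SOME w. w holomorphic_on \<Omega> \<and>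
    (AE z in lebesgue_on \<Omega>.
       w z = (of_real (weak_deriv \<Omega> 1 h z) - \<i> * of_real (weak_deriv \<Omega> \<i> h z))\<^sup>2))"

end

theory Submission
  imports Defs "HOL-Probability.Distribution_Functions"
begin

text \<open>
  Stationarity says that the weak gradient \<open>(p, q)\<close> of \<open>h\<close> makes \<open>(p - \<i> q)\<^sup>2\<close> a weak solution of
  the Cauchy-Riemann equation: the two rows of \<open>div T\<^sub>h = 0\<close> are its real and imaginary parts.
  By Weyl's lemma for the operator \<open>\<partial>\<^sub>x + \<i> \<partial>\<^sub>y\<close> (\<open>weyl_lemma_dbar\<close>) the square is
  almost everywhere equal to the holomorphic function \<open>\<omega>\<close> (\<open>omega_spec\<close>).

  Where \<open>\<omega> \<noteq> 0\<close> it has a holomorphic square root, and a primitive \<open>g\<close> of that root with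
  \<open>g z0 = 0\<close> is a local holomorphic coordinate (\<open>square_chart_exists\<close>). Put \<open>H = Re g\<close>. Almost
  everywhere the gradient of \<open>h\<close> is \<open>\<plusminus>\<nabla>H\<close>, with a measurable sign about which nothing is known at
  first. Whatever the sign, \<open>h\<close> does not vary along the level lines of \<open>H\<close>: a mollification of
  \<open>h\<close> has small derivative in that direction (\<open>constant_on_levels\<close>). Hence \<open>h = f \<circ> H\<close> near \<open>z0\<close>
  with \<open>f\<close> a continuous function of one real variable.

  The measure now restricts the oscillation of the sign. The Laplacian is conformally covariant, so
  testing \<open>\<Delta>h = \<mu>\<close> with products \<open>a (Re g) b (Im g)\<close> gives
  \<open>\<integral>a (Re g) b (Im g) d\<mu> = \<integral>f a'' \<sqdot> \<integral>b\<close> (\<open>laplacian_test_identity\<close>). With \<open>b\<close> a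
  fixed bump of integral one, the second derivative of \<open>f\<close> is therefore a difference of two finite
  measures on the line, and the slope of \<open>f\<close> is a difference \<open>F\<close> of two nondecreasing right continuous
  functions (\<open>slope_estimate_of_measure_second_derivative\<close>). Off a countable set \<open>F\<close> is the
  derivative of \<open>f\<close>, and comparing it with the weak gradient gives \<open>\<bar>F\<bar> = 1\<close> on a dense set
  (\<open>unit_slope_dense\<close>). Since \<open>F\<close> has one-sided limits at every point, near \<open>0\<close> it is constantly \<open>1\<close> or
  constantly \<open>-1\<close> on either side (\<open>unit_slopes_piecewise_linear\<close>).

  If the slopes on the two sides were equal, \<open>f\<close> would be linear near \<open>0\<close>, and the same identity
  would show that \<open>\<mu>\<close> vanishes near \<open>z0\<close> (\<open>no_mass_on_linear_strip\<close>), against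
  \<open>z0 \<in> supp \<mu>\<close>. So \<open>f t = \<plusminus>\<bar>t\<bar>\<close>, that is, \<open>h = \<plusminus>\<bar>H\<bar>\<close>. The measure has no mass where \<open>H \<noteq> 0\<close> but has
  mass near every point with \<open>H = 0\<close> (\<open>mass_on_fold\<close>), and the zero set of \<open>H\<close> is the image of
  a segment of the imaginary axis under the inverse of \<open>g\<close> (\<open>nodal_line\<close>).
\<close>

section \<open>Calculus of continuously differentiable functions\<close>

lemma dir_deriv_eqI: "(f has_derivative f') (at x) \<Longrightarrow> dir_deriv v f x = f' v"
  unfolding dir_deriv_def by (metis frechet_derivative_at)

lemma has_derivative_dir_deriv:
  "f differentiable (at x) \<Longrightarrow> (f has_derivative (\<lambda>v. dir_deriv v f x)) (at x)"
  unfolding dir_deriv_def by (simp add: frechet_derivative_works)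

text \<open>
  Where the Frechet derivative does not exist, \<open>dir_deriv\<close> is an arbitrary choice; it depends only on the
  set of possible derivatives and thereby on the germ.
\<close>
lemma dir_deriv_cong:
  assumes "open S" "x \<in> S" "\<And>y. y \<in> S \<Longrightarrow> f y = g y"
  shows "dir_deriv v f x = dir_deriv v g x"
proof -
  have "(f has_derivative D) (at x) \<longleftrightarrow> (g has_derivative D) (at x)" for D
    using assms by (metis has_derivative_transform_within_open)
  then show ?thesis by (simp add: dir_deriv_def frechet_derivative_def)
qed

lemma differentiable_cong_open:
  assumes "open S" "x \<in> S" "\<And>y. y \<in> S \<Longrightarrow> f y = g y" "g differentiable (at x)"
  shows "f differentiable (at x)"
  using assms unfolding differentiable_def by (metis has_derivative_transform_within_open)

lemma Ck_on_subset: "Ck_on k S f \<Longrightarrow> T \<subseteq> S \<Longrightarrow> Ck_on k T f"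
  by (induction k arbitrary: f) (auto intro: continuous_on_subset)

lemma Ck_on_cong:
  assumes "open S" "\<And>y. y \<in> S \<Longrightarrow> f y = g y" "Ck_on k S g"
  shows "Ck_on k S f"
  using assms(2,3)
proof (induction k arbitrary: f g)
  case 0 then show ?case by (simp cong: continuous_on_cong)
next
  case (Suc k)
  have "Ck_on k S (dir_deriv v f)" for v
    using Suc.IH[of "dir_deriv v f" "dir_deriv v g"] Suc.prems
      dir_deriv_cong[OF assms(1), of _ f g v] by auto
  then show ?case
    using Suc.prems differentiable_cong_open[OF assms(1), of _ f g] by auto
qed

lemma Ck_on_local:
  assumes "\<And>x. x \<in> S \<Longrightarrow> \<exists>U. open U \<and> x \<in> U \<and> Ck_on k U f"
  shows "Ck_on k S f"
  using assms
proof (induction k arbitrary: f)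
  case 0
  show ?case
    unfolding Ck_on.simps
  proof (rule continuous_at_imp_continuous_on, rule ballI)
    fix x assume "x \<in> S"
    then obtain U where "open U" "x \<in> U" "continuous_on U f" using 0 by auto
    then show "isCont f x" by (simp add: continuous_on_eq_continuous_at)
  qed
next
  case (Suc k)
  have "f differentiable (at x)" if "x \<in> S" for x
    using Suc.prems[OF that] by auto
  moreover have "Ck_on k S (dir_deriv v f)" for v
  proof (rule Suc.IH)
    fix x assume "x \<in> S"
    from Suc.prems[OF this] show "\<exists>U. open U \<and> x \<in> U \<and> Ck_on k U (dir_deriv v f)" by auto
  qed
  ultimately show ?case by simp
qed

lemma Ck_on_Suc_D: "Ck_on (Suc k) S f \<Longrightarrow> Ck_on k S f"
proof (induction k arbitrary: f)
  case 0 then show ?case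
    by (auto intro!: continuous_at_imp_continuous_on simp: differentiable_imp_continuous_within)
next
  case (Suc k) then show ?case by auto
qed

text \<open>
  The recursive definition speaks of \<open>dir_deriv v f\<close>, which is known only on \<open>S\<close> and only after
  the derivative has been computed; this rule lets one exhibit a formula instead.
\<close>
lemma Ck_on_SucI:
  assumes "open S" "\<And>x. x \<in> S \<Longrightarrow> (f has_derivative (\<lambda>v. D v x)) (at x)" "\<And>v. Ck_on k S (D v)"
  shows "Ck_on (Suc k) S f"
proof -
  have "Ck_on k S (dir_deriv v f)" for v
    by (rule Ck_on_cong[OF assms(1) _ assms(3)[of v]]) (simp add: dir_deriv_eqI[OF assms(2)])
  moreover have "f differentiable (at x)" if "x \<in> S" for x
    using assms(2)[OF that] unfolding differentiable_def by blast
  ultimately show ?thesis by simp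
qed

lemma Ck_on_const: "Ck_on k S (\<lambda>x. c)"
proof (induction k arbitrary: c)
  case (Suc k)
  have "dir_deriv v (\<lambda>x. c) = (\<lambda>x. 0)" for v :: 'a
    using dir_deriv_eqI[OF has_derivative_const] by auto
  then show ?case using Suc[of 0] by simp
qed auto

lemma Ck_on_bounded_linear:
  assumes "open S" "bounded_linear L" "Ck_on k S f" shows "Ck_on k S (\<lambda>x. L (f x))"
  using assms(3)
proof (induction k arbitrary: f)
  case 0
  then show ?case using assms(2) by (auto intro: bounded_linear.continuous_on)
next
  case (Suc k)
  show ?case
  proof (rule Ck_on_SucI[OF assms(1)])
    show "((\<lambda>x. L (f x)) has_derivative (\<lambda>v. L (dir_deriv v f x))) (at x)" if "x \<in> S" for x
      using bounded_linear.has_derivative[OF assms(2) has_derivative_dir_deriv] Suc.prems that by auto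
  qed (use Suc in auto)
qed

lemma Ck_on_id: "open S \<Longrightarrow> Ck_on k S (\<lambda>x. x)"
proof (cases k)
  case (Suc j)
  moreover assume "open S"
  ultimately show ?thesis by (auto intro!: Ck_on_SucI[where D="\<lambda>v x. v"] Ck_on_const simp del: Ck_on.simps)
qed auto

lemma Ck_on_linear: "open S \<Longrightarrow> bounded_linear L \<Longrightarrow> Ck_on k S L"
  using Ck_on_bounded_linear[OF _ _ Ck_on_id] by auto

lemma Ck_on_add:
  assumes "open S" "Ck_on k S f" "Ck_on k S g" shows "Ck_on k S (\<lambda>x. f x + g x)"
  using assms(2,3)
proof (induction k arbitrary: f g)
  case 0
  then show ?case by (simp add: continuous_on_add)
next
  case (Suc k)
  show ?case
    by (rule Ck_on_SucI[OF assms(1), where D="\<lambda>v x. dir_deriv v f x + dir_deriv v g x"])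
      (use Suc in \<open>simp_all add: has_derivative_add has_derivative_dir_deriv\<close>)
qed

lemma Ck_on_sum:
  assumes "open S" "\<And>i. i \<in> I \<Longrightarrow> Ck_on k S (f i)" shows "Ck_on k S (\<lambda>x. \<Sum>i\<in>I. f i x)"
  using assms(2)
  by (induction I rule: infinite_finite_induct) (auto intro!: Ck_on_const Ck_on_add[OF assms(1)])

lemma Ck_on_bilinear:
  assumes "open S" "bounded_bilinear B" "Ck_on k S f" "Ck_on k S g"
  shows "Ck_on k S (\<lambda>x. B (f x) (g x))"
  using assms(3,4)
proof (induction k arbitrary: f g)
  case 0
  then show ?case using assms(2) by (auto intro: bounded_bilinear.continuous_on)
next
  case (Suc k)
  show ?case
  proof (rule Ck_on_SucI[OF assms(1), where D="\<lambda>v x. B (f x) (dir_deriv v g x) + B (dir_deriv v f x) (g x)"])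
    show "((\<lambda>x. B (f x) (g x)) has_derivative (\<lambda>v. B (f x) (dir_deriv v g x) + B (dir_deriv v f x) (g x))) (at x)"
      if "x \<in> S" for x
      by (rule bounded_bilinear.FDERIV[OF assms(2) has_derivative_dir_deriv has_derivative_dir_deriv])
        (use Suc.prems that in auto)
    show "Ck_on k S (\<lambda>x. B (f x) (dir_deriv v g x) + B (dir_deriv v f x) (g x))" for v
      using Suc.prems Ck_on_Suc_D[OF Suc.prems(1)] Ck_on_Suc_D[OF Suc.prems(2)]
      by (intro Ck_on_add assms(1) Suc.IH) auto
  qed
qed

lemmas Ck_on_mult = Ck_on_bilinear[OF _ bounded_bilinear_mult]
lemmas Ck_on_scaleR = Ck_on_bilinear[OF _ bounded_bilinear_scaleR]

lemma Ck_on_minus: "open S \<Longrightarrow> Ck_on k S f \<Longrightarrow> Ck_on k S (\<lambda>x. - f x)"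
  by (rule Ck_on_bounded_linear) (auto intro: bounded_linear_minus bounded_linear_ident)

lemma Ck_on_diff:
  assumes "open S" "Ck_on k S f" "Ck_on k S g" shows "Ck_on k S (\<lambda>x. f x - g x)"
  using Ck_on_add[OF assms(1,2) Ck_on_minus[OF assms(1,3)]] by simp

text \<open>
  The chain rule expands \<open>dir_deriv v (g \<circ> f)\<close> in a basis. This keeps the direction in which \<open>g\<close>
  is differentiated independent of the point, so that the induction hypothesis applies to each summand;
  it is the reason for the finite dimension of the middle space.
\<close>
lemma Ck_on_compose:
  fixes f :: "'a::real_normed_vector \<Rightarrow> 'b::euclidean_space" and g :: "'b \<Rightarrow> 'c::real_normed_vector"
  assumes S: "open S" and T: "open T" and f: "Ck_on k S f" and g: "Ck_on k T g" and sub: "f ` S \<subseteq> T"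
  shows "Ck_on k S (\<lambda>x. g (f x))"
  using f g
proof (induction k arbitrary: g)
  case 0
  then show ?case using sub by (auto intro: continuous_on_compose2)
next
  case (Suc k)
  let ?D = "\<lambda>v x. \<Sum>b\<in>Basis. (dir_deriv v f x \<bullet> b) *\<^sub>R dir_deriv b g (f x)"
  show ?case
  proof (rule Ck_on_SucI[OF S, where D="?D"])
    fix x assume x: "x \<in> S"
    have df: "(f has_derivative (\<lambda>v. dir_deriv v f x)) (at x)"
      using Suc.prems x by (auto intro: has_derivative_dir_deriv)
    have dg: "(g has_derivative (\<lambda>v. dir_deriv v g (f x))) (at (f x))"
      using Suc.prems x sub by (auto intro!: has_derivative_dir_deriv)
    have lin: "linear (\<lambda>v. dir_deriv v g (f x))"
      using dg by (rule has_derivative_linear)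
    have eq: "dir_deriv w g (f x) = (\<Sum>b\<in>Basis. (w \<bullet> b) *\<^sub>R dir_deriv b g (f x))" for w
    proof -
      have "dir_deriv (\<Sum>b\<in>Basis. (w \<bullet> b) *\<^sub>R b) g (f x) = (\<Sum>b\<in>Basis. (w \<bullet> b) *\<^sub>R dir_deriv b g (f x))"
        unfolding linear_sum[OF lin] linear_scale[OF lin] ..
      then show ?thesis by (simp only: euclidean_representation)
    qed
    show "((\<lambda>x. g (f x)) has_derivative (\<lambda>v. ?D v x)) (at x)"
      using diff_chain_at[OF df dg] unfolding o_def eq[of "dir_deriv _ f x"] .
  next
    fix v
    show "Ck_on k S (?D v)"
      using Suc.prems Ck_on_Suc_D[OF Suc.prems(1)]
      by (intro Ck_on_sum Ck_on_scaleR S Suc.IH Ck_on_bounded_linear[OF S bounded_linear_inner_left]) auto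
  qed
qed

lemma holomorphic_Ck_on:
  assumes "open S" "f holomorphic_on S" shows "Ck_on k S f"
  using assms(2)
proof (induction k arbitrary: f)
  case 0 then show ?case by (simp add: holomorphic_on_imp_continuous_on)
next
  case (Suc k)
  show ?case
  proof (rule Ck_on_SucI[OF assms(1), where D="\<lambda>v x. deriv f x * v"])
    show "(f has_derivative (\<lambda>v. deriv f x * v)) (at x)" if "x \<in> S" for x
      using holomorphic_derivI[OF Suc.prems assms(1) that] by (simp add: has_field_derivative_def)
    show "Ck_on k S (\<lambda>x. deriv f x * v)" for v
      by (intro Suc.IH holomorphic_on_mult holomorphic_deriv Suc.prems assms(1) holomorphic_on_const)
  qed
qed

text \<open>
  Instances with \<open>f'\<close> expressed through \<open>f\<close> itself give smoothness of solutions of differential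
  equations such as \<open>tanh' = 1 - tanh\<^sup>2\<close> by induction on \<open>k\<close>.
\<close>
lemma Ck_on_real_SucI:
  fixes f :: "real \<Rightarrow> 'b::real_normed_vector"
  assumes "open S" "\<And>t. t \<in> S \<Longrightarrow> (f has_vector_derivative f' t) (at t)" "Ck_on k S f'"
  shows "Ck_on (Suc k) S f"
  by (rule Ck_on_SucI[OF assms(1), where D="\<lambda>v t. v *\<^sub>R f' t"])
    (use assms(2) in \<open>simp add: has_vector_derivative_def\<close>, intro Ck_on_scaleR Ck_on_const assms)

lemma smooth_on_dir_deriv: "smooth_on S f \<Longrightarrow> smooth_on S (dir_deriv v f)"
  unfolding smooth_on_def by (metis Ck_on.simps(2))

lemma smooth_on_differentiable: "smooth_on S f \<Longrightarrow> x \<in> S \<Longrightarrow> f differentiable (at x)"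
  unfolding smooth_on_def by (metis Ck_on.simps(2))

lemma smooth_on_continuous: "smooth_on S f \<Longrightarrow> continuous_on S f"
  unfolding smooth_on_def by (metis Ck_on.simps(1))

lemma smooth_on_has_derivative:
  "smooth_on S f \<Longrightarrow> x \<in> S \<Longrightarrow> (f has_derivative (\<lambda>v. dir_deriv v f x)) (at x)"
  by (intro has_derivative_dir_deriv smooth_on_differentiable)

section \<open>Bump functions and test functions\<close>

text \<open>
  These functions are closed under differentiation, unlike the single function \<open>exp (-1/t)\<close>; that
  makes smoothness at \<open>0\<close> an induction over the order with an arbitrary polynomial.
\<close>
definition flat_poly :: "real poly \<Rightarrow> real \<Rightarrow> real" where
  "flat_poly p t = (if t \<le> 0 then 0 else poly p (1 / t) * exp (- (1 / t)))"

lemma poly_exp_minus_tendsto_0: "((\<lambda>x. poly p x * exp (- x)) \<longlongrightarrow> (0::real)) at_top"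
proof -
  have "((\<lambda>x::real. \<Sum>i\<le>degree p. coeff p i * (x ^ i / exp x)) \<longlongrightarrow> (\<Sum>i\<le>degree p. coeff p i * 0)) at_top"
    by (intro tendsto_intros tendsto_power_div_exp_0)
  then show ?thesis
    by (simp add: poly_altdef sum_distrib_right exp_minus divide_inverse mult.assoc)
qed

lemma flat_poly_tendsto_0: "((flat_poly p) \<longlongrightarrow> 0) (at 0)"
proof -
  have "filterlim (\<lambda>t::real. 1 / t) at_top (at_right 0)"
    using filterlim_inverse_at_top_right by (simp add: divide_inverse)
  then have "((\<lambda>t. poly p (1 / t) * exp (- (1 / t))) \<longlongrightarrow> 0) (at_right 0)"
    by (rule filterlim_compose[OF poly_exp_minus_tendsto_0])
  moreover have "eventually (\<lambda>t. poly p (1 / t) * exp (- (1 / t)) = flat_poly p t) (at_right 0)"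
    using eventually_at_right_less[of 0] by eventually_elim (simp add: flat_poly_def)
  ultimately have R: "(flat_poly p \<longlongrightarrow> 0) (at_right 0)"
    using Lim_transform_eventually by blast
  have "eventually (\<lambda>t. 0 = flat_poly p t) (at_left 0)"
    unfolding eventually_at_filter by (simp add: flat_poly_def)
  then have "(flat_poly p \<longlongrightarrow> 0) (at_left 0)"
    using Lim_transform_eventually tendsto_const by blast
  with R show ?thesis by (simp add: filterlim_split_at)
qed

text \<open>
  At \<open>0\<close> the difference quotient is the flat function of the polynomial \<open>x p\<close>, because
  \<open>1 / t\<close> is the variable of the polynomial; hence the derivative there is a limit already known.
\<close>
lemma flat_poly_deriv:
  "(flat_poly p has_real_derivative flat_poly (monom 1 2 * (p - pderiv p)) t) (at t)"
proof -
  consider "t > 0" | "t < 0" | "t = 0" by linarith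
  then show ?thesis
  proof cases
    case 1
    have "((\<lambda>t. poly p (1 / t) * exp (- (1 / t))) has_real_derivative
        flat_poly (monom 1 2 * (p - pderiv p)) t) (at t)"
      using 1 by (auto intro!: derivative_eq_intros
          simp: flat_poly_def poly_monom field_simps power2_eq_square)
    then show ?thesis
      by (rule has_field_derivative_transform_within_open[where S="{0<..}"])
         (use 1 in \<open>auto simp: flat_poly_def\<close>)
  next
    case 2
    have "((\<lambda>t. 0) has_real_derivative flat_poly (monom 1 2 * (p - pderiv p)) t) (at t)"
      using 2 by (auto simp: flat_poly_def)
    then show ?thesis
      by (rule has_field_derivative_transform_within_open[where S="{..<0}"])
         (use 2 in \<open>auto simp: flat_poly_def\<close>)
  next
    case 3
    have "((\<lambda>h. (flat_poly p h - flat_poly p 0) / h) \<longlongrightarrow> 0) (at 0)"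
      by (rule Lim_transform_eventually[OF flat_poly_tendsto_0[of "pCons 0 p"]])
        (auto simp: eventually_at_filter flat_poly_def)
    with 3 show ?thesis
      by (simp add: has_field_derivative_def has_derivative_at DERIV_def flat_poly_def
          flip: has_field_derivative_def)
  qed
qed

lemma smooth_on_real_antiderivative:
  fixes F :: "real \<Rightarrow> real"
  assumes "open S" "\<And>t. t \<in> S \<Longrightarrow> (F has_real_derivative f t) (at t)" "smooth_on S f"
  shows "smooth_on S F"
  unfolding smooth_on_def
proof
  fix k show "Ck_on k S F"
    using Ck_on_real_SucI[OF assms(1), of F f k] assms(2,3)
    by (auto simp: smooth_on_def has_real_derivative_iff_has_vector_derivative simp del: Ck_on.simps
        dest: Ck_on_Suc_D)
qed

lemma smooth_flat_poly: "smooth_on UNIV (flat_poly p)"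
  unfolding smooth_on_def
proof
  fix k show "Ck_on k UNIV (flat_poly p)"
  proof (induction k arbitrary: p)
    case 0
    have "isCont (flat_poly p) t" for t using flat_poly_deriv by (rule DERIV_isCont)
    then show ?case by (simp add: continuous_at_imp_continuous_on)
  next
    case (Suc k)
    show ?case
      using flat_poly_deriv[of p] Suc
      by (intro Ck_on_real_SucI) (auto simp: has_real_derivative_iff_has_vector_derivative)
  qed
qed

text \<open>
  The bump of the interval \<open>(a, b)\<close> with an extra parameter: as \<open>e\<close> decreases to \<open>0\<close> the bumps
  increase to the indicator function of the open interval.
\<close>
definition bump :: "real \<Rightarrow> real \<Rightarrow> real \<Rightarrow> real \<Rightarrow> real" where
  "bump e a b t = (if a < t \<and> t < b then exp (- (e / (t - a))) * exp (- (e / (b - t))) else 0)"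

lemma bump_eq_flat: "0 < e \<Longrightarrow> bump e a b t = flat_poly 1 ((t - a) / e) * flat_poly 1 ((b - t) / e)"
  by (auto simp: bump_def flat_poly_def divide_le_0_iff)

lemma smooth_on_compose:
  fixes f :: "'a::real_normed_vector \<Rightarrow> 'b::euclidean_space" and g :: "'b \<Rightarrow> 'c::real_normed_vector"
  assumes "open S" "open T" "smooth_on S f" "smooth_on T g" "f ` S \<subseteq> T"
  shows "smooth_on S (\<lambda>x. g (f x))"
  using assms Ck_on_compose unfolding smooth_on_def by blast

lemma smooth_on_mult:
  fixes f g :: "'a::real_normed_vector \<Rightarrow> 'b::real_normed_algebra"
  shows "open S \<Longrightarrow> smooth_on S f \<Longrightarrow> smooth_on S g \<Longrightarrow> smooth_on S (\<lambda>x. f x * g x)"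
  unfolding smooth_on_def by (blast intro: Ck_on_mult)

lemma smooth_on_add:
  "open S \<Longrightarrow> smooth_on S f \<Longrightarrow> smooth_on S g \<Longrightarrow> smooth_on S (\<lambda>x. f x + g x)"
  unfolding smooth_on_def by (blast intro: Ck_on_add)

lemma smooth_on_diff:
  "open S \<Longrightarrow> smooth_on S f \<Longrightarrow> smooth_on S g \<Longrightarrow> smooth_on S (\<lambda>x. f x - g x)"
  unfolding smooth_on_def by (blast intro: Ck_on_diff)

lemma smooth_on_const: "smooth_on S (\<lambda>x. c)"
  unfolding smooth_on_def by (blast intro: Ck_on_const)

lemma smooth_on_bounded_linear: "open S \<Longrightarrow> bounded_linear L \<Longrightarrow> smooth_on S f \<Longrightarrow> smooth_on S (\<lambda>x. L (f x))"
  unfolding smooth_on_def by (blast intro: Ck_on_bounded_linear)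

lemma smooth_on_linear: "open S \<Longrightarrow> bounded_linear L \<Longrightarrow> smooth_on S L"
  unfolding smooth_on_def by (blast intro: Ck_on_linear)

lemma smooth_on_id: "open S \<Longrightarrow> smooth_on S (\<lambda>x. x)"
  unfolding smooth_on_def by (blast intro: Ck_on_id)

lemma smooth_on_subset: "smooth_on S f \<Longrightarrow> T \<subseteq> S \<Longrightarrow> smooth_on T f"
  unfolding smooth_on_def by (blast intro: Ck_on_subset)

lemma smooth_on_cong: "open S \<Longrightarrow> (\<And>y. y \<in> S \<Longrightarrow> f y = g y) \<Longrightarrow> smooth_on S g \<Longrightarrow> smooth_on S f"
  unfolding smooth_on_def by (blast intro: Ck_on_cong)

lemma smooth_on_local: "(\<And>x. x \<in> S \<Longrightarrow> \<exists>U. open U \<and> x \<in> U \<and> smooth_on U f) \<Longrightarrow> smooth_on S f"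
  unfolding smooth_on_def by (intro allI Ck_on_local) blast

lemma holomorphic_smooth_on: "open S \<Longrightarrow> f holomorphic_on S \<Longrightarrow> smooth_on S f"
  unfolding smooth_on_def by (blast intro: holomorphic_Ck_on)

lemma smooth_bump: assumes "0 < e" shows "smooth_on UNIV (bump e a b)"
proof -
  have "smooth_on UNIV (\<lambda>t. flat_poly 1 ((t - a) * (1 / e)) * flat_poly 1 ((b - t) * (1 / e)))"
    by (intro smooth_on_mult smooth_on_compose[OF _ _ _ smooth_flat_poly]
        smooth_on_diff smooth_on_id smooth_on_const) auto
  then show ?thesis by (simp add: bump_eq_flat[OF assms, abs_def])
qed

lemma bump_nonneg: "0 \<le> bump e a b t" and bump_le_1: "0 < e \<Longrightarrow> bump e a b t \<le> 1"
  by (auto simp: bump_def intro!: mult_le_one)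

lemma bump_eq_0: "t \<le> a \<or> b \<le> t \<Longrightarrow> bump e a b t = 0"
  by (auto simp: bump_def)

lemma bump_pos: "a < t \<Longrightarrow> t < b \<Longrightarrow> 0 < bump e a b t"
  by (auto simp: bump_def)

lemma continuous_bump: "0 < e \<Longrightarrow> continuous_on S (bump e a b)"
  using smooth_on_continuous[OF smooth_bump] continuous_on_subset by blast

lemma test_funI:
  assumes "smooth_on UNIV \<phi>" "compact K" "K \<subseteq> \<Omega>" "\<And>z. z \<notin> K \<Longrightarrow> \<phi> z = 0"
  shows "test_fun \<Omega> \<phi>"
proof -
  have "support_on UNIV \<phi> \<subseteq> K" using assms(4) by (auto simp: support_on_def)
  then have *: "closure (support_on UNIV \<phi>) \<subseteq> K"
    by (simp add: assms(2) closure_minimal compact_imp_closed)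
  then have "compact (closure (support_on UNIV \<phi>))"
    using assms(2) by (metis closed_closure compact_Int_closed inf.absorb2)
  with * assms show ?thesis by (auto simp: test_fun_def)
qed

lemma test_funE:
  assumes "test_fun \<Omega> \<phi>"
  obtains K where "compact K" "K \<subseteq> \<Omega>" "\<And>z. z \<notin> K \<Longrightarrow> \<phi> z = 0" "smooth_on UNIV \<phi>"
proof
  show "\<phi> z = 0" if "z \<notin> closure (support_on UNIV \<phi>)" for z
    using that closure_subset by (force simp: support_on_def)
qed (use assms in \<open>auto simp: test_fun_def\<close>)

lemma dir_deriv_eq_0:
  assumes "closed K" "\<And>z. z \<notin> K \<Longrightarrow> f z = 0" "z \<notin> K" shows "dir_deriv v f z = 0"
proof -
  have "dir_deriv v f z = dir_deriv v (\<lambda>x. 0) z"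
    using assms by (intro dir_deriv_cong[of "-K"]) auto
  then show ?thesis using dir_deriv_eqI[OF has_derivative_const] by metis
qed

lemma test_fun_dir_deriv:
  assumes "test_fun \<Omega> \<phi>" shows "test_fun \<Omega> (dir_deriv v \<phi>)"
proof -
  obtain K where K: "compact K" "K \<subseteq> \<Omega>" "\<And>z. z \<notin> K \<Longrightarrow> \<phi> z = 0" "smooth_on UNIV \<phi>"
    using test_funE[OF assms] by metis
  show ?thesis
    using test_funI[OF smooth_on_dir_deriv[OF K(4)] K(1,2)]
      dir_deriv_eq_0[OF compact_imp_closed[OF K(1)] K(3)] by presburger
qed

lemma test_fun_mono: "test_fun U \<phi> \<Longrightarrow> U \<subseteq> V \<Longrightarrow> test_fun V \<phi>"
  by (auto simp: test_fun_def)

lemma test_fun_continuous: "test_fun \<Omega> \<phi> \<Longrightarrow> continuous_on S \<phi>"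
  using smooth_on_continuous continuous_on_subset unfolding test_fun_def by blast

lemma compact_support_bounded:
  fixes f :: "'a::topological_space \<Rightarrow> 'b::real_normed_vector"
  assumes "continuous_on UNIV f" "compact K" "\<And>z. z \<notin> K \<Longrightarrow> f z = 0"
  obtains B where "\<And>z. norm (f z) \<le> B" "B > 0"
proof -
  have "compact (f ` K)" using assms by (intro compact_continuous_image continuous_on_subset[OF assms(1)]) auto
  then obtain B where "B > 0" and B: "\<And>x. x \<in> f ` K \<Longrightarrow> norm x \<le> B"
    using compact_imp_bounded[of "f ` K"] unfolding bounded_pos by blast
  have "norm (f z) \<le> B" for z
    using assms(3)[of z] \<open>B > 0\<close> B by (cases "z \<in> K") auto
  with \<open>B > 0\<close> show ?thesis using that by blast
qed

lemma test_fun_bounded: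
  assumes "test_fun \<Omega> \<phi>" obtains B where "\<And>z. \<bar>\<phi> z\<bar> \<le> B" "B > 0"
proof -
  from assms obtain K where K: "compact K" "\<And>z. z \<notin> K \<Longrightarrow> \<phi> z = 0" "smooth_on UNIV \<phi>"
    by (elim test_funE) blast
  show ?thesis using compact_support_bounded[OF smooth_on_continuous[OF K(3)] K(1,2)] that by auto
qed

text \<open>
  Products of bumps are the only test functions needed to identify measures.
\<close>
lemma test_fun_box_bump:
  assumes "0 < e" "cbox (Complex a c) (Complex b d) \<subseteq> \<Omega>"
  shows "test_fun \<Omega> (\<lambda>z. bump e a b (Re z) * bump e c d (Im z))"
proof (rule test_funI)
  show "smooth_on UNIV (\<lambda>z. bump e a b (Re z) * bump e c d (Im z))"
    by (intro smooth_on_mult smooth_on_compose[OF _ _ _ smooth_bump] assms smooth_on_linear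
        bounded_linear_Re bounded_linear_Im) auto
  show "bump e a b (Re z) * bump e c d (Im z) = 0" if "z \<notin> cbox (Complex a c) (Complex b d)" for z
    using that by (auto simp: in_cbox_complex_iff bump_def)
qed (use assms in auto)

section \<open>Test functions determine measures and integrable functions\<close>

lemma bump_tendsto_indicator:
  "(\<lambda>n. bump (1 / Suc n) a b t) \<longlonglongrightarrow> indicator {a<..<b} t"
proof (cases "a < t \<and> t < b")
  case True
  have "(\<lambda>n. exp (- (1 / Suc n * (1 / (t - a)))) * exp (- (1 / Suc n * (1 / (b - t)))))
      \<longlonglongrightarrow> exp (- (0 * (1 / (t - a)))) * exp (- (0 * (1 / (b - t))))"
    by (intro tendsto_intros LIMSEQ_Suc[OF lim_1_over_n])
  with True show ?thesis by (simp add: bump_def)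
qed (auto simp: bump_def)

lemma emeasure_box_eq_if_bumps_agree:
  fixes M N :: "complex measure"
  assumes fin: "finite_measure M" "finite_measure N"
    and sets: "sets M = sets borel" "sets N = sets borel"
    and eq: "\<And>e. 0 < e \<Longrightarrow> (LINT z|M. bump e a b (Re z) * bump e c d (Im z)) =
        (LINT z|N. bump e a b (Re z) * bump e c d (Im z))"
  shows "emeasure M (box (Complex a c) (Complex b d)) = emeasure N (box (Complex a c) (Complex b d))"
proof -
  let ?B = "box (Complex a c) (Complex b d)"
  let ?f = "\<lambda>n z. bump (1 / Suc n) a b (Re z) * bump (1 / Suc n) c d (Im z)"
  have lim: "(\<lambda>n. LINT z|L. ?f n z) \<longlonglongrightarrow> measure L ?B"
    if L: "finite_measure L" "sets L = sets borel" for L :: "complex measure"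
  proof -
    interpret finite_measure L by fact
    have [measurable_cong]: "sets L = sets borel" by fact
    have [measurable]: "bump (1 / Suc n) a b \<in> borel_measurable borel" for n a b
      by (intro borel_measurable_continuous_onI continuous_bump) auto
    have [measurable]: "?f n \<in> borel_measurable L" for n
      by measurable
    have "(\<lambda>n. LINT z|L. ?f n z) \<longlonglongrightarrow> (LINT z|L. indicator ?B z)"
    proof (rule integral_dominated_convergence[where w="\<lambda>z. 1"])
      show "AE z in L. (\<lambda>n. ?f n z) \<longlonglongrightarrow> indicator ?B z"
      proof (rule AE_I2)
        fix z
        have "(\<lambda>n. ?f n z) \<longlonglongrightarrow> indicator {a<..<b} (Re z) * indicator {c<..<d} (Im z)"
          by (intro tendsto_mult bump_tendsto_indicator)
        moreover have "indicator {a<..<b} (Re z) * indicator {c<..<d} (Im z) = (indicator ?B z :: real)"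
          by (auto simp: indicator_def in_box_complex_iff)
        ultimately show "(\<lambda>n. ?f n z) \<longlonglongrightarrow> indicator ?B z" by simp
      qed
      show "AE z in L. norm (?f n z) \<le> 1" for n
        by (auto simp: abs_mult bump_nonneg intro!: mult_le_one bump_le_1)
    qed measurable
    moreover have "?B \<in> sets L" using L(2) by simp
    ultimately show ?thesis by simp
  qed
  have "(\<lambda>n. LINT z|M. ?f n z) \<longlonglongrightarrow> measure N ?B"
    using lim[OF fin(2) sets(2)] eq by (simp del: of_nat_Suc)
  then have "measure M ?B = measure N ?B"
    using lim[OF fin(1) sets(1)] LIMSEQ_unique by blast
  then show ?thesis
    using fin by (simp add: finite_measure.emeasure_eq_measure)
qed

lemma box_Int_box_complex:
  "box (Complex a c) (Complex b d) \<inter> box p q =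
    box (Complex (max a (Re p)) (max c (Im p))) (Complex (min b (Re q)) (min d (Im q)))"
  by (auto simp: in_box_complex_iff)

text \<open>
  Only bumps inside the large box are tested, so both measures are cut off to that box first.
  Boxes then form an intersection-stable generator on which the cut-off measures agree by dominated
  convergence of bumps to indicators.
\<close>
lemma emeasure_eq_if_bumps_agree:
  fixes M N :: "complex measure"
  assumes fin: "finite_measure M" "finite_measure N"
    and sets: "sets M = sets borel" "sets N = sets borel"
    and eq: "\<And>e a b c d. 0 < e \<Longrightarrow> l1 \<le> a \<Longrightarrow> a < b \<Longrightarrow> b \<le> u1 \<Longrightarrow> l2 \<le> c \<Longrightarrow> c < d \<Longrightarrow> d \<le> u2 \<Longrightarrow>
        (LINT z|M. bump e a b (Re z) * bump e c d (Im z)) =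
        (LINT z|N. bump e a b (Re z) * bump e c d (Im z))"
    and A: "A \<in> sets borel" "A \<subseteq> box (Complex l1 l2) (Complex u1 u2)"
  shows "emeasure M A = emeasure N A"
proof -
  let ?B = "box (Complex l1 l2) (Complex u1 u2)"
  let ?D = "\<lambda>L. density L (indicator ?B)"
  let ?E = "range (\<lambda>(a, b). box a b::complex set)"
  have B: "?B \<in> sets borel" by simp
  have em: "emeasure (?D L) X = emeasure L (?B \<inter> X)" if "sets L = sets borel" "X \<in> sets borel" for L X
    using that by (subst emeasure_density)
      (auto simp: measurable_def[of _ borel] simp flip: indicator_inter_arith intro!: nn_integral_indicator)
  have box: "emeasure M (?B \<inter> box p q) = emeasure N (?B \<inter> box p q)" for p q
  proof -
    let ?a = "max l1 (Re p)" and ?b = "min u1 (Re q)" and ?c = "max l2 (Im p)" and ?d = "min u2 (Im q)"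
    show ?thesis
    proof (cases "?a < ?b \<and> ?c < ?d")
      case True
      have "(LINT z|M. bump e ?a ?b (Re z) * bump e ?c ?d (Im z)) =
          (LINT z|N. bump e ?a ?b (Re z) * bump e ?c ?d (Im z))" if "0 < e" for e
        by (rule eq[OF that]) (use True in linarith)+
      then show ?thesis
        unfolding box_Int_box_complex by (rule emeasure_box_eq_if_bumps_agree[OF fin sets])
    next
      case False
      then have "?B \<inter> box p q = {}" by (auto simp: in_box_complex_iff)
      then show ?thesis by simp
    qed
  qed
  have "?D M = ?D N"
  proof (rule measure_eqI_generator_eq)
    let ?A = "\<lambda>n::nat. box (- (real n *\<^sub>R One)) (real n *\<^sub>R One) :: complex set"
    show "Int_stable ?E" by (auto simp: Int_stable_def box_Int_box)
    show "?E \<subseteq> Pow UNIV" "sets (?D M) = sigma_sets UNIV ?E" "sets (?D N) = sigma_sets UNIV ?E"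
      by (simp_all add: borel_eq_box sets)
    show "range ?A \<subseteq> ?E" "(\<Union>i. ?A i) = UNIV" unfolding UN_box_eq_UNIV by auto
    show "emeasure (?D M) (?A i) \<noteq> \<infinity>" for i
      using fin(1) by (subst em) (auto simp: sets finite_measure.emeasure_eq_measure)
    show "emeasure (?D M) X = emeasure (?D N) X" if X: "X \<in> ?E" for X
    proof -
      obtain p q where "X = box p q" using X by auto
      then show ?thesis using box[of p q] by (simp add: em sets)
    qed
  qed
  then have "emeasure M (?B \<inter> A) = emeasure N (?B \<inter> A)"
    using em[OF sets(1) A(1)] em[OF sets(2) A(1)] by simp
  moreover have "?B \<inter> A = A" using A by auto
  ultimately show ?thesis by simp
qed

lemma test_integrable:
  fixes f :: "complex \<Rightarrow> 'b::{banach, second_countable_topology}"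
  assumes "integrable M f" "test_fun \<Omega> \<phi>" "sets M = sets borel"
  shows "integrable M (\<lambda>z. \<phi> z *\<^sub>R f z)"
proof -
  obtain B where B: "\<And>z. \<bar>\<phi> z\<bar> \<le> B" using test_fun_bounded[OF assms(2)] by blast
  have "\<phi> \<in> borel_measurable borel"
    by (intro borel_measurable_continuous_onI test_fun_continuous[OF assms(2)])
  then have "\<phi> \<in> borel_measurable M" using measurable_cong_sets[OF assms(3) refl] by blast
  then show ?thesis
    by (intro Bochner_Integration.integrable_bound[OF integrable_scaleR_right[OF integrable_norm[OF assms(1)], of B]])
      (use assms(1) in \<open>auto intro!: AE_I2 mult_right_mono order_trans[OF B abs_ge_self] simp: abs_mult\<close>)
qed

text \<open>
  The densities \<open>f\<^sup>+\<close> and \<open>f\<^sup>-\<close> define finite measures that agree on bumps, hence on the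
  set where \<open>f > 0\<close>; there the second measure vanishes, so the first does.
\<close>
lemma fundamental_lemma_box:
  fixes f :: "complex \<Rightarrow> real"
  assumes f: "integrable lborel f"
    and test: "\<And>\<phi>. test_fun (cbox p q) \<phi> \<Longrightarrow> (LINT z|lborel. \<phi> z * f z) = 0"
  shows "AE z in lborel. z \<in> box p q \<longrightarrow> f z \<le> 0"
proof -
  define M where "M = density lborel (\<lambda>z. ennreal (max 0 (f z)))"
  define N where "N = density lborel (\<lambda>z. ennreal (max 0 (- f z)))"
  have fm[measurable]: "f \<in> borel_measurable borel" using borel_measurable_integrable[OF f] by simp
  have fp: "integrable lborel (\<lambda>z. max 0 (f z))" "integrable lborel (\<lambda>z. max 0 (- f z))"
    using f by (auto intro!: Bochner_Integration.integrable_max)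
  have fin: "finite_measure M" "finite_measure N"
    unfolding M_def N_def using fp
    by (auto intro!: finite_measureI simp: emeasure_density integrable_iff_bounded)
  have sets: "sets M = sets borel" "sets N = sets borel" by (auto simp: M_def N_def)
  have tst: "(LINT z|M. \<phi> z) = (LINT z|N. \<phi> z)" if "test_fun (cbox p q) \<phi>" for \<phi>
  proof -
    have [measurable]: "\<phi> \<in> borel_measurable borel"
      by (intro borel_measurable_continuous_onI test_fun_continuous[OF that])
    have "(LINT z|M. \<phi> z) = (LINT z|lborel. \<phi> z * max 0 (f z))"
         "(LINT z|N. \<phi> z) = (LINT z|lborel. \<phi> z * max 0 (- f z))"
      unfolding M_def N_def by (subst integral_density; simp add: mult.commute)+
    moreover have "(LINT z|lborel. \<phi> z * max 0 (f z)) - (LINT z|lborel. \<phi> z * max 0 (- f z)) =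
        (LINT z|lborel. \<phi> z * f z)"
      using test_integrable[OF fp(1) that] test_integrable[OF fp(2) that]
      by (subst Bochner_Integration.integral_diff[symmetric])
        (auto intro!: Bochner_Integration.integral_cong simp: max_def algebra_simps simp del: Bochner_Integration.integral_diff)
    ultimately show ?thesis using test[OF that] by simp
  qed
  let ?A = "{z \<in> box p q. 0 < f z}"
  have A: "?A \<in> sets borel" by measurable
  have "emeasure M ?A = emeasure N ?A"
  proof (rule emeasure_eq_if_bumps_agree[OF fin sets _ A])
    show "?A \<subseteq> box (Complex (Re p) (Im p)) (Complex (Re q) (Im q))" by auto
    fix e a b c d :: real assume "0 < e" "Re p \<le> a" "a < b" "b \<le> Re q" "Im p \<le> c" "c < d" "d \<le> Im q"
    then have "test_fun (cbox p q) (\<lambda>z. bump e a b (Re z) * bump e c d (Im z))"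
      by (intro test_fun_box_bump) (auto simp: in_cbox_complex_iff)
    then show "(LINT z|M. bump e a b (Re z) * bump e c d (Im z)) =
        (LINT z|N. bump e a b (Re z) * bump e c d (Im z))"
      by (rule tst)
  qed
  also have "emeasure N ?A = 0"
    using A unfolding N_def by (subst emeasure_density) (auto simp: nn_integral_0_iff_AE indicator_def)
  finally have "AE z in lborel. ennreal (max 0 (f z)) * indicator ?A z = 0"
    using A unfolding M_def by (subst (asm) emeasure_density) (auto simp: nn_integral_0_iff_AE)
  then show ?thesis
    by eventually_elim (auto simp: indicator_def max_def split: if_splits)
qed

text \<open>
  By the Lindelof property countably many of the neighbourhoods suffice, and countably many null sets
  have a null union.
\<close>
lemma AE_open_local:
  fixes P :: "'a::euclidean_space \<Rightarrow> bool"
  assumes "\<And>x. x \<in> U \<Longrightarrow> \<exists>V. open V \<and> x \<in> V \<and> (AE z in lborel. z \<in> V \<longrightarrow> P z)"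
  shows "AE z in lborel. z \<in> U \<longrightarrow> P z"
proof -
  let ?F = "{V. open V \<and> (AE z in lborel. z \<in> V \<longrightarrow> P z)}"
  obtain F where F: "F \<subseteq> ?F" "countable F" "\<Union>F = \<Union>?F"
    using Lindelof[of ?F] by blast
  have sub: "U \<subseteq> \<Union>F" using assms F(3) by blast
  have "AE z in lborel. \<forall>V\<in>F. z \<in> V \<longrightarrow> P z"
    using AE_ball_countable[OF F(2), where P="\<lambda>z V. z \<in> V \<longrightarrow> P z"] F(1) by blast
  then show ?thesis by eventually_elim (use sub in blast)
qed

text \<open>
  The fundamental lemma of the calculus of variations, from the box version applied to \<open>f\<close> and \<open>-f\<close>.
\<close>
lemma fundamental_lemma:
  fixes f :: "complex \<Rightarrow> real"
  assumes U: "open U" and f: "integrable lborel f"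
    and test: "\<And>\<phi>. test_fun U \<phi> \<Longrightarrow> (LINT z|lborel. \<phi> z * f z) = 0"
  shows "AE z in lborel. z \<in> U \<longrightarrow> f z = 0"
proof (rule AE_open_local)
  fix x assume "x \<in> U"
  then obtain p q where pq: "cbox p q \<subseteq> U" "x \<in> box p q" by (rule open_contains_cbox[OF U])
  have "AE z in lborel. z \<in> box p q \<longrightarrow> f z \<le> 0"
    using f test test_fun_mono[OF _ pq(1)] by (intro fundamental_lemma_box) auto
  moreover have "AE z in lborel. z \<in> box p q \<longrightarrow> - f z \<le> 0"
    using f test test_fun_mono[OF _ pq(1)] by (intro fundamental_lemma_box) auto
  ultimately have "AE z in lborel. z \<in> box p q \<longrightarrow> f z = 0" by eventually_elim auto
  then show "\<exists>V. open V \<and> x \<in> V \<and> (AE z in lborel. z \<in> V \<longrightarrow> f z = 0)"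
    using pq(2) by (intro exI[of _ "box p q"]) auto
qed

text \<open>
  The change of variables theorem is stated for the spaces \<open>real^'n\<close>; this transports it to \<open>complex\<close>.
\<close>
section \<open>Lebesgue measure on the complex plane\<close>

lemma lborel_complex_vec2: "(lborel :: complex measure) = distr lborel borel (\<lambda>x::real^2. Complex (x $ 1) (x $ 2))"
proof (rule lborel_eqI)
  fix l u :: complex assume lu: "\<And>b. b \<in> Basis \<Longrightarrow> l \<bullet> b \<le> u \<bullet> b"
  have le: "Re l \<le> Re u" "Im l \<le> Im u" using lu[of 1] lu[of \<i>] by (auto simp: Basis_complex_def)
  let ?T = "\<lambda>x::real^2. Complex (x $ 1) (x $ 2)"
  have [measurable]: "?T \<in> borel \<rightarrow>\<^sub>M borel"
    by (intro borel_measurable_continuous_onI continuous_on_Complex continuous_intros)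
  have "?T -` box l u = box (vector [Re l, Im l]) (vector [Re u, Im u])"
    by (auto simp: in_box_complex_iff mem_box_cart forall_2)
  moreover have B: "(Basis :: (real^2) set) = {axis 1 1, axis 2 1}" "axis 1 1 \<noteq> (axis 2 1 :: real^2)"
    by (auto simp: Basis_vec_def axis_eq_axis) (metis exhaust_2)
  have "(\<forall>b\<in>Basis. vector [Re l, Im l] \<bullet> b \<le> (vector [Re u, Im u] :: real^2) \<bullet> b)"
    unfolding B using le by (simp add: inner_axis)
  moreover have "(\<Prod>b\<in>Basis. (vector [Re u, Im u] - vector [Re l, Im l] :: real^2) \<bullet> b) = (Re u - Re l) * (Im u - Im l)"
    unfolding B by (subst prod.insert) (use B(2) in \<open>auto simp: inner_axis\<close>)
  ultimately show "emeasure (distr lborel borel ?T) (box l u) = (\<Prod>b\<in>Basis. (u - l) \<bullet> b)"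
    by (simp add: emeasure_distr emeasure_lborel_box_eq Basis_complex_def)
qed simp

lemma lborel_complex_pair:
  "(lborel :: complex measure) = distr (lborel \<Otimes>\<^sub>M lborel) borel (\<lambda>(x, y). Complex x y)"
proof (rule lborel_eqI)
  fix l u :: complex assume lu: "\<And>b. b \<in> Basis \<Longrightarrow> l \<bullet> b \<le> u \<bullet> b"
  have le: "Re l \<le> Re u" "Im l \<le> Im u" using lu[of 1] lu[of \<i>] by (auto simp: Basis_complex_def)
  let ?T = "\<lambda>(x, y). Complex x y"
  have [measurable]: "?T \<in> borel \<rightarrow>\<^sub>M borel"
    by (intro borel_measurable_continuous_onI) (auto intro!: continuous_on_Complex continuous_intros simp: case_prod_unfold)
  have eq: "?T -` box l u = {Re l<..<Re u} \<times> {Im l<..<Im u}"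
    by (auto simp: in_box_complex_iff)
  have "emeasure (distr (lborel \<Otimes>\<^sub>M lborel) borel ?T) (box l u) =
      emeasure (lborel \<Otimes>\<^sub>M lborel) ({Re l<..<Re u} \<times> {Im l<..<Im u})"
    by (subst emeasure_distr) (auto simp: eq lborel_prod)
  also have "\<dots> = ennreal (Re u - Re l) * ennreal (Im u - Im l)"
    using le by (subst lborel.emeasure_pair_measure_Times) auto
  finally show "emeasure (distr (lborel \<Otimes>\<^sub>M lborel) borel ?T) (box l u) = (\<Prod>b\<in>Basis. (u - l) \<bullet> b)"
    using le by (simp add: Basis_complex_def ennreal_mult)
qed simp

lemma lebesgue_integral_product_complex:
  fixes a b :: "real \<Rightarrow> real"
  assumes a: "integrable lborel a" and b: "integrable lborel b"
  shows "integrable lborel (\<lambda>z. a (Re z) * b (Im z))"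
    and "(LINT z|lborel. a (Re z) * b (Im z)) = (LINT x|lborel. a x) * (LINT y|lborel. b y)"
proof -
  let ?T = "\<lambda>(x, y). Complex x y"
  have T[measurable]: "?T \<in> lborel \<Otimes>\<^sub>M lborel \<rightarrow>\<^sub>M borel"
    unfolding lborel_prod measurable_lborel2
    by (intro borel_measurable_continuous_onI) (auto intro!: continuous_on_Complex continuous_intros simp: case_prod_unfold)
  have [measurable]: "a \<in> borel_measurable borel" "b \<in> borel_measurable borel"
    using a b by (auto dest: borel_measurable_integrable)
  have m: "(\<lambda>z. a (Re z) * b (Im z)) \<in> borel_measurable borel" by measurable
  have i: "integrable (lborel \<Otimes>\<^sub>M lborel) (\<lambda>(x, y). a x * b y)"
  proof (rule lborel_pair.Fubini_integrable)
    show "(\<lambda>(x, y). a x * b y) \<in> borel_measurable (lborel \<Otimes>\<^sub>M lborel)" by measurable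
    have "(\<lambda>x. LINT y|lborel. norm (case (x, y) of (x, y) \<Rightarrow> a x * b y)) = (\<lambda>x. norm (a x) * (LINT y|lborel. norm (b y)))"
      by (simp add: abs_mult)
    then show "integrable lborel (\<lambda>x. LINT y|lborel. norm (case (x, y) of (x, y) \<Rightarrow> a x * b y))"
      using a by simp
  qed (use b in auto)
  show "integrable lborel (\<lambda>z. a (Re z) * b (Im z))"
    unfolding lborel_complex_pair using i by (subst integrable_distr_eq[OF T m]) (simp add: case_prod_unfold)
  have "(LINT z|lborel. a (Re z) * b (Im z)) = integral\<^sup>L (lborel \<Otimes>\<^sub>M lborel) (\<lambda>(x, y). a x * b y)"
    unfolding lborel_complex_pair by (subst integral_distr[OF T m]) (simp add: case_prod_unfold)
  also have "\<dots> = (LINT x|lborel. LINT y|lborel. a x * b y)"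
    using lborel_pair.integral_fst'[OF i] by simp
  finally show "(LINT z|lborel. a (Re z) * b (Im z)) = (LINT x|lborel. a x) * (LINT y|lborel. b y)" by simp
qed

text \<open>
  The real Jacobian of a holomorphic map is \<open>\<bar>g'\<bar>\<^sup>2\<close> by the Cauchy-Riemann equations. The proof
  moves to \<open>real^2\<close> and back; the values of the integrand in \<open>real^1\<close> are those of the multivariate theorem.
\<close>
lemma conformal_change_of_variables:
  fixes F :: "complex \<Rightarrow> real"
  assumes S: "open S" and g: "g holomorphic_on S" and inj: "inj_on g S"
    and F: "integrable lborel (\<lambda>\<zeta>. indicator (g ` S) \<zeta> * F \<zeta>)"
  shows "(LINT z|lborel. indicator S z * ((norm (deriv g z))\<^sup>2 * F (g z))) = (LINT \<zeta>|lborel. indicator (g ` S) \<zeta> * F \<zeta>)"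
proof -
  let ?T = "\<lambda>x::real^2. Complex (x $ 1) (x $ 2)"
  let ?I = "\<lambda>z. vector [Re z, Im z] :: real^2"
  have TI: "?T (?I z) = z" for z by simp
  have IT: "?I (?T x) = x" for x by (simp add: vec_eq_iff forall_2)
  have T: "?T \<in> lborel \<rightarrow>\<^sub>M borel"
    unfolding measurable_lborel2
    by (intro borel_measurable_continuous_onI continuous_on_Complex continuous_intros)
  have linT: "bounded_linear ?T"
    by (intro linear_conv_bounded_linear[THEN iffD1] linearI) (auto simp: complex_eq_iff)
  have linI: "bounded_linear ?I"
    by (intro linear_conv_bounded_linear[THEN iffD1] linearI) (auto simp: vec_eq_iff forall_2)
  let ?S = "?T -` S" and ?g = "\<lambda>x. ?I (g (?T x))"
  let ?g' = "\<lambda>x v. ?I (deriv g (?T x) * ?T v)"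
  let ?f = "\<lambda>x. vec (F (?T x)) :: real^1"
  have oS: "open ?S"
    using S by (intro open_vimage continuous_on_Complex continuous_intros)
  have oG: "open (g ` S)" using open_mapping_thm3[OF g S inj] .
  have img: "?g ` ?S = ?T -` (g ` S)"
  proof (intro set_eqI iffI)
    fix y assume "y \<in> ?T -` (g ` S)"
    then obtain z where z: "z \<in> S" "?T y = g z" by auto
    have "y = ?I (?T y)" by (rule IT[symmetric])
    also have "\<dots> = ?g (?I z)" unfolding z(2) TI ..
    finally show "y \<in> ?g ` ?S" using z(1) TI by (intro image_eqI[where x="?I z"]) auto
  next
    fix y assume "y \<in> ?g ` ?S"
    then show "y \<in> ?T -` (g ` S)" by (auto simp: TI)
  qed
  have der: "(?g has_derivative ?g' x) (at x within ?S)" if "x \<in> ?S" for x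
  proof -
    have "(g has_derivative (\<lambda>v. deriv g (?T x) * v)) (at (?T x))"
      using holomorphic_derivI[OF g S] that by (simp add: has_field_derivative_def)
    then have "((\<lambda>x. g (?T x)) has_derivative (\<lambda>v. deriv g (?T x) * ?T v)) (at x within ?S)"
      using has_derivative_compose[OF bounded_linear_imp_has_derivative[OF linT], of g] by blast
    then show ?thesis by (rule bounded_linear.has_derivative[OF linI])
  qed
  have injg: "inj_on ?g ?S"
  proof (rule inj_onI)
    fix x y assume xy: "x \<in> ?S" "y \<in> ?S" "?g x = ?g y"
    have "g (?T x) = g (?T y)" using arg_cong[OF xy(3), of ?T] unfolding TI .
    then have "?T x = ?T y" using inj xy(1,2) by (simp add: inj_on_eq_iff)
    then have "?I (?T x) = ?I (?T y)" by (rule arg_cong)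
    then show "x = y" unfolding IT .
  qed
  have det: "\<bar>det (matrix (?g' x))\<bar> = (norm (deriv g (?T x)))\<^sup>2" for x
    unfolding cmod_power2 by (simp add: det_2 matrix_def axis_def) (simp add: power2_eq_square)
  have Fm: "(\<lambda>\<zeta>. indicator (g ` S) \<zeta> * F \<zeta>) \<in> borel_measurable borel"
    using F by (auto dest: borel_measurable_integrable)
  have i1: "integrable lborel (\<lambda>x. indicator (?T -` (g ` S)) x * F (?T x))"
    using F unfolding lborel_complex_vec2 by (subst (asm) integrable_distr_eq[OF T Fm]) (simp add: indicator_vimage)
  have e1: "(LINT \<zeta>|lborel. indicator (g ` S) \<zeta> * F \<zeta>) = (LINT x|lborel. indicator (?T -` (g ` S)) x * F (?T x))"
    unfolding lborel_complex_vec2 by (subst integral_distr[OF T Fm]) (simp add: indicator_vimage)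
  have "(\<lambda>x. F (?T x)) absolutely_integrable_on (?T -` (g ` S))"
    using i1 by (simp add: set_integrable_def integrable_completion)
  then have fa: "?f absolutely_integrable_on (?T -` (g ` S))"
    by (subst absolutely_integrable_componentwise_iff) (auto simp: Basis_vec_def inner_axis)
  then have cv: "(\<lambda>x. \<bar>det (matrix (?g' x))\<bar> *\<^sub>R ?f (?g x)) absolutely_integrable_on ?S \<and>
      integral ?S (\<lambda>x. \<bar>det (matrix (?g' x))\<bar> *\<^sub>R ?f (?g x)) = integral (?T -` (g ` S)) ?f"
    using has_absolute_integral_change_of_variables[OF _ der injg, of ?f "integral (?T -` (g ` S)) ?f"] oS
    unfolding img by auto
  let ?F = "\<lambda>\<zeta>. indicator (g ` S) \<zeta> * F \<zeta>"
  let ?h = "\<lambda>z. indicator S z * ((norm (deriv g z))\<^sup>2 * F (g z))"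
  (* \<open>g\<close> and its derivative are unconstrained off \<open>S\<close>; measurability needs the versions
     that are \<open>0\<close> there *)
  have hm: "?h \<in> borel_measurable borel"
  proof -
    have "continuous_on S g" "continuous_on S (deriv g)"
      using g S by (auto intro: holomorphic_on_imp_continuous_on holomorphic_deriv)
    then have [measurable]: "(\<lambda>z. if z \<in> S then g z else 0) \<in> borel_measurable borel"
      "(\<lambda>z. if z \<in> S then deriv g z else 0) \<in> borel_measurable borel"
      using S by (auto intro!: borel_measurable_continuous_on_if)
    note Fm[measurable]
    have [measurable]: "S \<in> sets borel" using S by simp
    have "(\<lambda>z. indicator S z * ((norm (if z \<in> S then deriv g z else 0))\<^sup>2 * ?F (if z \<in> S then g z else 0)))
        \<in> borel_measurable borel"
      by measurable
    moreover have "(\<lambda>z. indicator S z * ((norm (if z \<in> S then deriv g z else 0))\<^sup>2 * ?F (if z \<in> S then g z else 0))) = ?h"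
      by (auto simp: indicator_def)
    ultimately show ?thesis by simp
  qed
  let ?k = "\<lambda>x. (norm (deriv g (?T x)))\<^sup>2 * F (g (?T x))"
  have vk: "(\<lambda>x. \<bar>det (matrix (?g' x))\<bar> *\<^sub>R ?f (?g x)) = (\<lambda>x. vec (?k x))"
    unfolding det TI by (auto simp: vec_eq_iff)
  have cv1: "(\<lambda>x. vec (?k x) :: real^1) absolutely_integrable_on ?S"
    and cv2: "integral ?S (\<lambda>x. vec (?k x) :: real^1) = integral (?T -` (g ` S)) ?f"
    using cv unfolding vk by auto
  have ak: "?k absolutely_integrable_on ?S"
    using absolutely_integrable_component[OF cv1, of "axis 1 1"] by (simp add: inner_axis)
  have aF: "(\<lambda>x. F (?T x)) absolutely_integrable_on (?T -` (g ` S))" by fact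
  have ek: "integral ?S ?k = integral (?T -` (g ` S)) (\<lambda>x. F (?T x))"
  proof -
    have "integral ?S ?k = integral ?S (\<lambda>x. vec (?k x) :: real^1) $ 1"
      using integral_component_eq_cart[of "\<lambda>x. vec (?k x) :: real^1" ?S 1]
        set_lebesgue_integral_eq_integral(1)[OF cv1] by simp
    also have "\<dots> = integral (?T -` (g ` S)) ?f $ 1" by (simp only: cv2)
    also have "\<dots> = integral (?T -` (g ` S)) (\<lambda>x. F (?T x))"
      using integral_component_eq_cart[of ?f "?T -` (g ` S)" 1]
        set_lebesgue_integral_eq_integral(1)[OF \<open>?f absolutely_integrable_on (?T -` (g ` S))\<close>] by simp
    finally show ?thesis .
  qed
  have hT: "(\<lambda>x. ?h (?T x)) \<in> borel_measurable lborel"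
    using measurable_compose[OF T hm] .
  have FT: "(\<lambda>x. ?F (?T x)) \<in> borel_measurable lborel"
    using measurable_compose[OF T Fm] .
  have "(LINT z|lborel. ?h z) = (LINT x|lborel. ?h (?T x))"
    unfolding lborel_complex_vec2 by (subst integral_distr[OF T hm]) simp
  also have "\<dots> = (LINT x|lebesgue. ?h (?T x))"
    by (rule integral_completion[OF hT, symmetric])
  also have "\<dots> = integral ?S ?k"
    using set_lebesgue_integral_eq_integral(2)[OF ak] by (simp add: set_lebesgue_integral_def indicator_vimage)
  also have "\<dots> = (LINT x|lebesgue. ?F (?T x))"
    unfolding ek using set_lebesgue_integral_eq_integral(2)[OF aF]
    by (simp add: set_lebesgue_integral_def indicator_vimage)
  also have "\<dots> = (LINT x|lborel. ?F (?T x))"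
    by (rule integral_completion[OF FT])
  also have "\<dots> = (LINT \<zeta>|lborel. ?F \<zeta>)"
    unfolding e1 by (simp add: indicator_vimage)
  finally show ?thesis .
qed

section \<open>Mollification\<close>

lemma compact_support_uniformly_continuous:
  fixes f :: "'a::{real_normed_vector, heine_borel} \<Rightarrow> 'b::real_normed_vector"
  assumes f: "continuous_on UNIV f" and K: "compact K" "\<And>x. x \<notin> K \<Longrightarrow> f x = 0" and e: "0 < e"
  obtains d where "0 < d" "\<And>x y. norm (x - y) < d \<Longrightarrow> norm (f x - f y) < e"
proof -
  let ?L = "{x + y |x y. x \<in> K \<and> y \<in> cball 0 1}"
  have L: "compact ?L" by (intro compact_sums K compact_cball)
  have "uniformly_continuous_on ?L f"
    using f by (intro compact_uniformly_continuous L) (rule continuous_on_subset, auto)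
  from uniformly_continuous_onE[OF this e]
  obtain d where d: "0 < d" "\<And>x y. x \<in> ?L \<Longrightarrow> y \<in> ?L \<Longrightarrow> dist y x < d \<Longrightarrow> dist (f y) (f x) < e"
    by blast
  have mem: "x \<in> ?L" if "z \<in> K" "norm (x - z) \<le> 1" for x z
  proof -
    have "x = z + (x - z) \<and> z \<in> K \<and> x - z \<in> cball 0 1" using that by simp
    then show ?thesis by blast
  qed
  show thesis
  proof (rule that[of "min d 1"])
    fix x y :: 'a assume n: "norm (x - y) < min d 1"
    show "norm (f x - f y) < e"
    proof (cases "x \<in> K \<or> y \<in> K")
      case True
      then have "x \<in> ?L" "y \<in> ?L"
        using mem[of x x] mem[of x y] mem[of y x] mem[of y y] n
        by (auto simp: norm_minus_commute)
      then show ?thesis using d(2)[of y x] n by (simp add: dist_norm)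
    qed (use K(2) e in auto)
  qed (use d in auto)
qed

lemma dir_deriv_complex:
  fixes f :: "complex \<Rightarrow> 'b::real_normed_vector"
  assumes "f differentiable (at x)"
  shows "dir_deriv v f x = Re v *\<^sub>R dir_deriv 1 f x + Im v *\<^sub>R dir_deriv \<i> f x"
proof -
  have lin: "linear (\<lambda>v. dir_deriv v f x)"
    using has_derivative_dir_deriv[OF assms] by (rule has_derivative_linear)
  have "dir_deriv (Re v *\<^sub>R 1 + Im v *\<^sub>R \<i>) f x = Re v *\<^sub>R dir_deriv 1 f x + Im v *\<^sub>R dir_deriv \<i> f x"
    by (simp only: linear_add[OF lin] linear_scale[OF lin])
  moreover have "Re v *\<^sub>R 1 + Im v *\<^sub>R \<i> = v" by (simp add: complex_eq_iff)
  ultimately show ?thesis by simp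
qed

text \<open>
  Compact support makes both partial derivatives uniformly continuous, and the mean value
  inequality turns that into a linearization error that is uniform in the base point.
\<close>
lemma uniform_linearization:
  fixes k :: "complex \<Rightarrow> real"
  assumes k: "smooth_on UNIV k" and K: "compact K" "\<And>x. x \<notin> K \<Longrightarrow> k x = 0" and e: "0 < e"
  obtains d where "0 < d" "\<And>x v. norm v < d \<Longrightarrow> \<bar>k (x + v) - k x - dir_deriv v k x\<bar> \<le> e * norm v"
proof -
  have supp: "x \<notin> K \<Longrightarrow> dir_deriv v k x = 0" for v x
    by (rule dir_deriv_eq_0[OF compact_imp_closed[OF K(1)] K(2)])
  have ct: "continuous_on UNIV (dir_deriv v k)" for v
    by (rule smooth_on_continuous[OF smooth_on_dir_deriv[OF k]])
  obtain d1 where d1: "0 < d1" "\<And>x y. norm (x - y) < d1 \<Longrightarrow> norm (dir_deriv 1 k x - dir_deriv 1 k y) < e / 2"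
    using compact_support_uniformly_continuous[OF ct K(1) supp, of "e/2" 1] e by auto
  obtain d2 where d2: "0 < d2" "\<And>x y. norm (x - y) < d2 \<Longrightarrow> norm (dir_deriv \<i> k x - dir_deriv \<i> k y) < e / 2"
    using compact_support_uniformly_continuous[OF ct K(1) supp, of "e/2" \<i>] e by auto
  have diff: "k differentiable (at x)" for x using smooth_on_differentiable[OF k] by auto
  show thesis
  proof (rule that[of "min d1 d2"])
    fix x v :: complex assume v: "norm v < min d1 d2"
    have "norm (k (x + v) - k x - dir_deriv (x + v - x) k x) \<le> norm (x + v - x) * e"
    proof (rule differentiable_bound_linearization[where S="ball x (min d1 d2)" and f'="\<lambda>x v. dir_deriv v k x"])
      show "x + t *\<^sub>R (x + v - x) \<in> ball x (min d1 d2)" if "t \<in> {0..1}" for t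
      proof -
        have "t * norm v \<le> norm v" using that by (simp add: mult_left_le_one_le)
        then show ?thesis using v that by (simp add: dist_norm)
      qed
      show "(k has_derivative (\<lambda>v. dir_deriv v k y)) (at y within ball x (min d1 d2))" for y
        using has_derivative_dir_deriv[OF diff] by (rule has_derivative_at_withinI)
      show "x \<in> ball x (min d1 d2)" using d1 d2 by simp
      show "onorm ((\<lambda>v. dir_deriv v k y) - (\<lambda>v. dir_deriv v k x)) \<le> e" if y: "y \<in> ball x (min d1 d2)" for y
      proof (rule onorm_le)
        fix w :: complex
        have "\<bar>dir_deriv w k y - dir_deriv w k x\<bar> =
            \<bar>Re w * (dir_deriv 1 k y - dir_deriv 1 k x) + Im w * (dir_deriv \<i> k y - dir_deriv \<i> k x)\<bar>"
          using dir_deriv_complex[OF diff[of y], of w] dir_deriv_complex[OF diff[of x], of w]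
          by (simp add: algebra_simps)
        also have "\<dots> \<le> \<bar>Re w\<bar> * \<bar>dir_deriv 1 k y - dir_deriv 1 k x\<bar> + \<bar>Im w\<bar> * \<bar>dir_deriv \<i> k y - dir_deriv \<i> k x\<bar>"
          by (rule order_trans[OF abs_triangle_ineq]) (simp add: abs_mult)
        also have "\<dots> \<le> norm w * (e / 2) + norm w * (e / 2)"
          using d1(2)[of y x] d2(2)[of y x] y
          by (intro add_mono mult_mono abs_Re_le_cmod abs_Im_le_cmod) (auto simp: dist_norm norm_minus_commute)
        finally show "norm (((\<lambda>v. dir_deriv v k y) - (\<lambda>v. dir_deriv v k x)) w) \<le> e * norm w" by simp
      qed
    qed
    then show "\<bar>k (x + v) - k x - dir_deriv v k x\<bar> \<le> e * norm v" by (simp add: mult.commute)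
  qed (use d1 d2 in auto)
qed

lemma integrable_bounded_scaleR:
  fixes f :: "complex \<Rightarrow> 'b::{banach, second_countable_topology}" and k :: "complex \<Rightarrow> real"
  assumes f: "integrable lborel f" and k: "k \<in> borel_measurable borel" and B: "\<And>x. \<bar>k x\<bar> \<le> B"
  shows "integrable lborel (\<lambda>w. k w *\<^sub>R f w)"
proof (rule Bochner_Integration.integrable_bound[OF integrable_scaleR_right[OF integrable_norm[OF f], of B]])
  show "(\<lambda>w. k w *\<^sub>R f w) \<in> borel_measurable lborel"
    using k f by (auto dest: borel_measurable_integrable)
  show "AE w in lborel. norm (k w *\<^sub>R f w) \<le> norm (B *\<^sub>R norm (f w))"
    by (rule AE_I2) (use B in \<open>auto intro!: mult_right_mono order_trans[OF B abs_ge_self] simp: abs_mult\<close>)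
qed

lemma mollify_integrable:
  fixes f :: "complex \<Rightarrow> 'b::{banach, second_countable_topology}" and k :: "complex \<Rightarrow> real"
  assumes f: "integrable lborel f" and k: "continuous_on UNIV k" and K: "compact K" "\<And>x. x \<notin> K \<Longrightarrow> k x = 0"
  shows "integrable lborel (\<lambda>w. k (z - w) *\<^sub>R f w)"
proof -
  obtain B where "\<And>z. norm (k z) \<le> B" using compact_support_bounded[OF k K] by blast
  moreover have "(\<lambda>w. k (z - w)) \<in> borel_measurable borel"
    by (intro borel_measurable_continuous_onI continuous_on_compose2[OF k] continuous_intros) auto
  ultimately show ?thesis by (intro integrable_bounded_scaleR[OF f]) auto
qed

text \<open>
  Differentiation under the integral sign. The error in the difference quotient is bounded by the
  uniform linearization error of the kernel times the integral of \<open>norm f\<close>.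
\<close>
lemma mollify_has_derivative:
  fixes f :: "complex \<Rightarrow> 'b::{banach, second_countable_topology}" and k :: "complex \<Rightarrow> real"
  assumes f: "integrable lborel f"
    and k: "smooth_on UNIV k" and K: "compact K" "\<And>x. x \<notin> K \<Longrightarrow> k x = 0"
  shows "((\<lambda>z. LINT w|lborel. k (z - w) *\<^sub>R f w) has_derivative
      (\<lambda>v. LINT w|lborel. dir_deriv v k (z - w) *\<^sub>R f w)) (at z)"
proof -
  have diff: "k differentiable (at x)" for x using smooth_on_differentiable[OF k] by auto
  have supp: "x \<notin> K \<Longrightarrow> dir_deriv v k x = 0" for v x
    by (rule dir_deriv_eq_0[OF compact_imp_closed[OF K(1)] K(2)])
  have ct: "continuous_on UNIV (dir_deriv v k)" for v
    by (rule smooth_on_continuous[OF smooth_on_dir_deriv[OF k]])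
  have i0: "integrable lborel (\<lambda>w. k (z - w) *\<^sub>R f w)" for z
    by (rule mollify_integrable[OF f smooth_on_continuous[OF k] K])
  have i1: "integrable lborel (\<lambda>w. dir_deriv v k (z - w) *\<^sub>R f w)" for z v
    by (rule mollify_integrable[OF f ct K(1) supp])
  let ?D = "\<lambda>v. LINT w|lborel. dir_deriv v k (z - w) *\<^sub>R f w"
  have D: "?D v = Re v *\<^sub>R ?D 1 + Im v *\<^sub>R ?D \<i>" for v
  proof -
    have "?D v = (LINT w|lborel. Re v *\<^sub>R (dir_deriv 1 k (z - w) *\<^sub>R f w) + Im v *\<^sub>R (dir_deriv \<i> k (z - w) *\<^sub>R f w))"
      by (subst dir_deriv_complex[OF diff, of v]) (simp add: scaleR_add_left)
    also have "\<dots> = Re v *\<^sub>R ?D 1 + Im v *\<^sub>R ?D \<i>"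
      using i1[of 1 z] i1[of \<i> z]
      by (subst Bochner_Integration.integral_add) (auto simp del: scaleR_scaleR)
    finally show ?thesis .
  qed
  show ?thesis
    unfolding has_derivative_at_alt
  proof (intro conjI allI impI)
    have "bounded_linear (\<lambda>v. Re v *\<^sub>R ?D 1 + Im v *\<^sub>R ?D \<i>)"
      by (intro bounded_linear_add bounded_linear_compose[OF bounded_linear_scaleR_left] bounded_linear_Re bounded_linear_Im)
    then show "bounded_linear ?D" unfolding D[symmetric] .
  next
    fix e :: real assume e: "0 < e"
    let ?N = "LINT w|lborel. norm (f w)"
    have N: "0 \<le> ?N" by simp
    then have N1: "0 < ?N + 1" by linarith
    define e' where "e' = e / (?N + 1)"
    have e': "0 < e'" unfolding e'_def using e N1 by (rule divide_pos_pos)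
    have "e' * ?N \<le> e' * (?N + 1)" using e' by (intro mult_left_mono) auto
    also have "\<dots> = e" using N1 by (simp add: e'_def)
    finally have e'N: "e' * ?N \<le> e" .
    obtain d where d: "0 < d" "\<And>x v. norm v < d \<Longrightarrow> \<bar>k (x + v) - k x - dir_deriv v k x\<bar> \<le> e' * norm v"
      using uniform_linearization[OF k K e'] by blast
    show "\<exists>d>0. \<forall>y. norm (y - z) < d \<longrightarrow> norm ((LINT w|lborel. k (y - w) *\<^sub>R f w) -
        (LINT w|lborel. k (z - w) *\<^sub>R f w) - ?D (y - z)) \<le> e * norm (y - z)"
    proof (intro exI[of _ d] conjI allI impI d(1))
      fix y assume y: "norm (y - z) < d"
      have "(LINT w|lborel. k (y - w) *\<^sub>R f w) - (LINT w|lborel. k (z - w) *\<^sub>R f w) - ?D (y - z) =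
          (LINT w|lborel. (k (y - w) - k (z - w) - dir_deriv (y - z) k (z - w)) *\<^sub>R f w)"
        by (simp only: scaleR_diff_left Bochner_Integration.integral_diff i0 i1 Bochner_Integration.integrable_diff)
      also have "norm \<dots> \<le> (LINT w|lborel. (e' * norm (y - z)) * norm (f w))"
      proof (rule Bochner_Integration.integral_norm_bound_integral)
        show "integrable lborel (\<lambda>w. (k (y - w) - k (z - w) - dir_deriv (y - z) k (z - w)) *\<^sub>R f w)"
          by (simp only: scaleR_diff_left i0 i1 Bochner_Integration.integrable_diff)
        show "integrable lborel (\<lambda>w. (e' * norm (y - z)) * norm (f w))" using f by simp
        show "norm ((k (y - w) - k (z - w) - dir_deriv (y - z) k (z - w)) *\<^sub>R f w) \<le> (e' * norm (y - z)) * norm (f w)" for w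
          using d(2)[OF y, of "z - w"] by (auto intro!: mult_right_mono)
      qed
      also have "\<dots> = e' * ?N * norm (y - z)" by simp
      also have "\<dots> \<le> e * norm (y - z)" using e'N by (intro mult_right_mono) auto
      finally show "norm ((LINT w|lborel. k (y - w) *\<^sub>R f w) -
        (LINT w|lborel. k (z - w) *\<^sub>R f w) - ?D (y - z)) \<le> e * norm (y - z)" .
    qed
  qed
qed

lemma lborel_integral_reflect:
  fixes f :: "'a::euclidean_space \<Rightarrow> 'b::{banach, second_countable_topology}"
  assumes "f \<in> borel_measurable borel"
  shows "(LINT w|lborel. f (z - w)) = (LINT w|lborel. f w)"
    and "integrable lborel (\<lambda>w. f (z - w)) \<longleftrightarrow> integrable lborel f"
proof -
  have eq: "(lborel :: 'a measure) = distr lborel borel (\<lambda>w. z - w)"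
    using lborel_affine[of "-1" z] by (simp add: density_1 one_ennreal_def[symmetric])
  have m: "(\<lambda>w. z - w) \<in> lborel \<rightarrow>\<^sub>M borel" by simp
  show "(LINT w|lborel. f (z - w)) = (LINT w|lborel. f w)"
    by (subst (2) eq) (subst integral_distr[OF m assms], simp)
  show "integrable lborel (\<lambda>w. f (z - w)) \<longleftrightarrow> integrable lborel f"
    by (subst (2) eq) (subst integrable_distr_eq[OF m assms], simp)
qed

text \<open>
  An average of values within \<open>e\<close> of \<open>c\<close> is within \<open>e\<close> of \<open>c\<close>.
\<close>
lemma approximate_identity:
  fixes f :: "'a::euclidean_space \<Rightarrow> 'b::{banach, second_countable_topology}" and k :: "'a \<Rightarrow> real"
  assumes k: "integrable lborel k" "(LINT w|lborel. k w) = 1" "\<And>w. 0 \<le> k w"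
    and int: "integrable lborel (\<lambda>w. k (z - w) *\<^sub>R f w)"
    and close: "\<And>w. k (z - w) \<noteq> 0 \<Longrightarrow> norm (f w - c) \<le> e"
  shows "norm ((LINT w|lborel. k (z - w) *\<^sub>R f w) - c) \<le> e"
proof -
  have km: "k \<in> borel_measurable borel" using k(1) by (auto dest: borel_measurable_integrable)
  have k1: "integrable lborel (\<lambda>w. k (z - w))" "(LINT w|lborel. k (z - w)) = 1"
    using lborel_integral_reflect[OF km, of z] k by auto
  have "(LINT w|lborel. k (z - w) *\<^sub>R f w) - c = (LINT w|lborel. k (z - w) *\<^sub>R f w) - (LINT w|lborel. k (z - w) *\<^sub>R c)"
    using k1 by simp
  also have "\<dots> = (LINT w|lborel. k (z - w) *\<^sub>R f w - k (z - w) *\<^sub>R c)"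
    using int k1 by (intro Bochner_Integration.integral_diff[symmetric]) auto
  also have "norm \<dots> \<le> (LINT w|lborel. k (z - w) * e)"
  proof (rule Bochner_Integration.integral_norm_bound_integral)
    show "integrable lborel (\<lambda>w. k (z - w) *\<^sub>R f w - k (z - w) *\<^sub>R c)" using int k1 by auto
    show "integrable lborel (\<lambda>w. k (z - w) * e)" using k1 by auto
    show "norm (k (z - w) *\<^sub>R f w - k (z - w) *\<^sub>R c) \<le> k (z - w) * e" for w
      using close[of w] k(3)[of "z - w"]
      by (cases "k (z - w) = 0") (auto simp: scaleR_diff_right[symmetric] intro!: mult_left_mono)
  qed
  also have "\<dots> = e" using k1 by simp
  finally show ?thesis .
qed

lemma open_nonempty_not_null:
  fixes U :: "'a::euclidean_space set"
  assumes "open U" "x \<in> U" "AE z in lborel. z \<in> U \<longrightarrow> P z"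
  obtains z where "z \<in> U" "P z"
proof -
  have "\<exists>z\<in>U. P z"
  proof (rule ccontr)
    assume "\<not> (\<exists>z\<in>U. P z)"
    then have "AE z in lborel. z \<in> - U" using assms(3) by auto
    then have "AE z in lebesgue. z \<in> - U" by (rule AE_completion)
    then have "x \<in> - U" using assms(1) by (intro mem_closed_if_AE_lebesgue) auto
    then show False using assms(2) by simp
  qed
  then show ?thesis using that by blast
qed

lemma integrable_continuous_compact_support:
  fixes f :: "'a::euclidean_space \<Rightarrow> 'b::{banach, second_countable_topology}"
  assumes "continuous_on UNIV f" "compact K" "\<And>x. x \<notin> K \<Longrightarrow> f x = 0"
  shows "integrable lborel f"
proof -
  have "integrable lborel (\<lambda>x. indicator K x *\<^sub>R f x)"
    using borel_integrable_compact[OF assms(2) continuous_on_subset[OF assms(1)]] by simp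
  moreover have "(\<lambda>x. indicator K x *\<^sub>R f x) = f" using assms(3) by (auto simp: indicator_def)
  ultimately show ?thesis by simp
qed

lemma integral_continuous_nonneg_pos:
  fixes f :: "'a::euclidean_space \<Rightarrow> real"
  assumes f: "continuous_on UNIV f" and i: "integrable lborel f" and "\<And>x. 0 \<le> f x" "0 < f x0"
  shows "0 < (LINT x|lborel. f x)"
proof -
  have "(LINT x|lborel. f x) \<noteq> 0"
  proof
    assume "(LINT x|lborel. f x) = 0"
    then have "AE x in lborel. f x = 0"
      using integral_nonneg_eq_0_iff_AE[OF i] assms(3) by simp
    then have "AE x in lborel. x \<in> {x. 0 < f x} \<longrightarrow> f x = 0" by eventually_elim auto
    moreover have "open {x. 0 < f x}" using f by (intro open_Collect_less) (auto intro: continuous_on_const)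
    moreover have "x0 \<in> {x. 0 < f x}" using assms(4) by simp
    ultimately obtain x where "x \<in> {x. 0 < f x}" "f x = 0"
      using open_nonempty_not_null[of "{x. 0 < f x}" x0 "\<lambda>x. f x = 0"] by blast
    then show False by simp
  qed
  moreover have "0 \<le> (LINT x|lborel. f x)" using assms(3) by simp
  ultimately show ?thesis by simp
qed

text \<open>
  Integrals over the Lebesgue completion of \<open>\<Omega>\<close> are replaced once and for all by Borel integrals over the
  plane, where Fubini and translations are at hand.
\<close>
lemma lebesgue_on_representative:
  fixes f :: "complex \<Rightarrow> real"
  assumes \<Omega>: "open \<Omega>" and f: "integrable (lebesgue_on \<Omega>) f"
  obtains g where "integrable lborel g" "\<And>z. z \<notin> \<Omega> \<Longrightarrow> g z = 0" "AE z in lborel. z \<in> \<Omega> \<longrightarrow> g z = f z"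
    "\<And>\<phi>. \<phi> \<in> borel_measurable borel \<Longrightarrow> (LINT z|lebesgue_on \<Omega>. f z * \<phi> z) = (LINT z|lborel. \<phi> z * g z)"
proof -
  have S: "\<Omega> \<inter> space lebesgue \<in> sets lebesgue" "\<Omega> \<in> sets lborel" using \<Omega> by auto
  let ?f = "\<lambda>z. indicator \<Omega> z * f z"
  have i: "integrable lebesgue ?f" using f integrable_restrict_space[OF S(1), of f] by simp
  obtain g0 where g0: "g0 \<in> borel_measurable lborel" "AE z in lborel. ?f z = g0 z"
    using completion_ex_borel_measurable_real[OF borel_measurable_integrable[OF i]] by auto
  let ?g = "\<lambda>z. indicator \<Omega> z * g0 z"
  have gm: "?g \<in> borel_measurable lborel" using g0(1) S(2) by measurable
  have ae: "AE z in lborel. ?f z = ?g z" using g0(2) by eventually_elim (auto simp: indicator_def)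
  have ae': "AE z in lebesgue. ?f z = ?g z" using ae by (rule AE_completion)
  show thesis
  proof (rule that[of ?g])
    have "integrable lebesgue ?g"
      using i gm ae' by (subst integrable_cong_AE[of _ _ ?f]) (auto intro: measurable_completion)
    then show "integrable lborel ?g" using integrable_completion[OF gm] by simp
    show "AE z in lborel. z \<in> \<Omega> \<longrightarrow> ?g z = f z" using ae by eventually_elim auto
    fix \<phi> :: "complex \<Rightarrow> real" assume \<phi>: "\<phi> \<in> borel_measurable borel"
    have \<phi>g: "(\<lambda>z. \<phi> z * ?g z) \<in> borel_measurable lborel" using \<phi> gm by measurable
    have "(LINT z|lebesgue_on \<Omega>. f z * \<phi> z) = (LINT z|lebesgue. indicator \<Omega> z *\<^sub>R (f z * \<phi> z))"
      by (rule integral_restrict_space[OF S(1)])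
    also have "\<dots> = (LINT z|lebesgue. \<phi> z * ?g z)"
    proof (rule integral_cong_AE)
      show "(\<lambda>z. \<phi> z * ?g z) \<in> borel_measurable lebesgue" using \<phi>g by (rule measurable_completion)
      have "(\<lambda>z. ?f z * \<phi> z) \<in> borel_measurable lebesgue"
      proof -
        have "\<phi> \<in> borel_measurable lebesgue" using \<phi> by (intro measurable_completion) simp
        then show ?thesis by (rule borel_measurable_times[OF borel_measurable_integrable[OF i]])
      qed
      then show "(\<lambda>z. indicator \<Omega> z *\<^sub>R (f z * \<phi> z)) \<in> borel_measurable lebesgue"
        by (simp add: mult.assoc)
      show "AE z in lebesgue. indicator \<Omega> z *\<^sub>R (f z * \<phi> z) = \<phi> z * ?g z"
        using ae' by eventually_elim (simp add: algebra_simps)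
    qed
    also have "\<dots> = (LINT z|lborel. \<phi> z * ?g z)" by (rule integral_completion[OF \<phi>g])
    finally show "(LINT z|lebesgue_on \<Omega>. f z * \<phi> z) = (LINT z|lborel. \<phi> z * ?g z)" .
  qed auto
qed

text \<open>
  A radial mollifier supported in the annulus \<open>\<epsilon>/2 \<le> \<bar>z\<bar> \<le> \<epsilon>\<close> rather than in a disc: differences of
  two such kernels vanish near \<open>0\<close>, so that they can be divided by \<open>z\<close> without leaving the smooth
  functions.
\<close>
definition radial_kernel :: "real \<Rightarrow> complex \<Rightarrow> real" where
  "radial_kernel \<epsilon> z = bump 1 (1/4) 1 ((norm z)\<^sup>2 / \<epsilon>\<^sup>2) /
     (\<epsilon>\<^sup>2 * (LINT z|lborel. bump 1 (1/4) 1 ((norm (z::complex))\<^sup>2)))"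

lemma smooth_norm_square: "smooth_on UNIV (\<lambda>z::complex. (norm z)\<^sup>2)"
proof -
  have "smooth_on UNIV (\<lambda>z::complex. Re z * Re z + Im z * Im z)"
    by (intro smooth_on_mult smooth_on_add smooth_on_linear bounded_linear_Re bounded_linear_Im) auto
  then show ?thesis unfolding cmod_power2 unfolding power2_eq_square .
qed

lemma radial_profile_integral:
  "integrable lborel (\<lambda>z::complex. bump 1 (1/4) 1 ((norm z)\<^sup>2))"
  "0 < (LINT z|lborel. bump 1 (1/4) 1 ((norm (z::complex))\<^sup>2))"
proof -
  have c: "continuous_on UNIV (\<lambda>z::complex. bump 1 (1/4) 1 ((norm z)\<^sup>2))"
    by (intro continuous_on_compose2[OF continuous_bump[of 1 UNIV]] continuous_intros) auto
  show i: "integrable lborel (\<lambda>z::complex. bump 1 (1/4) 1 ((norm z)\<^sup>2))"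
  proof (rule integrable_continuous_compact_support[OF c compact_cball])
    fix z :: complex assume "z \<notin> cball 0 1"
    then have "1 \<le> (norm z)\<^sup>2" by (simp add: one_le_power)
    then show "bump 1 (1/4) 1 ((norm z)\<^sup>2) = 0" by (intro bump_eq_0) simp
  qed
  show "0 < (LINT z|lborel. bump 1 (1/4) 1 ((norm (z::complex))\<^sup>2))"
  proof (rule integral_continuous_nonneg_pos[OF c i bump_nonneg])
    show "0 < bump 1 (1/4) 1 ((norm (complex_of_real (3/4)))\<^sup>2)"
      by (intro bump_pos) (simp_all add: power2_eq_square)
  qed
qed

lemma radial_kernel:
  assumes \<epsilon>: "0 < \<epsilon>"
  shows smooth_radial_kernel: "smooth_on UNIV (radial_kernel \<epsilon>)"
    and radial_kernel_nonneg: "0 \<le> radial_kernel \<epsilon> z"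
    and radial_kernel_eq_0: "\<epsilon> \<le> norm z \<Longrightarrow> radial_kernel \<epsilon> z = 0"
    and radial_kernel_minus: "radial_kernel \<epsilon> (- z) = radial_kernel \<epsilon> z"
    and radial_kernel_integrable: "integrable lborel (radial_kernel \<epsilon>)"
    and radial_kernel_integral: "(LINT z|lborel. radial_kernel \<epsilon> z) = 1"
proof -
  let ?c = "LINT z|lborel. bump 1 (1/4) 1 ((norm (z::complex))\<^sup>2)"
  have "smooth_on UNIV (\<lambda>z::complex. bump 1 (1/4) 1 ((norm z)\<^sup>2 * (1 / \<epsilon>\<^sup>2)) * (1 / (\<epsilon>\<^sup>2 * ?c)))"
    by (intro smooth_on_mult smooth_on_const smooth_norm_square smooth_on_compose[OF _ _ _ smooth_bump]) auto
  then show sm: "smooth_on UNIV (radial_kernel \<epsilon>)"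
    unfolding radial_kernel_def[abs_def] by simp
  show "0 \<le> radial_kernel \<epsilon> z"
    using radial_profile_integral(2) \<epsilon> unfolding radial_kernel_def
    by (intro divide_nonneg_pos bump_nonneg) auto
  show z: "radial_kernel \<epsilon> z = 0" if "\<epsilon> \<le> norm z" for z
  proof -
    have "\<epsilon>\<^sup>2 \<le> (norm z)\<^sup>2" using that \<epsilon> by (intro power_mono) auto
    then show ?thesis using \<epsilon> unfolding radial_kernel_def by (subst bump_eq_0) auto
  qed
  show "radial_kernel \<epsilon> (- z) = radial_kernel \<epsilon> z" by (simp add: radial_kernel_def)
  show "integrable lborel (radial_kernel \<epsilon>)"
    by (rule integrable_continuous_compact_support[OF smooth_on_continuous[OF sm] compact_cball[of 0 \<epsilon>]]) (use z in auto)
  have "(LINT z|lborel. indicator UNIV z * ((norm (deriv (\<lambda>z. z / of_real \<epsilon>) z))\<^sup>2 * bump 1 (1/4) 1 ((norm (z / complex_of_real \<epsilon>))\<^sup>2))) =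
      (LINT \<zeta>|lborel. indicator ((\<lambda>z. z / complex_of_real \<epsilon>) ` UNIV) \<zeta> * bump 1 (1/4) 1 ((norm \<zeta>)\<^sup>2))"
  proof (rule conformal_change_of_variables)
    have "range (\<lambda>z. z / complex_of_real \<epsilon>) = UNIV"
    proof (intro equalityI subsetI)
      fix w :: complex show "w \<in> range (\<lambda>z. z / complex_of_real \<epsilon>)"
        using \<epsilon> by (intro image_eqI[where x="w * of_real \<epsilon>"]) auto
    qed auto
    then show "integrable lborel (\<lambda>\<zeta>. indicator ((\<lambda>z. z / complex_of_real \<epsilon>) ` UNIV) \<zeta> * bump 1 (1/4) 1 ((norm \<zeta>)\<^sup>2))"
      using radial_profile_integral(1) by simp
  qed (use \<epsilon> in \<open>auto intro!: holomorphic_intros simp: inj_on_def\<close>)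
  moreover have "range (\<lambda>z. z / complex_of_real \<epsilon>) = UNIV"
  proof (intro equalityI subsetI)
    fix w :: complex show "w \<in> range (\<lambda>z. z / complex_of_real \<epsilon>)"
      using \<epsilon> by (intro image_eqI[where x="w * of_real \<epsilon>"]) auto
  qed auto
  moreover have "deriv (\<lambda>z. z / complex_of_real \<epsilon>) z = 1 / of_real \<epsilon>" for z
    using \<epsilon> by (intro DERIV_imp_deriv) (auto intro!: derivative_eq_intros)
  ultimately have "(LINT z|lborel. (1 / \<epsilon>)\<^sup>2 * bump 1 (1/4) 1 ((norm (z / complex_of_real \<epsilon>))\<^sup>2)) = ?c"
    using \<epsilon> by (simp add: norm_divide)
  then have "(LINT z|lborel. (1 / \<epsilon>)\<^sup>2 * bump 1 (1/4) 1 ((norm (z / complex_of_real \<epsilon>))\<^sup>2)) / ?c = 1"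
    using radial_profile_integral(2) by simp
  moreover have "radial_kernel \<epsilon> = (\<lambda>z. ((1 / \<epsilon>)\<^sup>2 * bump 1 (1/4) 1 ((norm (z / complex_of_real \<epsilon>))\<^sup>2)) / ?c)"
    using \<epsilon> by (auto simp: radial_kernel_def norm_divide power_divide)
  ultimately show "(LINT z|lborel. radial_kernel \<epsilon> z) = 1" by (simp only: integral_divide_zero)
qed

section \<open>Weyl's lemma for the Cauchy-Riemann operator\<close>

lemma antiderivative_of_compact_support:
  fixes f :: "real \<Rightarrow> real"
  assumes f: "continuous_on UNIV f" and z: "\<And>t. t \<le> a \<Longrightarrow> f t = 0"
  shows "((\<lambda>t. integral {a..t} f) has_real_derivative f t) (at t)"
proof -
  define c where "c = min a t - 1"
  have c: "c < a" "c < t" by (auto simp: c_def)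
  have int: "f integrable_on {p..q}" for p q
    by (intro integrable_continuous_real continuous_on_subset[OF f]) auto
  have z': "integral {c..x} f = 0" if "x \<le> a" for x
    using z that by (subst integral_cong[where g="\<lambda>_. 0"]) auto
  have eq: "integral {c..x} f = integral {a..x} f" for x
  proof (cases "a \<le> x")
    case True
    then show ?thesis using Henstock_Kurzweil_Integration.integral_combine[of c a x f] int c z'[of a] by simp
  next
    case False
    then show ?thesis using z'[of x] by simp
  qed
  have "((\<lambda>x. integral {c..x} f) has_real_derivative f t) (at t within {c..t + 1})"
    using c by (intro integral_has_real_derivative continuous_on_subset[OF f]) auto
  moreover have "at t within {c..t + 1} = at t"
    using c by (intro at_within_interior) auto
  ultimately show ?thesis by (simp add: eq)
qed

lemma dir_deriv_reflect:
  fixes k :: "complex \<Rightarrow> real"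
  assumes "smooth_on UNIV k"
  shows "dir_deriv v (\<lambda>\<zeta>. k (z - \<zeta>)) \<zeta> = - dir_deriv v k (z - \<zeta>)"
proof -
  have d: "((\<lambda>\<zeta>. z - \<zeta>) has_derivative (\<lambda>v. - v)) (at \<zeta>)" by (auto intro!: derivative_eq_intros)
  have k: "(k has_derivative (\<lambda>v. dir_deriv v k (z - \<zeta>))) (at (z - \<zeta>))"
    by (rule smooth_on_has_derivative[OF assms]) simp
  have "dir_deriv v (\<lambda>\<zeta>. k (z - \<zeta>)) \<zeta> = dir_deriv (- v) k (z - \<zeta>)"
    by (rule dir_deriv_eqI[OF has_derivative_compose[OF d k]])
  also have "\<dots> = - dir_deriv v k (z - \<zeta>)"
    by (rule linear_neg[OF has_derivative_linear[OF k]])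
  finally show ?thesis .
qed

lemma dir_deriv_translate:
  fixes k :: "complex \<Rightarrow> 'b::real_normed_vector"
  assumes "smooth_on UNIV k"
  shows "dir_deriv v (\<lambda>\<zeta>. k (\<zeta> - z)) \<zeta> = dir_deriv v k (\<zeta> - z)"
proof -
  have d: "((\<lambda>\<zeta>. \<zeta> - z) has_derivative (\<lambda>v. v)) (at \<zeta>)" by (auto intro!: derivative_eq_intros)
  have k: "(k has_derivative (\<lambda>v. dir_deriv v k (\<zeta> - z))) (at (\<zeta> - z))"
    by (rule smooth_on_has_derivative[OF assms]) simp
  show ?thesis by (rule dir_deriv_eqI[OF has_derivative_compose[OF d k]])
qed

lemma smooth_on_reflect: "smooth_on UNIV (k :: complex \<Rightarrow> 'b::real_normed_vector) \<Longrightarrow> smooth_on UNIV (\<lambda>\<zeta>. k (z - \<zeta>))"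
  using smooth_on_compose[of UNIV UNIV "\<lambda>\<zeta>. z - \<zeta>" k, OF _ _ smooth_on_diff[OF _ smooth_on_const smooth_on_id]]
  by simp

lemma smooth_on_translate: "smooth_on UNIV (k :: complex \<Rightarrow> 'b::real_normed_vector) \<Longrightarrow> smooth_on UNIV (\<lambda>\<zeta>. k (\<zeta> - z))"
  using smooth_on_compose[of UNIV UNIV "\<lambda>\<zeta>. \<zeta> - z" k, OF _ _ smooth_on_diff[OF _ smooth_on_id smooth_on_const]]
  by simp

definition mollify :: "real \<Rightarrow> (complex \<Rightarrow> 'b::{banach, second_countable_topology}) \<Rightarrow> complex \<Rightarrow> 'b" where
  "mollify \<epsilon> w z = (LINT \<zeta>|lborel. radial_kernel \<epsilon> (z - \<zeta>) *\<^sub>R w \<zeta>)"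

lemma radial_kernel_outside: "0 < \<epsilon> \<Longrightarrow> z \<notin> cball 0 \<epsilon> \<Longrightarrow> radial_kernel \<epsilon> z = 0"
  by (simp add: radial_kernel_eq_0)

lemma mollify_deriv:
  assumes "0 < \<epsilon>" "integrable lborel w"
  shows "(mollify \<epsilon> w has_derivative (\<lambda>v. LINT \<zeta>|lborel. dir_deriv v (radial_kernel \<epsilon>) (z - \<zeta>) *\<^sub>R w \<zeta>)) (at z)"
  unfolding mollify_def[abs_def]
  by (rule mollify_has_derivative[OF assms(2) smooth_radial_kernel[OF assms(1)] compact_cball[of "0::complex" \<epsilon>]])
    (rule radial_kernel_outside[OF assms(1)])

lemma continuous_mollify:
  assumes "0 < \<epsilon>" "integrable lborel w" shows "continuous_on UNIV (mollify \<epsilon> w)"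
  by (intro continuous_at_imp_continuous_on ballI has_derivative_continuous[OF mollify_deriv[OF assms]])

lemma radial_kernel_test_fun:
  assumes "0 < \<epsilon>" "cball z \<epsilon> \<subseteq> \<Omega>" shows "test_fun \<Omega> (\<lambda>\<zeta>. radial_kernel \<epsilon> (z - \<zeta>))"
  by (rule test_funI[OF smooth_on_reflect[OF smooth_radial_kernel[OF assms(1)]] compact_cball assms(2)])
    (simp add: radial_kernel_eq_0[OF assms(1)] dist_norm)

lemma mollify_kernel_integrable:
  fixes w :: "complex \<Rightarrow> 'b::{banach, second_countable_topology}"
  assumes "0 < \<epsilon>" "integrable lborel w"
  shows "integrable lborel (\<lambda>\<zeta>. radial_kernel \<epsilon> (z - \<zeta>) *\<^sub>R w \<zeta>)"
  using radial_kernel_outside[OF assms(1)] smooth_on_continuous[OF smooth_radial_kernel[OF assms(1)]]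
  by (intro mollify_integrable[where K="cball 0 \<epsilon>"] assms(2) compact_cball)

text \<open>
  Fubini and the symmetry of the kernel.
\<close>
lemma mollify_self_adjoint:
  fixes w :: "complex \<Rightarrow> 'b::{banach, second_countable_topology}" and \<phi> :: "complex \<Rightarrow> real"
  assumes e: "0 < \<epsilon>" and w: "integrable lborel w" and \<phi>: "test_fun \<Omega> \<phi>"
  shows "(LINT z|lborel. \<phi> z *\<^sub>R mollify \<epsilon> w z) = (LINT \<zeta>|lborel. mollify \<epsilon> \<phi> \<zeta> *\<^sub>R w \<zeta>)"
proof -
  let ?F = "\<lambda>(z, \<zeta>). (\<phi> z * radial_kernel \<epsilon> (z - \<zeta>)) *\<^sub>R w \<zeta>"
  have k: "continuous_on UNIV (radial_kernel \<epsilon>)" by (rule smooth_on_continuous[OF smooth_radial_kernel[OF e]])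
  have \<phi>c: "continuous_on UNIV \<phi>" by (rule test_fun_continuous[OF \<phi>])
  obtain K where K: "compact K" "\<And>z. z \<notin> K \<Longrightarrow> \<phi> z = 0" using test_funE[OF \<phi>] by metis
  have [measurable]: "radial_kernel \<epsilon> \<in> borel_measurable borel" "\<phi> \<in> borel_measurable borel"
    "w \<in> borel_measurable borel"
    using k \<phi>c w by (auto intro!: borel_measurable_continuous_onI dest: borel_measurable_integrable)
  have i: "integrable (lborel \<Otimes>\<^sub>M lborel) ?F"
  proof (rule lborel_pair.Fubini_integrable)
    show "?F \<in> borel_measurable (lborel \<Otimes>\<^sub>M lborel)" by measurable
    have "(\<lambda>z. LINT \<zeta>|lborel. norm (?F (z, \<zeta>))) = (\<lambda>z. \<bar>\<phi> z\<bar> * mollify \<epsilon> (\<lambda>\<zeta>. norm (w \<zeta>)) z)"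
      by (simp add: mollify_def abs_mult mult.assoc radial_kernel_nonneg[OF e])
    moreover have "integrable lborel (\<lambda>z. \<bar>\<phi> z\<bar> * mollify \<epsilon> (\<lambda>\<zeta>. norm (w \<zeta>)) z)"
      by (rule integrable_continuous_compact_support[OF _ K(1)])
        (auto intro!: continuous_intros \<phi>c continuous_mollify e integrable_norm w simp: K(2))
    ultimately show "integrable lborel (\<lambda>z. LINT \<zeta>|lborel. norm (?F (z, \<zeta>)))" by simp
    show "AE z in lborel. integrable lborel (\<lambda>\<zeta>. ?F (z, \<zeta>))"
      using mollify_kernel_integrable[OF e w] by (auto simp flip: scaleR_scaleR)
  qed
  have "(LINT z|lborel. \<phi> z *\<^sub>R mollify \<epsilon> w z) = (LINT z|lborel. LINT \<zeta>|lborel. ?F (z, \<zeta>))"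
    by (simp add: mollify_def flip: scaleR_scaleR)
  also have "\<dots> = (LINT \<zeta>|lborel. LINT z|lborel. ?F (z, \<zeta>))"
    using lborel_pair.Fubini_integral[of "\<lambda>z \<zeta>. ?F (z, \<zeta>)"] i by simp
  also have "\<dots> = (LINT \<zeta>|lborel. mollify \<epsilon> \<phi> \<zeta> *\<^sub>R w \<zeta>)"
  proof (rule Bochner_Integration.integral_cong[OF refl])
    fix \<zeta>
    have \<phi>i: "integrable lborel \<phi>" by (rule integrable_continuous_compact_support[OF \<phi>c K])
    have "radial_kernel \<epsilon> (\<zeta> - z) = radial_kernel \<epsilon> (z - \<zeta>)" for z
      using radial_kernel_minus[OF e, of "z - \<zeta>"] by simp
    then have "mollify \<epsilon> \<phi> \<zeta> = (LINT z|lborel. \<phi> z * radial_kernel \<epsilon> (z - \<zeta>))"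
      and "integrable lborel (\<lambda>z. \<phi> z * radial_kernel \<epsilon> (z - \<zeta>))"
      using mollify_kernel_integrable[OF e \<phi>i, of \<zeta>] by (simp_all add: mollify_def mult.commute)
    then show "(LINT z|lborel. ?F (z, \<zeta>)) = mollify \<epsilon> \<phi> \<zeta> *\<^sub>R w \<zeta>" by simp
  qed
  finally show ?thesis .
qed

lemma mollify_close:
  fixes w :: "complex \<Rightarrow> 'b::{banach, second_countable_topology}"
  assumes "0 < \<epsilon>" "integrable lborel w" "\<And>\<zeta>. norm (\<zeta> - z) < \<epsilon> \<Longrightarrow> norm (w \<zeta> - w z) \<le> e"
  shows "norm (mollify \<epsilon> w z - w z) \<le> e"
  unfolding mollify_def
proof (rule approximate_identity[OF radial_kernel_integrable radial_kernel_integral radial_kernel_nonneg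
      mollify_kernel_integrable])
  fix \<zeta> assume "radial_kernel \<epsilon> (z - \<zeta>) \<noteq> 0"
  then have "norm (z - \<zeta>) < \<epsilon>" using radial_kernel_eq_0[OF assms(1), of "z - \<zeta>"] by force
  then show "norm (w \<zeta> - w z) \<le> e" by (intro assms(3)) (simp add: norm_minus_commute)
qed (use assms in auto)

text \<open>
  Mollification moves from \<open>w\<close> to the test function, where it converges uniformly.
\<close>
lemma mollify_test_fun_limit:
  fixes w :: "complex \<Rightarrow> 'b::{banach, second_countable_topology}" and \<phi> :: "complex \<Rightarrow> real"
  assumes w: "integrable lborel w" and \<phi>: "test_fun \<Omega> \<phi>" and e: "0 < e"
  obtains d where "0 < d" "\<And>\<epsilon>. 0 < \<epsilon> \<Longrightarrow> \<epsilon> < d \<Longrightarrow>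
    norm ((LINT z|lborel. \<phi> z *\<^sub>R mollify \<epsilon> w z) - (LINT z|lborel. \<phi> z *\<^sub>R w z)) \<le> e"
proof -
  let ?N = "LINT z|lborel. norm (w z)"
  have "0 \<le> ?N" by simp
  then have N1: "0 < ?N + 1" by linarith
  (* adding \<open>1\<close> avoids a case distinction when \<open>w\<close> vanishes almost everywhere *)
  define e' where "e' = e / (?N + 1)"
  have e': "0 < e'" unfolding e'_def using e N1 by (rule divide_pos_pos)
  have "e' * ?N \<le> e' * (?N + 1)" using e' by (intro mult_left_mono) auto
  also have "\<dots> = e" using N1 by (simp add: e'_def)
  finally have e'N: "e' * ?N \<le> e" .
  have \<phi>c: "continuous_on UNIV \<phi>" by (rule test_fun_continuous[OF \<phi>])
  obtain K where K: "compact K" "\<And>z. z \<notin> K \<Longrightarrow> \<phi> z = 0" using test_funE[OF \<phi>] by metis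
  have \<phi>i: "integrable lborel \<phi>" by (rule integrable_continuous_compact_support[OF \<phi>c K])
  obtain d where d: "0 < d" "\<And>x y. norm (x - y) < d \<Longrightarrow> norm (\<phi> x - \<phi> y) < e'"
    using compact_support_uniformly_continuous[OF \<phi>c K e'] by blast
  show thesis
  proof (rule that[OF d(1)])
    fix \<epsilon> assume eps: "0 < \<epsilon>" "\<epsilon> < d"
    have cl: "\<bar>mollify \<epsilon> \<phi> \<zeta> - \<phi> \<zeta>\<bar> \<le> e'" for \<zeta>
      using mollify_close[OF eps(1) \<phi>i, of \<zeta> e'] d(2)[of _ \<zeta>] eps(2) by (force intro: less_imp_le)
    have i: "integrable lborel (\<lambda>\<zeta>. (mollify \<epsilon> \<phi> \<zeta> - \<phi> \<zeta>) *\<^sub>R w \<zeta>)"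
      by (rule integrable_bounded_scaleR[OF w _ cl])
        (intro borel_measurable_continuous_onI continuous_intros continuous_mollify eps \<phi>i \<phi>c)
    have i2: "integrable lborel (\<lambda>\<zeta>. \<phi> \<zeta> *\<^sub>R w \<zeta>)" by (rule test_integrable[OF w \<phi>]) simp
    have i1: "integrable lborel (\<lambda>\<zeta>. mollify \<epsilon> \<phi> \<zeta> *\<^sub>R w \<zeta>)"
      using Bochner_Integration.integrable_add[OF i i2] by (simp flip: scaleR_add_left)
    have "(LINT z|lborel. \<phi> z *\<^sub>R mollify \<epsilon> w z) - (LINT z|lborel. \<phi> z *\<^sub>R w z) =
        (LINT \<zeta>|lborel. (mollify \<epsilon> \<phi> \<zeta> - \<phi> \<zeta>) *\<^sub>R w \<zeta>)"
      unfolding mollify_self_adjoint[OF eps(1) w \<phi>] scaleR_diff_left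
      by (rule Bochner_Integration.integral_diff[OF i1 i2, symmetric])
    also have "norm \<dots> \<le> (LINT \<zeta>|lborel. e' * norm (w \<zeta>))"
      by (rule Bochner_Integration.integral_norm_bound_integral[OF i])
        (use w cl in \<open>auto intro!: mult_right_mono\<close>)
    also have "\<dots> = e' * ?N" by simp
    finally show "norm ((LINT z|lborel. \<phi> z *\<^sub>R mollify \<epsilon> w z) - (LINT z|lborel. \<phi> z *\<^sub>R w z)) \<le> e"
      using e'N by linarith
  qed
qed

lemma smooth_dir_deriv_bounded_linear:
  assumes "smooth_on UNIV f" "bounded_linear L"
  shows "dir_deriv v (\<lambda>z. L (f z)) z = L (dir_deriv v f z)"
  using dir_deriv_eqI[OF bounded_linear.has_derivative[OF assms(2) smooth_on_has_derivative[OF assms(1)]]] by simp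

text \<open>
  Real test functions suffice by complex linearity, but the test function that makes mollification
  independent of the radius is complex.
\<close>
lemma weak_dbar_complex:
  fixes w \<Phi> :: "complex \<Rightarrow> complex"
  assumes w: "integrable lborel w"
    and test: "\<And>\<phi>. test_fun \<Omega> \<phi> \<Longrightarrow>
      (LINT z|lborel. (of_real (dir_deriv 1 \<phi> z) + \<i> * of_real (dir_deriv \<i> \<phi> z)) * w z) = 0"
    and \<Phi>: "smooth_on UNIV \<Phi>" and K: "compact K" "K \<subseteq> \<Omega>" "\<And>z. z \<notin> K \<Longrightarrow> \<Phi> z = 0"
  shows "(LINT z|lborel. (dir_deriv 1 \<Phi> z + \<i> * dir_deriv \<i> \<Phi> z) * w z) = 0"
proof -
  let ?R = "\<lambda>z. Re (\<Phi> z)" and ?I = "\<lambda>z. Im (\<Phi> z)"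
  have R: "test_fun \<Omega> ?R" and I: "test_fun \<Omega> ?I"
    by (rule test_funI[OF smooth_on_bounded_linear[OF open_UNIV bounded_linear_Re \<Phi>] K(1,2)], simp add: K(3),
        rule test_funI[OF smooth_on_bounded_linear[OF open_UNIV bounded_linear_Im \<Phi>] K(1,2)], simp add: K(3))
  have d: "dir_deriv v \<Phi> z = of_real (dir_deriv v ?R z) + \<i> * of_real (dir_deriv v ?I z)" for v z
    unfolding smooth_dir_deriv_bounded_linear[OF \<Phi> bounded_linear_Re]
      smooth_dir_deriv_bounded_linear[OF \<Phi> bounded_linear_Im] by (simp add: complex_eq_iff)
  have i: "integrable lborel (\<lambda>z. (of_real (dir_deriv 1 \<phi> z) + \<i> * of_real (dir_deriv \<i> \<phi> z)) * w z)"
    if "test_fun \<Omega> \<phi>" for \<phi>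
  proof -
    have "integrable lborel (\<lambda>z. dir_deriv 1 \<phi> z *\<^sub>R w z + \<i> * (dir_deriv \<i> \<phi> z *\<^sub>R w z))"
      by (intro Bochner_Integration.integrable_add integrable_mult_right test_integrable[OF w test_fun_dir_deriv[OF that]]) auto
    then show ?thesis by (simp add: scaleR_conv_of_real algebra_simps)
  qed
  have "(LINT z|lborel. (dir_deriv 1 \<Phi> z + \<i> * dir_deriv \<i> \<Phi> z) * w z) =
     (LINT z|lborel. (of_real (dir_deriv 1 ?R z) + \<i> * of_real (dir_deriv \<i> ?R z)) * w z +
        \<i> * ((of_real (dir_deriv 1 ?I z) + \<i> * of_real (dir_deriv \<i> ?I z)) * w z))"
    unfolding d by (simp add: algebra_simps)
  also have "\<dots> = 0"
    by (subst Bochner_Integration.integral_add[OF i[OF R] integrable_mult_right[OF i[OF I]]])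
      (simp only: integral_mult_right_zero test[OF R] test[OF I], simp)
  finally show ?thesis .
qed

text \<open>
  The kernel is itself a test function of its second argument, so the weak equation says that the
  derivative of the mollification is complex linear.
\<close>
lemma mollify_holomorphic:
  fixes w :: "complex \<Rightarrow> complex"
  assumes w: "integrable lborel w" and e: "0 < \<epsilon>"
    and test: "\<And>\<phi>. test_fun \<Omega> \<phi> \<Longrightarrow>
      (LINT z|lborel. (of_real (dir_deriv 1 \<phi> z) + \<i> * of_real (dir_deriv \<i> \<phi> z)) * w z) = 0"
    and S: "open S" "\<And>z. z \<in> S \<Longrightarrow> cball z \<epsilon> \<subseteq> \<Omega>"
  shows "mollify \<epsilon> w holomorphic_on S"
  unfolding holomorphic_on_open[OF S(1)]
proof (intro ballI exI)
  fix z assume z: "z \<in> S"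
  let ?k = "radial_kernel \<epsilon>"
  let ?D = "\<lambda>v. LINT \<zeta>|lborel. dir_deriv v ?k (z - \<zeta>) *\<^sub>R w \<zeta>"
  have k: "smooth_on UNIV ?k" by (rule smooth_radial_kernel[OF e])
  have D: "(mollify \<epsilon> w has_derivative ?D) (at z)" by (rule mollify_deriv[OF e w])
  have i: "integrable lborel (\<lambda>\<zeta>. dir_deriv v ?k (z - \<zeta>) *\<^sub>R w \<zeta>)" for v
    using dir_deriv_eq_0[OF closed_cball[of 0 \<epsilon>] radial_kernel_outside[OF e]]
    by (intro mollify_integrable[OF w smooth_on_continuous[OF smooth_on_dir_deriv[OF k]] compact_cball[of "0::complex" \<epsilon>]]) auto
  have "(LINT \<zeta>|lborel. (of_real (- dir_deriv 1 ?k (z - \<zeta>)) + \<i> * of_real (- dir_deriv \<i> ?k (z - \<zeta>))) * w \<zeta>) = 0"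
    using test[OF radial_kernel_test_fun[OF e S(2)[OF z]]] unfolding dir_deriv_reflect[OF k] .
  moreover have "(LINT \<zeta>|lborel. (of_real (- dir_deriv 1 ?k (z - \<zeta>)) + \<i> * of_real (- dir_deriv \<i> ?k (z - \<zeta>))) * w \<zeta>)
    = (LINT \<zeta>|lborel. - (dir_deriv 1 ?k (z - \<zeta>) *\<^sub>R w \<zeta>) - \<i> * (dir_deriv \<i> ?k (z - \<zeta>) *\<^sub>R w \<zeta>))"
    by (simp add: scaleR_conv_of_real algebra_simps)
  moreover have "\<dots> = - ?D 1 - \<i> * ?D \<i>"
    by (subst Bochner_Integration.integral_diff[OF Bochner_Integration.integrable_minus[OF i] integrable_mult_right[OF i]])
      (simp only: integral_mult_right_zero integral_minus)
  ultimately have "- ?D 1 - \<i> * ?D \<i> = 0" by simp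
  then have "\<i> * (- ?D 1 - \<i> * ?D \<i>) = 0" by simp
  then have Di: "?D \<i> = \<i> * ?D 1" by (simp add: algebra_simps)
  have lin: "linear ?D" using D by (rule has_derivative_linear)
  have "?D v = ?D 1 * v" for v
  proof -
    have "?D (Re v *\<^sub>R 1 + Im v *\<^sub>R \<i>) = Re v *\<^sub>R ?D 1 + Im v *\<^sub>R ?D \<i>"
      by (simp only: linear_add[OF lin] linear_scale[OF lin])
    moreover have "Re v *\<^sub>R 1 + Im v *\<^sub>R \<i> = v" by (simp add: complex_eq_iff)
    ultimately have "?D v = Re v *\<^sub>R ?D 1 + Im v *\<^sub>R ?D \<i>" by simp
    also have "\<dots> = ?D 1 * (Re v *\<^sub>R 1 + Im v *\<^sub>R \<i>)"
      unfolding Di by (simp add: scaleR_conv_of_real algebra_simps)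
    finally show ?thesis by (simp only: \<open>Re v *\<^sub>R 1 + Im v *\<^sub>R \<i> = v\<close>)
  qed
  then have "?D = (*) (?D 1)" by (rule ext)
  then show "(mollify \<epsilon> w has_field_derivative ?D 1) (at z)"
    using D unfolding has_field_derivative_def by simp
qed

text \<open>
  The primitive \<open>\<Lambda>\<close> of the radial profile: \<open>(\<partial>\<^sub>x + \<i> \<partial>\<^sub>y) \<Lambda>(\<bar>z\<bar>\<^sup>2/\<epsilon>\<^sup>2)\<close> is
  \<open>2 z / \<epsilon>\<^sup>2\<close> times the profile.
\<close>
definition annulus_primitive :: "real \<Rightarrow> real" where
  "annulus_primitive s = integral {1/4..s} (bump 1 (1/4) 1)"

lemma annulus_primitive_deriv: "(annulus_primitive has_real_derivative bump 1 (1/4) 1 s) (at s)"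
  unfolding annulus_primitive_def[abs_def]
  by (rule antiderivative_of_compact_support[OF continuous_bump]) (auto simp: bump_eq_0)

lemma annulus_primitive_eq_0: "s \<le> 1/4 \<Longrightarrow> annulus_primitive s = 0"
  unfolding annulus_primitive_def by (cases "s < 1/4") (simp, metis integral_refl cbox_interval order_le_less)

lemma annulus_primitive_const: assumes "1 \<le> s" shows "annulus_primitive s = annulus_primitive 1"
proof (cases "s = 1")
  case False
  then have "1 < s" using assms by simp
  then obtain x where "1 < x" "annulus_primitive s - annulus_primitive 1 = (s - 1) * bump 1 (1/4) 1 x"
    using MVT2[of 1 s annulus_primitive "bump 1 (1/4) 1"] annulus_primitive_deriv by blast
  then show ?thesis by (simp add: bump_eq_0)
qed simp

lemma smooth_annulus_primitive: "smooth_on UNIV annulus_primitive"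
  by (rule smooth_on_real_antiderivative[OF open_UNIV annulus_primitive_deriv smooth_bump]) simp

lemma annulus_primitive_norm_deriv:
  "((\<lambda>\<xi>::complex. annulus_primitive ((norm \<xi>)\<^sup>2 / \<epsilon>\<^sup>2)) has_derivative
     (\<lambda>v. bump 1 (1/4) 1 ((norm \<xi>)\<^sup>2 / \<epsilon>\<^sup>2) * (2 * (\<xi> \<bullet> v) / \<epsilon>\<^sup>2))) (at \<xi>)"
proof -
  have "((\<lambda>\<xi>::complex. (\<xi> \<bullet> \<xi>) * (1 / \<epsilon>\<^sup>2)) has_derivative (\<lambda>v. (\<xi> \<bullet> v + v \<bullet> \<xi>) * (1 / \<epsilon>\<^sup>2))) (at \<xi>)"
    by (intro has_derivative_mult_left has_derivative_inner has_derivative_ident)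
  then have "((\<lambda>\<xi>::complex. (\<xi> \<bullet> \<xi>) / \<epsilon>\<^sup>2) has_derivative (\<lambda>v. 2 * (\<xi> \<bullet> v) / \<epsilon>\<^sup>2)) (at \<xi>)"
    by (simp add: inner_commute)
  from has_derivative_compose[OF this annulus_primitive_deriv[unfolded has_field_derivative_def]]
  show ?thesis by (simp add: dot_square_norm)
qed

text \<open>
  The mean value property for weak solutions. With \<open>\<Lambda>\<close> the primitive of the radial profile, the function
  \<open>(\<Lambda>(\<bar>z\<bar>\<^sup>2/\<epsilon>\<^sup>2) - \<Lambda>(\<bar>z\<bar>\<^sup>2/\<delta>\<^sup>2)) / z\<close> is smooth with compact support, since the numerator
  vanishes near \<open>0\<close> and far out. Its image under \<open>\<partial>\<^sub>x + \<i> \<partial>\<^sub>y\<close> is a multiple of the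
  difference of the two kernels, because \<open>1 / z\<close> is holomorphic and the factor \<open>z\<close> from the chain
  rule cancels it.
\<close>
lemma mollify_radius_independent:
  fixes w :: "complex \<Rightarrow> complex"
  assumes w: "integrable lborel w" and e: "0 < \<epsilon>" and d: "0 < \<delta>"
    and test: "\<And>\<phi>. test_fun \<Omega> \<phi> \<Longrightarrow>
      (LINT z|lborel. (of_real (dir_deriv 1 \<phi> z) + \<i> * of_real (dir_deriv \<i> \<phi> z)) * w z) = 0"
    and sub: "cball z \<epsilon> \<subseteq> \<Omega>" "cball z \<delta> \<subseteq> \<Omega>"
  shows "mollify \<epsilon> w z = mollify \<delta> w z"
proof -
  let ?L = "\<lambda>\<xi>::complex. annulus_primitive ((norm \<xi>)\<^sup>2 / \<epsilon>\<^sup>2) - annulus_primitive ((norm \<xi>)\<^sup>2 / \<delta>\<^sup>2)"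
  let ?\<Phi> = "\<lambda>\<xi>::complex. of_real (?L \<xi>) * inverse \<xi>"
  let ?b = "\<lambda>\<epsilon> \<xi>::complex. bump 1 (1/4) 1 ((norm \<xi>)\<^sup>2 / \<epsilon>\<^sup>2) / \<epsilon>\<^sup>2"
  (* both kernels vanish within radius \<open>\<epsilon> / 2\<close> or \<open>\<delta> / 2\<close> respectively *)
  define m where "m = min \<epsilon> \<delta> / 2"
  have m: "0 < m" using e d by (simp add: m_def)
  have Lsm: "smooth_on UNIV ?L"
  proof -
    have "smooth_on UNIV (\<lambda>\<xi>::complex. annulus_primitive ((norm \<xi>)\<^sup>2 * (1 / \<epsilon>\<^sup>2)) - annulus_primitive ((norm \<xi>)\<^sup>2 * (1 / \<delta>\<^sup>2)))"
      by (intro smooth_on_diff smooth_on_mult smooth_on_const smooth_norm_square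
          smooth_on_compose[OF _ _ _ smooth_annulus_primitive]) auto
    then show ?thesis by simp
  qed
  have small: "?L \<xi> = 0" if "norm \<xi> < m" for \<xi>
  proof -
    have "(norm \<xi>)\<^sup>2 / r\<^sup>2 \<le> 1/4" if "norm \<xi> < r / 2" "0 < r" for r
    proof -
      have "(norm \<xi>)\<^sup>2 \<le> (r / 2)\<^sup>2" using that by (intro power_mono) auto
      then show ?thesis using that by (simp add: field_simps power2_eq_square)
    qed
    from this[of \<epsilon>] this[of \<delta>] show ?thesis using that e d by (simp add: m_def annulus_primitive_eq_0)
  qed
  have large: "?L \<xi> = 0" if "max \<epsilon> \<delta> < norm \<xi>" for \<xi>
  proof -
    have "1 \<le> (norm \<xi>)\<^sup>2 / r\<^sup>2" if "r < norm \<xi>" "0 < r" for r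
    proof -
      have "r\<^sup>2 \<le> (norm \<xi>)\<^sup>2" using that by (intro power_mono) auto
      then show ?thesis using that by simp
    qed
    from annulus_primitive_const[OF this[of \<epsilon>]] annulus_primitive_const[OF this[of \<delta>]]
    show ?thesis using that e d by simp
  qed
  have \<Phi>sm: "smooth_on UNIV ?\<Phi>"
  proof (rule smooth_on_local)
    fix \<xi> :: complex
    show "\<exists>U. open U \<and> \<xi> \<in> U \<and> smooth_on U ?\<Phi>"
    proof (cases "\<xi> = 0")
      case True
      have "smooth_on (ball 0 m) ?\<Phi>"
        by (rule smooth_on_cong[OF _ _ smooth_on_const[of _ 0]]) (use small in auto)
      then show ?thesis using True m by (intro exI[of _ "ball 0 m"]) auto
    next
      case False
      have "smooth_on (-{0}) (inverse :: complex \<Rightarrow> complex)"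
        by (rule holomorphic_smooth_on) (auto intro!: holomorphic_intros)
      then have "smooth_on (-{0}) ?\<Phi>"
        by (intro smooth_on_mult smooth_on_bounded_linear[OF _ bounded_linear_of_real] smooth_on_subset[OF Lsm]) auto
      then show ?thesis using False by (intro exI[of _ "-{0}"]) auto
    qed
  qed
  (* the terms with the derivative of \<open>1 / \<xi>\<close> cancel, as it is holomorphic *)
  have dbar: "dir_deriv 1 ?\<Phi> \<xi> + \<i> * dir_deriv \<i> ?\<Phi> \<xi> = of_real (2 * (?b \<epsilon> \<xi> - ?b \<delta> \<xi>))" for \<xi>
  proof (cases "\<xi> = 0")
    case True
    have "dir_deriv v ?\<Phi> \<xi> = dir_deriv v (\<lambda>_. 0) \<xi>" for v
      by (rule dir_deriv_cong[of "ball 0 m"]) (use small m True in auto)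
    moreover have "dir_deriv v (\<lambda>_. 0::complex) \<xi> = 0" for v :: complex
      by (rule dir_deriv_eqI[OF has_derivative_const])
    ultimately show ?thesis using True by (simp add: bump_eq_0)
  next
    case False
    let ?l = "\<lambda>v. bump 1 (1/4) 1 ((norm \<xi>)\<^sup>2 / \<epsilon>\<^sup>2) * (2 * (\<xi> \<bullet> v) / \<epsilon>\<^sup>2) -
      bump 1 (1/4) 1 ((norm \<xi>)\<^sup>2 / \<delta>\<^sup>2) * (2 * (\<xi> \<bullet> v) / \<delta>\<^sup>2)"
    have l: "?l v = 2 * (\<xi> \<bullet> v) * (?b \<epsilon> \<xi> - ?b \<delta> \<xi>)" for v
      by (simp add: algebra_simps)
    have "(?L has_derivative ?l) (at \<xi>)"
      by (intro has_derivative_diff annulus_primitive_norm_deriv)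
    then have "((\<lambda>\<xi>. complex_of_real (?L \<xi>)) has_derivative (\<lambda>v. of_real (?l v))) (at \<xi>)"
      by (rule has_derivative_of_real)
    moreover have "(inverse has_derivative (\<lambda>v. - (inverse \<xi> * v * inverse \<xi>))) (at \<xi>)"
      using False by (rule has_derivative_inverse')
    ultimately have D: "(?\<Phi> has_derivative (\<lambda>v. of_real (?L \<xi>) * - (inverse \<xi> * v * inverse \<xi>) + of_real (?l v) * inverse \<xi>)) (at \<xi>)"
      by (rule has_derivative_mult)
    have "dir_deriv 1 ?\<Phi> \<xi> + \<i> * dir_deriv \<i> ?\<Phi> \<xi> = (of_real (?l 1) + \<i> * of_real (?l \<i>)) * inverse \<xi>"
      unfolding dir_deriv_eqI[OF D] by (simp add: algebra_simps)
    also have "of_real (?l 1) + \<i> * of_real (?l \<i>) = of_real (2 * (?b \<epsilon> \<xi> - ?b \<delta> \<xi>)) * \<xi>"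
      unfolding l by (simp add: complex_eq_iff)
    finally show ?thesis using False by simp
  qed
  let ?\<Psi> = "\<lambda>\<zeta>. ?\<Phi> (\<zeta> - z)"
  have \<Psi>0: "?\<Psi> \<zeta> = 0" if "\<zeta> \<notin> cball z (max \<epsilon> \<delta>)" for \<zeta>
  proof -
    have "max \<epsilon> \<delta> < norm (\<zeta> - z)" using that by (simp only: mem_cball dist_norm norm_minus_commute not_le)
    from large[OF this] show ?thesis by simp
  qed
  have "cball z (max \<epsilon> \<delta>) \<subseteq> \<Omega>" using sub by (simp add: max_def)
  from weak_dbar_complex[OF w test smooth_on_translate[OF \<Phi>sm] compact_cball this \<Psi>0]
  have "(LINT \<zeta>|lborel. of_real (2 * (?b \<epsilon> (\<zeta> - z) - ?b \<delta> (\<zeta> - z))) * w \<zeta>) = 0"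
    unfolding dir_deriv_translate[OF \<Phi>sm] dbar .
  moreover define c where "c = (LINT z|lborel. bump 1 (1/4) 1 ((norm (z::complex))\<^sup>2))"
  have c: "0 < c" unfolding c_def by (rule radial_profile_integral(2))
  have "?b r (\<zeta> - z) = c * radial_kernel r (z - \<zeta>)" for r \<zeta>
    using c unfolding radial_kernel_def c_def[symmetric] by (simp add: norm_minus_commute)
  ultimately have "(LINT \<zeta>|lborel. of_real (2 * (c * radial_kernel \<epsilon> (z - \<zeta>) - c * radial_kernel \<delta> (z - \<zeta>))) * w \<zeta>) = 0"
    by simp
  also have "(\<lambda>\<zeta>. of_real (2 * (c * radial_kernel \<epsilon> (z - \<zeta>) - c * radial_kernel \<delta> (z - \<zeta>))) * w \<zeta>) =
    (\<lambda>\<zeta>. (2 * c) *\<^sub>R (radial_kernel \<epsilon> (z - \<zeta>) *\<^sub>R w \<zeta> - radial_kernel \<delta> (z - \<zeta>) *\<^sub>R w \<zeta>))"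
    by (simp add: scaleR_conv_of_real algebra_simps)
  finally show ?thesis
    using c unfolding mollify_def
    by (simp add: Bochner_Integration.integral_diff mollify_kernel_integrable[OF e w] mollify_kernel_integrable[OF d w])
qed

lemma fundamental_lemma_complex:
  fixes f :: "complex \<Rightarrow> complex"
  assumes U: "open U" and f: "integrable lborel f"
    and test: "\<And>\<phi>. test_fun U \<phi> \<Longrightarrow> (LINT z|lborel. \<phi> z *\<^sub>R f z) = 0"
  shows "AE z in lborel. z \<in> U \<longrightarrow> f z = 0"
proof -
  have i: "integrable lborel (\<lambda>z. \<phi> z *\<^sub>R f z)" if "test_fun U \<phi>" for \<phi>
    by (rule test_integrable[OF f that]) simp
  have "AE z in lborel. z \<in> U \<longrightarrow> Re (f z) = 0"
  proof (rule fundamental_lemma[OF U integrable_Re[OF f]])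
    fix \<phi> assume t: "test_fun U \<phi>"
    show "(LINT z|lborel. \<phi> z * Re (f z)) = 0"
      using integral_Re[OF i[OF t]] test[OF t] by simp
  qed
  moreover have "AE z in lborel. z \<in> U \<longrightarrow> Im (f z) = 0"
  proof (rule fundamental_lemma[OF U integrable_Im[OF f]])
    fix \<phi> assume t: "test_fun U \<phi>"
    show "(LINT z|lborel. \<phi> z * Im (f z)) = 0"
      using integral_Im[OF i[OF t]] test[OF t] by simp
  qed
  ultimately show ?thesis by eventually_elim (simp add: complex_eq_iff)
qed

text \<open>
  Mollifications are holomorphic where they make sense and do not depend on the radius, so they
  patch to one holomorphic function on \<open>\<Omega>\<close>. As the radius tends to \<open>0\<close> they converge to \<open>w\<close> weakly.
\<close>
theorem weyl_lemma_dbar: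
  fixes w :: "complex \<Rightarrow> complex"
  assumes \<Omega>: "open \<Omega>" and w: "integrable lborel w"
    and test: "\<And>\<phi>. test_fun \<Omega> \<phi> \<Longrightarrow>
      (LINT z|lborel. (of_real (dir_deriv 1 \<phi> z) + \<i> * of_real (dir_deriv \<i> \<phi> z)) * w z) = 0"
  obtains W where "W holomorphic_on \<Omega>" "AE z in lborel. z \<in> \<Omega> \<longrightarrow> w z = W z"
proof -
  (* some admissible radius at each point; independence of the radius makes the choice immaterial *)
  define r where "r z = (SOME r. 0 < r \<and> cball z r \<subseteq> \<Omega>)" for z
  have r: "0 < r z" "cball z (r z) \<subseteq> \<Omega>" if "z \<in> \<Omega>" for z
    using someI_ex[of "\<lambda>r. 0 < r \<and> cball z r \<subseteq> \<Omega>"] \<Omega> that unfolding r_def by (auto simp: open_contains_cball)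
  define W where "W z = mollify (r z) w z" for z
  have W: "W z = mollify \<rho> w z" if "0 < \<rho>" "cball z \<rho> \<subseteq> \<Omega>" for z \<rho>
  proof -
    have "z \<in> \<Omega>" using that by auto
    then show ?thesis unfolding W_def using mollify_radius_independent[OF w r(1) that(1) test r(2) that(2)] by blast
  qed
  have nbhd: "\<exists>\<rho>>0. \<forall>z\<in>ball x \<rho>. cball z \<rho> \<subseteq> \<Omega>" if x: "x \<in> \<Omega>" for x
  proof -
    obtain q where q: "0 < q" "cball x q \<subseteq> \<Omega>" using \<Omega> x unfolding open_contains_cball by blast
    have "cball z (q / 2) \<subseteq> \<Omega>" if "z \<in> ball x (q / 2)" for z
    proof
      fix y assume "y \<in> cball z (q / 2)"
      then have "dist x y \<le> q" using that dist_triangle[of x y z] by (simp add: dist_commute)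
      then show "y \<in> \<Omega>" using q(2) by auto
    qed
    then show ?thesis using q(1) by (intro exI[of _ "q / 2"]) auto
  qed
  have "W holomorphic_on \<Omega>"
  proof (rule holomorphic_on_subset[of _ "\<Union>x\<in>\<Omega>. ball x (SOME \<rho>. 0 < \<rho> \<and> (\<forall>z\<in>ball x \<rho>. cball z \<rho> \<subseteq> \<Omega>))"])
    let ?\<rho> = "\<lambda>x. SOME \<rho>. 0 < \<rho> \<and> (\<forall>z\<in>ball x \<rho>. cball z \<rho> \<subseteq> \<Omega>)"
    have \<rho>: "0 < ?\<rho> x \<and> (\<forall>z\<in>ball x (?\<rho> x). cball z (?\<rho> x) \<subseteq> \<Omega>)" if "x \<in> \<Omega>" for x
      using someI_ex[of "\<lambda>\<rho>. 0 < \<rho> \<and> (\<forall>z\<in>ball x \<rho>. cball z \<rho> \<subseteq> \<Omega>)"] nbhd[OF that] by blast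
    have "W holomorphic_on ball x (?\<rho> x)" if "x \<in> \<Omega>" for x
    proof (rule holomorphic_transform[of "mollify (?\<rho> x) w"])
      show "mollify (?\<rho> x) w holomorphic_on ball x (?\<rho> x)"
        using \<rho>[OF that] by (intro mollify_holomorphic[OF w _ test]) auto
      show "mollify (?\<rho> x) w z = W z" if "z \<in> ball x (?\<rho> x)" for z
        using W[of "?\<rho> x" z] \<rho>[OF \<open>x \<in> \<Omega>\<close>] that by simp
    qed
    then show "W holomorphic_on (\<Union>x\<in>\<Omega>. ball x (?\<rho> x))"
      by (intro holomorphic_on_UN_open) auto
    show "\<Omega> \<subseteq> (\<Union>x\<in>\<Omega>. ball x (?\<rho> x))" using \<rho> by (meson UN_I centre_in_ball subsetI)
  qed
  moreover have "AE z in lborel. z \<in> \<Omega> \<longrightarrow> w z = W z"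
  proof (rule AE_open_local)
    fix x assume "x \<in> \<Omega>"
    then obtain \<rho> where \<rho>: "0 < \<rho>" "\<And>z. z \<in> ball x \<rho> \<Longrightarrow> cball z \<rho> \<subseteq> \<Omega>" using nbhd by blast
    let ?B = "ball x \<rho>"
    let ?m = "\<lambda>z. indicator ?B z *\<^sub>R mollify \<rho> w z"
    have mi: "integrable lborel ?m"
    proof -
      have "integrable lborel (\<lambda>z. indicator (cball x \<rho>) z *\<^sub>R mollify \<rho> w z)"
        by (rule borel_integrable_compact[OF compact_cball continuous_on_subset[OF continuous_mollify[OF \<rho>(1) w]]]) simp
      then have "integrable lborel (\<lambda>z. indicator ?B z *\<^sub>R (indicator (cball x \<rho>) z *\<^sub>R mollify \<rho> w z))"
        by (rule integrable_mult_indicator[rotated]) simp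
      moreover have "(\<lambda>z. indicator ?B z *\<^sub>R (indicator (cball x \<rho>) z *\<^sub>R mollify \<rho> w z)) = ?m"
        by (auto simp: indicator_def)
      ultimately show ?thesis by simp
    qed
    have "AE z in lborel. z \<in> ?B \<longrightarrow> w z - ?m z = 0"
    proof (rule fundamental_lemma_complex)
      fix \<phi> assume \<phi>: "test_fun ?B \<phi>"
      have out: "\<phi> z = 0" if "z \<notin> ?B" for z using test_funE[OF \<phi>] that by (metis subsetD)
      have eq: "(LINT z|lborel. \<phi> z *\<^sub>R mollify \<epsilon> w z) = (LINT z|lborel. \<phi> z *\<^sub>R ?m z)" if "0 < \<epsilon>" "\<epsilon> \<le> \<rho>" for \<epsilon>
      proof (rule Bochner_Integration.integral_cong[OF refl])
        fix z show "\<phi> z *\<^sub>R mollify \<epsilon> w z = \<phi> z *\<^sub>R ?m z"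
        proof (cases "z \<in> ?B")
          case True
          have "cball z \<epsilon> \<subseteq> \<Omega>" using \<rho>(2)[OF True] that by (meson subset_cball subset_trans)
          then have "mollify \<epsilon> w z = mollify \<rho> w z"
            using W[OF that(1)] W[OF \<rho>(1) \<rho>(2)[OF True]] by simp
          then show ?thesis using True by simp
        qed (simp add: out)
      qed
      have "norm ((LINT z|lborel. \<phi> z *\<^sub>R ?m z) - (LINT z|lborel. \<phi> z *\<^sub>R w z)) \<le> e" if "0 < e" for e
      proof -
        obtain d where d: "0 < d" "\<And>\<epsilon>. 0 < \<epsilon> \<Longrightarrow> \<epsilon> < d \<Longrightarrow>
          norm ((LINT z|lborel. \<phi> z *\<^sub>R mollify \<epsilon> w z) - (LINT z|lborel. \<phi> z *\<^sub>R w z)) \<le> e"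
          using mollify_test_fun_limit[OF w \<phi> \<open>0 < e\<close>] by blast
        have "0 < min \<rho> (d / 2)" "min \<rho> (d / 2) < d" "min \<rho> (d / 2) \<le> \<rho>" using \<rho>(1) d(1) by auto
        then show ?thesis using d(2)[of "min \<rho> (d / 2)"] eq[of "min \<rho> (d / 2)"] by simp
      qed
      then have "norm ((LINT z|lborel. \<phi> z *\<^sub>R ?m z) - (LINT z|lborel. \<phi> z *\<^sub>R w z)) \<le> 0"
        by (rule field_le_epsilon[of _ 0, simplified])
      then show "(LINT z|lborel. \<phi> z *\<^sub>R (w z - ?m z)) = 0"
        unfolding scaleR_diff_right
          Bochner_Integration.integral_diff[OF test_integrable[OF w \<phi> sets_lborel] test_integrable[OF mi \<phi> sets_lborel]]
        by (simp only: norm_le_zero_iff right_minus_eq)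
    qed (use w mi in auto)
    then have "AE z in lborel. z \<in> ?B \<longrightarrow> w z = W z"
      by eventually_elim (use W[OF \<rho>(1) \<rho>(2)] in auto)
    then show "\<exists>V. open V \<and> x \<in> V \<and> (AE z in lborel. z \<in> V \<longrightarrow> w z = W z)"
      using \<rho>(1) by (intro exI[of _ ?B]) auto
  qed
  ultimately show thesis using that by blast
qed

section \<open>Functions of one variable whose second derivative is a measure\<close>

text \<open>
  Halving the interval halves the length in the bound, while the increments of \<open>V\<close> over the two halves
  add up: after \<open>k\<close> halvings the bound has shrunk by \<open>2\<^sup>-\<^sup>k\<close>. This serves as a mean value theorem for
  functions that are differentiable off a countable set only.
\<close>
lemma increments_eq_if_bv_bound:
  fixes G V :: "real \<Rightarrow> real"
  assumes bound: "\<And>s t. s \<in> {a..b} \<Longrightarrow> t \<in> {a..b} \<Longrightarrow> s \<le> t \<Longrightarrow> \<bar>G t - G s\<bar> \<le> (t - s) * (V t - V s)"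
    and st: "s \<in> {a..b}" "t \<in> {a..b}" "s \<le> t"
  shows "G t = G s"
proof -
  (* the claim for all subintervals, by induction on the number of halvings *)
  have "\<bar>G t - G s\<bar> \<le> (t - s) * (V t - V s) * (1/2) ^ k" for k
    using st
  proof (induction k arbitrary: s t)
    case 0 then show ?case using bound by simp
  next
    case (Suc k)
    define m where "m = (s + t) / 2"
    have m: "m \<in> {a..b}" "s \<le> m" "m \<le> t" using Suc.prems by (auto simp: m_def)
    have "\<bar>G t - G s\<bar> \<le> \<bar>G t - G m\<bar> + \<bar>G m - G s\<bar>" by simp
    also have "\<dots> \<le> (t - m) * (V t - V m) * (1/2) ^ k + (m - s) * (V m - V s) * (1/2) ^ k"
      using Suc m by (intro add_mono) auto
    also have "t - m = (t - s) / 2" by (simp add: m_def field_simps)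
    also have "m - s = (t - s) / 2" by (simp add: m_def field_simps)
    also have "(t - s) / 2 * (V t - V m) * (1/2) ^ k + (t - s) / 2 * (V m - V s) * (1/2) ^ k =
        (t - s) * (V t - V s) * (1/2) ^ Suc k"
    proof -
      have "x / 2 * (A - M) * p + x / 2 * (M - S) * p = x * (A - S) * (1/2 * p)" for x A M S p :: real
        by (simp add: field_simps)
      from this[of "t - s" "V t" "V m" "(1/2) ^ k" "V s"] show ?thesis by simp
    qed
    finally show ?case .
  qed
  moreover have "(\<lambda>k. (t - s) * (V t - V s) * (1/2) ^ k) \<longlonglongrightarrow> (t - s) * (V t - V s) * 0"
    by (intro tendsto_mult tendsto_const LIMSEQ_power_zero) simp
  ultimately have "\<bar>G t - G s\<bar> \<le> (t - s) * (V t - V s) * 0"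
    by (intro LIMSEQ_le_const) auto
  then show ?thesis by simp
qed

text \<open>
  A smooth function \<open>E\<close> close to the positive part \<open>max 0 t\<close>, whose second derivative is the mollifier
  \<open>e\<close> instead of a point mass.
\<close>
lemma second_antiderivative_of_mollifier:
  fixes \<delta> :: real
  assumes d: "0 < \<delta>"
  obtains e E1 E :: "real \<Rightarrow> real" where
    "smooth_on UNIV E" "\<And>t. (E has_real_derivative E1 t) (at t)" "\<And>t. (E1 has_real_derivative e t) (at t)"
    "continuous_on UNIV e" "\<And>t. 0 \<le> e t" "\<And>t. e (- t) = e t" "\<And>t. \<delta> \<le> \<bar>t\<bar> \<Longrightarrow> e t = 0"
    "integrable lborel e" "(LINT t|lborel. e t) = 1"
    "\<And>t. \<bar>E t - max 0 t\<bar> \<le> \<delta>" "\<And>t. t \<le> - \<delta> \<Longrightarrow> E t = 0" "\<And>t. \<delta> \<le> t \<Longrightarrow> E t = t + (E \<delta> - \<delta>)"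
proof -
  let ?b = "bump 1 (-\<delta>) \<delta>"
  have bc: "continuous_on UNIV ?b" by (rule continuous_bump) simp
  have bi: "integrable lborel ?b"
    by (rule integrable_continuous_compact_support[OF bc, of "{-\<delta>..\<delta>}"]) (auto simp: bump_def)
  define c where "c = (LINT t|lborel. ?b t)"
  have c: "0 < c" unfolding c_def
    by (rule integral_continuous_nonneg_pos[OF bc bi bump_nonneg, of 0]) (use d in \<open>auto intro: bump_pos\<close>)
  define e where "e t = ?b t * (1 / c)" for t
  have ec: "continuous_on UNIV e" unfolding e_def by (intro continuous_intros bc)
  have es: "smooth_on UNIV e"
    unfolding e_def[abs_def] by (intro smooth_on_mult smooth_bump smooth_on_const) auto
  have e0: "0 \<le> e t" for t using c by (simp add: e_def bump_nonneg)
  have em: "e (- t) = e t" for t by (auto simp: e_def bump_def mult.commute add.commute)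
  have ez: "e t = 0" if "\<delta> \<le> \<bar>t\<bar>" for t using that by (auto simp: e_def bump_def)
  have ei: "integrable lborel e" using bi by (simp add: e_def[abs_def])
  have e1: "(LINT t|lborel. e t) = 1" unfolding e_def using c by (simp add: c_def)
  define E1 where "E1 t = integral {-\<delta>..t} e" for t
  have D1: "(E1 has_real_derivative e t) (at t)" for t
    unfolding E1_def[abs_def] by (rule antiderivative_of_compact_support[OF ec]) (use ez d in auto)
  have E1z: "E1 t = 0" if "t \<le> - \<delta>" for t
    using that by (cases "t < - \<delta>") (auto simp: E1_def)
  have E1c: "continuous_on UNIV E1"
    by (intro continuous_at_imp_continuous_on ballI DERIV_isCont[OF D1])
  have E1one: "E1 t = 1" if "\<delta> \<le> t" for t
  proof -
    have "e integrable_on {-\<delta>..t}" by (intro integrable_continuous_real continuous_on_subset[OF ec]) auto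
    then have "(e has_integral E1 t) {-\<delta>..t}" unfolding E1_def by (rule integrable_integral)
    then have "(e has_integral E1 t) UNIV"
      by (rule has_integral_on_superset) (use ez that in auto)
    moreover have "(e has_integral 1) UNIV" using has_integral_integral_lborel[OF ei] e1 by simp
    ultimately show ?thesis by (rule has_integral_unique)
  qed
  have E1mono: "E1 s \<le> E1 t" if "s \<le> t" for s t
    using that D1 e0 by (intro DERIV_nonneg_imp_nondecreasing[of s t E1]) auto
  have E1nn: "0 \<le> E1 t" for t using E1mono[of "min t (-\<delta>)" t] E1z[of "min t (-\<delta>)"] by simp
  have E1le: "E1 t \<le> 1" for t using E1mono[of t "max t \<delta>"] E1one[of "max t \<delta>"] by simp
  define E where "E t = integral {-\<delta>..t} E1" for t
  have D: "(E has_real_derivative E1 t) (at t)" for t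
    unfolding E_def[abs_def] by (rule antiderivative_of_compact_support[OF E1c]) (use E1z in auto)
  have Ez: "E t = 0" if "t \<le> - \<delta>" for t
    using that by (cases "t < - \<delta>") (auto simp: E_def)
  have Emono: "E s \<le> E t" if "s \<le> t" for s t
    using that D E1nn by (intro DERIV_nonneg_imp_nondecreasing[of s t E]) auto
  have Elin: "E t - E s \<le> t - s" if "s \<le> t" for s t
  proof -
    have "E t - t \<le> E s - s"
    proof (rule DERIV_nonpos_imp_nonincreasing[OF that])
      fix x show "\<exists>y. ((\<lambda>x. E x - x) has_real_derivative y) (at x) \<and> y \<le> 0"
        using E1le by (intro exI[of _ "E1 x - 1"]) (auto intro!: derivative_eq_intros D)
    qed
    then show ?thesis by simp
  qed
  have Econst: "E t = t + (E \<delta> - \<delta>)" if "\<delta> \<le> t" for t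
  proof (cases "t = \<delta>")
    case False
    then have "\<delta> < t" using that by simp
    then obtain x where "\<delta> < x" "E t - E \<delta> = (t - \<delta>) * E1 x" using MVT2[of \<delta> t E E1] D by blast
    then show ?thesis using E1one[of x] by simp
  qed simp
  have Enn: "0 \<le> E t" for t using Emono[of "min t (-\<delta>)" t] Ez[of "min t (-\<delta>)"] by simp
  have Eabs: "\<bar>E t - max 0 t\<bar> \<le> \<delta>" for t
  proof (cases "t \<le> - \<delta>")
    case True then show ?thesis using Ez d by simp
  next
    case False
    have "E t \<le> t + \<delta>" using Elin[of "-\<delta>" t] Ez[of "-\<delta>"] False by simp
    moreover have "t - \<delta> \<le> E t"
    proof (cases "\<delta> \<le> t")
      case True then show ?thesis using Econst[OF True] Enn[of \<delta>] by simp
    qed (use Enn[of t] in linarith)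
    ultimately show ?thesis using Enn[of t] d False by (auto simp: max_def abs_le_iff)
  qed
  have "smooth_on UNIV E"
    by (rule smooth_on_real_antiderivative[OF open_UNIV D smooth_on_real_antiderivative[OF open_UNIV D1 es]])
  then show thesis using that D D1 ec e0 em ez ei e1 Eabs Ez Econst by blast
qed

lemma integrable_positive_part:
  fixes m :: "real measure"
  assumes m: "finite_borel_measure m" and supp: "AE \<tau> in m. \<bar>\<tau>\<bar> \<le> r"
  shows "integrable m (\<lambda>\<tau>. max 0 (\<tau> - t))"
proof -
  interpret finite_borel_measure m by fact
  have [measurable_cong]: "sets m = sets borel" by (rule M_is_borel)
  show ?thesis
    by (rule integrable_const_bound[where B="r + \<bar>t\<bar>"]) (use supp in \<open>eventually_elim, auto\<close>, measurable)
qed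

text \<open>
  The function \<open>D t = \<integral>(\<tau> - t)\<^sup>+ dm\<close> is a second antiderivative of \<open>m\<close>; its slope lies between
  the values of \<open>cdf m - m(\<real>)\<close> at the endpoints.
\<close>
lemma positive_part_increment:
  fixes m :: "real measure"
  assumes m: "finite_borel_measure m" and supp: "AE \<tau> in m. \<bar>\<tau>\<bar> \<le> r" and st: "s \<le> t"
  defines "D \<equiv> \<lambda>t. LINT \<tau>|m. max 0 (\<tau> - t)"
  shows "(t - s) * (measure m (space m) - cdf m t) \<le> D s - D t"
    and "D s - D t \<le> (t - s) * (measure m (space m) - cdf m s)"
proof -
  interpret finite_borel_measure m by fact
  have ms[measurable_cong]: "sets m = sets borel" by (rule M_is_borel)
  have sp: "space m = UNIV" using sets_eq_imp_space_eq[OF ms] by simp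
  have int: "(LINT \<tau>|m. (t - s) * indicator {x<..} \<tau>) = (t - s) * (measure m (space m) - cdf m x)" for x
  proof -
    have "{x<..} = space m - {..x}" by (auto simp: sp)
    then have "measure m {x<..} = measure m (space m) - cdf m x"
      unfolding cdf_def by (simp add: finite_measure_compl ms)
    then show ?thesis by (simp add: ms)
  qed
  have ii: "integrable m (\<lambda>\<tau>. (t - s) * indicator {x<..} \<tau>)" for x
    by (intro integrable_mult_right) (simp add: ms emeasure_eq_measure)
  have D: "D s - D t = (LINT \<tau>|m. max 0 (\<tau> - s) - max 0 (\<tau> - t))"
    unfolding D_def by (rule Bochner_Integration.integral_diff[symmetric]; rule integrable_positive_part[OF m supp])
  have Di: "integrable m (\<lambda>\<tau>. max 0 (\<tau> - s) - max 0 (\<tau> - t))"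
    by (intro Bochner_Integration.integrable_diff integrable_positive_part[OF m supp])
  show "(t - s) * (measure m (space m) - cdf m t) \<le> D s - D t"
    unfolding int[symmetric] D using st by (intro integral_mono ii Di) (auto simp: indicator_def max_def)
  show "D s - D t \<le> (t - s) * (measure m (space m) - cdf m s)"
    unfolding int[symmetric] D using st by (intro integral_mono ii Di) (auto simp: indicator_def max_def)
qed

lemma integral_close_of_uniformly_close:
  fixes m :: "real measure" and u v :: "real \<Rightarrow> real"
  assumes "finite_measure m" "integrable m u" "integrable m v" "\<And>t. \<bar>u t - v t\<bar> \<le> e"
  shows "\<bar>(LINT t|m. u t) - (LINT t|m. v t)\<bar> \<le> e * measure m (space m)"
proof -
  interpret finite_measure m by fact
  have "\<bar>(LINT t|m. u t) - (LINT t|m. v t)\<bar> = norm (LINT t|m. u t - v t)"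
    using assms by simp
  also have "\<dots> \<le> (LINT t|m. e)"
    by (rule Bochner_Integration.integral_norm_bound_integral) (use assms in auto)
  finally show ?thesis by (simp add: mult.commute)
qed

text \<open>
  If \<open>f'' = m1 - m2\<close> in the sense of distributions, then \<open>f\<close> differs from the difference of the second
  antiderivatives \<open>D m1 - D m2\<close> by an affine function, and the slopes of the antiderivatives are
  controlled by the distribution functions.

  That the difference is affine on \<open>[-\<rho>, \<rho>]\<close> is tested with three points: the functional \<open>L\<close> in
  the proof measures the deviation of \<open>g t\<close> from the chord between \<open>-\<rho>\<close> and \<open>\<rho>\<close>.
\<close>
lemma slope_estimate_of_measure_second_derivative:
  fixes f :: "real \<Rightarrow> real" and m1 m2 :: "real measure"
  assumes m1: "finite_borel_measure m1" "AE \<tau> in m1. \<bar>\<tau>\<bar> \<le> r"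
    and m2: "finite_borel_measure m2" "AE \<tau> in m2. \<bar>\<tau>\<bar> \<le> r"
    and f: "continuous_on {-r..r} f" and \<rho>: "0 < \<rho>" "\<rho> < r"
    and test: "\<And>a a1 a2. smooth_on UNIV a \<Longrightarrow> (\<And>t. (a has_real_derivative a1 t) (at t)) \<Longrightarrow>
      (\<And>t. (a1 has_real_derivative a2 t) (at t)) \<Longrightarrow> (\<And>t. r \<le> \<bar>t\<bar> \<Longrightarrow> a t = 0) \<Longrightarrow>
      (LINT t|m1. a t) - (LINT t|m2. a t) = (LINT t|lborel. (indicator {-r..r} t * f t) * a2 t)"
  obtains B where "\<And>s t. -\<rho> \<le> s \<Longrightarrow> s \<le> t \<Longrightarrow> t \<le> \<rho> \<Longrightarrow>
      (t - s) * (B + cdf m1 s - cdf m2 t) \<le> f t - f s \<and> f t - f s \<le> (t - s) * (B + cdf m1 t - cdf m2 s)"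
proof -
  interpret m1: finite_borel_measure m1 by fact
  interpret m2: finite_borel_measure m2 by fact
  let ?D = "\<lambda>m t. LINT \<tau>|m. max 0 (\<tau> - t)"
  let ?M = "\<lambda>m. measure m (space m)"
  define fs where "fs t = indicator {-r..r} t * f t" for t
  have fsi: "integrable lborel fs"
    using borel_integrable_compact[OF compact_Icc f] by (simp add: fs_def[abs_def])
  (* \<open>f - (D m1 - D m2)\<close> has no deviation from its chord *)
  have key: "(\<rho> - t) * (f (-\<rho>) - (?D m1 (-\<rho>) - ?D m2 (-\<rho>))) - 2 * \<rho> * (f t - (?D m1 t - ?D m2 t)) +
      (t + \<rho>) * (f \<rho> - (?D m1 \<rho> - ?D m2 \<rho>)) = 0" (is "?lhs = 0") if t: "-\<rho> \<le> t" "t \<le> \<rho>" for t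
  proof -
    define L where "L g = (\<rho> - t) * g (-\<rho>) - 2 * \<rho> * g t + (t + \<rho>) * g \<rho>" for g :: "real \<Rightarrow> real"
    have Lbound: "\<bar>L g - L h\<bar> \<le> 4 * \<rho> * e" if "\<And>x. x \<in> {-\<rho>, t, \<rho>} \<Longrightarrow> \<bar>g x - h x\<bar> \<le> e" for g h e
    proof -
      have "\<bar>L g - L h\<bar> = \<bar>(\<rho> - t) * (g (-\<rho>) - h (-\<rho>)) - 2 * \<rho> * (g t - h t) + (t + \<rho>) * (g \<rho> - h \<rho>)\<bar>"
        by (simp add: L_def algebra_simps)
      also have "\<dots> \<le> \<bar>(\<rho> - t) * (g (-\<rho>) - h (-\<rho>))\<bar> + \<bar>2 * \<rho> * (g t - h t)\<bar> + \<bar>(t + \<rho>) * (g \<rho> - h \<rho>)\<bar>"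
        by linarith
      also have "\<dots> = (\<rho> - t) * \<bar>g (-\<rho>) - h (-\<rho>)\<bar> + 2 * \<rho> * \<bar>g t - h t\<bar> + (t + \<rho>) * \<bar>g \<rho> - h \<rho>\<bar>"
        using t \<rho> by (simp add: abs_mult)
      also have "\<dots> \<le> (\<rho> - t) * e + 2 * \<rho> * e + (t + \<rho>) * e"
        using t \<rho> that by (intro add_mono mult_left_mono) auto
      also have "\<dots> = 4 * \<rho> * e" by (simp add: algebra_simps)
      finally show ?thesis .
    qed
    have "\<bar>L f - (L (?D m1) - L (?D m2))\<bar> \<le> \<eta>" if \<eta>: "0 < \<eta>" for \<eta>
    proof -
      define C where "C = 4 * \<rho> * (1 + ?M m1 + ?M m2)"
      have C: "0 < C" using \<rho> measure_nonneg[of m1 "space m1"] measure_nonneg[of m2 "space m2"]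
        unfolding C_def by (intro mult_pos_pos) linarith+
      define \<eta>' where "\<eta>' = \<eta> / C"
      have \<eta>': "0 < \<eta>'" using \<eta> C by (simp add: \<eta>'_def)
      have "uniformly_continuous_on {-r..r} f" using f by (intro compact_uniformly_continuous) auto
      from uniformly_continuous_onE[OF this \<eta>'] obtain d where d: "0 < d"
        "\<And>x y. x \<in> {-r..r} \<Longrightarrow> y \<in> {-r..r} \<Longrightarrow> dist y x < d \<Longrightarrow> dist (f y) (f x) < \<eta>'" by blast
      define \<delta> where "\<delta> = min \<eta>' (min d ((r - \<rho>) / 2))"
      have "\<delta> \<le> (r - \<rho>) / 2" unfolding \<delta>_def by (rule min.coboundedI2, rule min.cobounded2)
      moreover have "(r - \<rho>) / 2 < r - \<rho>" using \<rho> by simp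
      ultimately have \<delta>: "0 < \<delta>" "\<delta> \<le> \<eta>'" "\<delta> \<le> d" "\<rho> + \<delta> < r"
        using \<eta>' d(1) \<rho> by (simp_all add: \<delta>_def)
      obtain e E1 E :: "real \<Rightarrow> real" where e:
        "smooth_on UNIV E" "\<And>t. (E has_real_derivative E1 t) (at t)" "\<And>t. (E1 has_real_derivative e t) (at t)"
        "continuous_on UNIV e" "\<And>t. 0 \<le> e t" "\<And>t. e (- t) = e t" "\<And>t. \<delta> \<le> \<bar>t\<bar> \<Longrightarrow> e t = 0"
        "integrable lborel e" "(LINT t|lborel. e t) = 1"
        "\<And>t. \<bar>E t - max 0 t\<bar> \<le> \<delta>" "\<And>t. t \<le> - \<delta> \<Longrightarrow> E t = 0" "\<And>t. \<delta> \<le> t \<Longrightarrow> E t = t + (E \<delta> - \<delta>)"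
        by (rule second_antiderivative_of_mollifier[OF \<delta>(1)]) (rule that)
      (* \<open>L\<close> annihilates affine functions, so \<open>a\<close> vanishes far out, where \<open>E\<close> is affine;
         its second derivative is a combination of three approximate point masses *)
      define a where "a \<tau> = L (\<lambda>x. E (\<tau> - x))" for \<tau>
      define a1 where "a1 \<tau> = L (\<lambda>x. E1 (\<tau> - x))" for \<tau>
      define a2 where "a2 \<tau> = L (\<lambda>x. e (\<tau> - x))" for \<tau>
      have sE: "smooth_on UNIV (\<lambda>\<tau>. E (\<tau> - x))" for x
        using smooth_on_compose[of UNIV UNIV "\<lambda>\<tau>. \<tau> - x" E, OF _ _ smooth_on_diff[OF _ smooth_on_id smooth_on_const] e(1)]
        by simp
      have as: "smooth_on UNIV a" unfolding a_def[abs_def] L_def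
        by (intro smooth_on_add smooth_on_diff smooth_on_mult smooth_on_const sE) auto
      have d1: "((\<lambda>\<tau>. \<tau> - x) has_real_derivative 1) (at \<tau>)" for x \<tau> :: real
        by (auto intro!: derivative_eq_intros)
      have dE: "((\<lambda>\<tau>. E (\<tau> - x)) has_real_derivative E1 (\<tau> - x)) (at \<tau>)" for x \<tau>
        using DERIV_chain2[OF e(2) d1] by simp
      have dE1: "((\<lambda>\<tau>. E1 (\<tau> - x)) has_real_derivative e (\<tau> - x)) (at \<tau>)" for x \<tau>
        using DERIV_chain2[OF e(3) d1] by simp
      have da: "(a has_real_derivative a1 \<tau>) (at \<tau>)" for \<tau>
        unfolding a_def[abs_def] a1_def L_def
        by (intro DERIV_add DERIV_diff DERIV_cmult dE)
      have da1: "(a1 has_real_derivative a2 \<tau>) (at \<tau>)" for \<tau>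
        unfolding a1_def[abs_def] a2_def L_def
        by (intro DERIV_add DERIV_diff DERIV_cmult dE1)
      have az: "a \<tau> = 0" if "r \<le> \<bar>\<tau>\<bar>" for \<tau>
      proof (cases "0 \<le> \<tau>")
        case True
        then have "E (\<tau> - x) = \<tau> - x + (E \<delta> - \<delta>)" if "x \<in> {-\<rho>, t, \<rho>}" for x
          using \<open>r \<le> \<bar>\<tau>\<bar>\<close> that t \<rho> \<delta> by (intro e(12)) auto
        from this[of "-\<rho>"] this[of t] this[of \<rho>]
        have "E (\<tau> - -\<rho>) = \<tau> - -\<rho> + (E \<delta> - \<delta>)" "E (\<tau> - t) = \<tau> - t + (E \<delta> - \<delta>)"
          "E (\<tau> - \<rho>) = \<tau> - \<rho> + (E \<delta> - \<delta>)" by blast+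
        then show ?thesis unfolding a_def L_def by (simp only:) (simp add: algebra_simps)
      next
        case False
        then have "E (\<tau> - x) = 0" if "x \<in> {-\<rho>, t, \<rho>}" for x
          using \<open>r \<le> \<bar>\<tau>\<bar>\<close> that t \<rho> \<delta> by (intro e(11)) auto
        from this[of "-\<rho>"] this[of t] this[of \<rho>]
        have "E (\<tau> - -\<rho>) = 0" "E (\<tau> - t) = 0" "E (\<tau> - \<rho>) = 0" by blast+
        then show ?thesis unfolding a_def L_def by simp
      qed
      have eq: "(LINT \<tau>|m1. a \<tau>) - (LINT \<tau>|m2. a \<tau>) = (LINT \<tau>|lborel. fs \<tau> * a2 \<tau>)"
        unfolding fs_def by (rule test[OF as da da1 az])
      have ac: "continuous_on UNIV a" by (rule smooth_on_continuous[OF as])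
      have az': "a \<tau> = 0" if "\<tau> \<notin> {-r..r}" for \<tau>
        by (rule az) (use that in auto)
      from compact_support_bounded[OF ac compact_Icc az'] obtain b where b: "\<And>\<tau>. norm (a \<tau>) \<le> b" by blast
      (* on the side of the measures \<open>E\<close> is within \<open>\<delta>\<close> of the positive part *)
      have close: "\<bar>(LINT \<tau>|m. a \<tau>) - L (?D m)\<bar> \<le> 4 * \<rho> * \<delta> * ?M m"
        if m: "finite_borel_measure m" "AE \<tau> in m. \<bar>\<tau>\<bar> \<le> r" for m
      proof -
        interpret m: finite_borel_measure m by fact
        have [measurable_cong]: "sets m = sets borel" by (rule m.M_is_borel)
        have [measurable]: "a \<in> borel_measurable borel" using ac by (rule borel_measurable_continuous_onI)
        have ip: "integrable m (\<lambda>\<tau>. max 0 (\<tau> - x))" for x by (rule integrable_positive_part[OF m])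
        have "L (?D m) = (LINT \<tau>|m. L (\<lambda>x. max 0 (\<tau> - x)))"
          unfolding L_def using ip[of "-\<rho>"] ip[of t] ip[of \<rho>] by simp
        moreover have "integrable m (\<lambda>\<tau>. L (\<lambda>x. max 0 (\<tau> - x)))"
          unfolding L_def using ip[of "-\<rho>"] ip[of t] ip[of \<rho>] by simp
        moreover have "integrable m a" by (rule m.integrable_const_bound[where B=b]) (use b in auto)
        moreover have "\<bar>a \<tau> - L (\<lambda>x. max 0 (\<tau> - x))\<bar> \<le> 4 * \<rho> * \<delta>" for \<tau>
          unfolding a_def by (rule Lbound) (rule e(10))
        ultimately show ?thesis
          using integral_close_of_uniformly_close[OF m.finite_measure_axioms] by simp
      qed
      have fe: "integrable lborel (\<lambda>\<tau>. fs \<tau> * e (\<tau> - x))" for x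
      proof -
        have [measurable]: "e \<in> borel_measurable borel" using e(4) by (rule borel_measurable_continuous_onI)
        have ez: "e t = 0" if "t \<notin> {-\<delta>..\<delta>}" for t
          by (rule e(7)) (use that in auto)
        from compact_support_bounded[OF e(4) compact_Icc ez] obtain b where b: "\<And>t. norm (e t) \<le> b" by blast
        have "integrable lborel (\<lambda>\<tau>. e (\<tau> - x) *\<^sub>R fs \<tau>)"
          by (rule Bochner_Integration.integrable_bound[OF integrable_mult_right[OF integrable_norm[OF fsi], of b]])
            (use fsi b in \<open>auto intro!: AE_I2 mult_right_mono order_trans[OF b[simplified] abs_ge_self] simp: abs_mult dest: borel_measurable_integrable\<close>)
        then show ?thesis by (simp add: mult.commute)
      qed
      have fa: "(LINT \<tau>|lborel. fs \<tau> * a2 \<tau>) = L (\<lambda>x. LINT \<tau>|lborel. fs \<tau> * e (\<tau> - x))"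
      proof -
        have "(LINT \<tau>|lborel. fs \<tau> * a2 \<tau>) = (LINT \<tau>|lborel. (\<rho> - t) * (fs \<tau> * e (\<tau> + \<rho>)) - 2 * \<rho> * (fs \<tau> * e (\<tau> - t)) +
            (t + \<rho>) * (fs \<tau> * e (\<tau> - \<rho>)))"
          unfolding a2_def L_def by (simp add: algebra_simps)
        also have "\<dots> = L (\<lambda>x. LINT \<tau>|lborel. fs \<tau> * e (\<tau> - x))"
          using fe[of "-\<rho>"] fe[of t] fe[of \<rho>] by (simp add: L_def)
        finally show ?thesis .
      qed
      (* on the side of \<open>f\<close> the mollifier returns nearly the value at the point *)
      have fclose: "\<bar>(LINT \<tau>|lborel. fs \<tau> * e (\<tau> - x)) - f x\<bar> \<le> \<eta>'" if x: "x \<in> {-\<rho>, t, \<rho>}" for x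
      proof -
        have ex: "e (\<tau> - x) = e (x - \<tau>)" for \<tau> using e(6)[of "x - \<tau>"] by simp
        have "norm ((LINT \<tau>|lborel. e (x - \<tau>) *\<^sub>R fs \<tau>) - f x) \<le> \<eta>'"
        proof (rule approximate_identity[OF e(8,9,5)])
          show "integrable lborel (\<lambda>\<tau>. e (x - \<tau>) *\<^sub>R fs \<tau>)" using fe[of x] by (simp add: ex mult.commute)
          fix \<tau> assume "e (x - \<tau>) \<noteq> 0"
          then have *: "\<bar>x - \<tau>\<bar> < \<delta>" using e(7)[of "x - \<tau>"] by force
          then have "x \<in> {-r..r}" "\<tau> \<in> {-r..r}" using x t \<rho> \<delta> by auto
          moreover have "dist \<tau> x < d" using * \<delta>(3) unfolding dist_real_def by linarith
          ultimately have "dist (f \<tau>) (f x) < \<eta>'" by (rule d(2))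
          then show "norm (fs \<tau> - f x) \<le> \<eta>'"
            using \<open>\<tau> \<in> {-r..r}\<close> by (simp add: fs_def dist_real_def)
        qed
        then show ?thesis by (simp add: ex mult.commute)
      qed
      have "\<bar>L (\<lambda>x. LINT \<tau>|lborel. fs \<tau> * e (\<tau> - x)) - L f\<bar> \<le> 4 * \<rho> * \<eta>'"
        by (rule Lbound) (rule fclose)
      then have "\<bar>L f - (L (?D m1) - L (?D m2))\<bar> \<le> 4 * \<rho> * \<eta>' + 4 * \<rho> * \<delta> * ?M m1 + 4 * \<rho> * \<delta> * ?M m2"
        using close[OF m1] close[OF m2] eq fa by linarith
      also have "\<dots> \<le> 4 * \<rho> * \<eta>' + 4 * \<rho> * \<eta>' * ?M m1 + 4 * \<rho> * \<eta>' * ?M m2"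
        using \<delta> \<rho> by (intro add_mono mult_right_mono mult_left_mono) auto
      also have "\<dots> = C * \<eta>'" by (simp add: C_def algebra_simps)
      also have "\<dots> = \<eta>" using C by (simp add: \<eta>'_def)
      finally show ?thesis .
    qed
    then have "\<bar>L f - (L (?D m1) - L (?D m2))\<bar> \<le> 0" by (rule field_le_epsilon[of _ 0, simplified])
    then show ?thesis by (simp add: L_def algebra_simps)
  qed
  define u where "u t = f t - (?D m1 t - ?D m2 t)" for t
  define \<beta> where "\<beta> = (u \<rho> - u (-\<rho>)) / (2 * \<rho>)"
  have u: "u t = u (-\<rho>) + \<beta> * (t + \<rho>)" if "-\<rho> \<le> t" "t \<le> \<rho>" for t
  proof -
    have "2 * \<rho> * u t = (\<rho> - t) * u (-\<rho>) + (t + \<rho>) * u \<rho>"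
      using key[OF that] unfolding u_def by linarith
    then have "u t = ((\<rho> - t) * u (-\<rho>) + (t + \<rho>) * u \<rho>) / (2 * \<rho>)" using \<rho> by (simp add: field_simps)
    then show ?thesis using \<rho> by (simp add: \<beta>_def field_simps)
  qed
  show thesis
  proof (rule that[of "\<beta> - ?M m1 + ?M m2"])
    fix s t assume st: "-\<rho> \<le> s" "s \<le> t" "t \<le> \<rho>"
    have eq: "f t - f s = (t - s) * \<beta> - (?D m1 s - ?D m1 t) + (?D m2 s - ?D m2 t)"
      using u[of s] u[of t] st unfolding u_def by (simp add: algebra_simps)
    have "f t - f s \<ge> (t - s) * \<beta> - (t - s) * (?M m1 - cdf m1 s) + (t - s) * (?M m2 - cdf m2 t)"
      unfolding eq using positive_part_increment[OF m1 st(2)] positive_part_increment[OF m2 st(2)] by linarith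
    moreover have "f t - f s \<le> (t - s) * \<beta> - (t - s) * (?M m1 - cdf m1 t) + (t - s) * (?M m2 - cdf m2 s)"
      unfolding eq using positive_part_increment[OF m1 st(2)] positive_part_increment[OF m2 st(2)] by linarith
    ultimately show "(t - s) * (\<beta> - ?M m1 + ?M m2 + cdf m1 s - cdf m2 t) \<le> f t - f s \<and>
       f t - f s \<le> (t - s) * (\<beta> - ?M m1 + ?M m2 + cdf m1 t - cdf m2 s)"
      by (simp add: algebra_simps)
  qed
qed

text \<open>
  The error of the linearization with slope \<open>B + c1 s - c2 s\<close> is of second order in the sense of
  \<open>increments_eq_if_bv_bound\<close>: length times variation of \<open>c1 + c2\<close>.
\<close>
lemma slope_estimate_error:
  fixes f c1 c2 :: "real \<Rightarrow> real"
  assumes est: "\<And>s t. s \<in> {-\<rho>..\<rho>} \<Longrightarrow> t \<in> {-\<rho>..\<rho>} \<Longrightarrow> s \<le> t \<Longrightarrow>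
      (t - s) * (B + c1 s - c2 t) \<le> f t - f s \<and> f t - f s \<le> (t - s) * (B + c1 t - c2 s)"
    and mono: "mono c1" "mono c2" and st: "s \<in> {-\<rho>..\<rho>}" "t \<in> {-\<rho>..\<rho>}"
  shows "\<bar>f t - f s - (B + c1 s - c2 s) * (t - s)\<bar> \<le> \<bar>t - s\<bar> * (\<bar>c1 t - c1 s\<bar> + \<bar>c2 t - c2 s\<bar>)"
proof (cases "s \<le> t")
  case True
  then have m: "c1 s \<le> c1 t" "c2 s \<le> c2 t" using mono by (auto dest: monoD)
  have "f t - f s - (B + c1 s - c2 s) * (t - s) \<le> (t - s) * (c1 t - c1 s)"
    "- ((t - s) * (c2 t - c2 s)) \<le> f t - f s - (B + c1 s - c2 s) * (t - s)"
    using est[OF st True] by (simp_all add: algebra_simps)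
  moreover have "0 \<le> (t - s) * (c1 t - c1 s)" "0 \<le> (t - s) * (c2 t - c2 s)" using True m by auto
  ultimately have "\<bar>f t - f s - (B + c1 s - c2 s) * (t - s)\<bar> \<le> (t - s) * (c1 t - c1 s) + (t - s) * (c2 t - c2 s)"
    by linarith
  then show ?thesis using True m by (simp add: algebra_simps)
next
  case False
  then have ts: "t \<le> s" by simp
  then have m: "c1 t \<le> c1 s" "c2 t \<le> c2 s" using monoD[OF mono(1)] monoD[OF mono(2)] by blast+
  have "f t - f s - (B + c1 s - c2 s) * (t - s) \<le> (s - t) * (c1 s - c1 t)"
    "- ((s - t) * (c2 s - c2 t)) \<le> f t - f s - (B + c1 s - c2 s) * (t - s)"
    using est[OF st(2,1) ts] by (simp_all add: algebra_simps)
  moreover have "0 \<le> (s - t) * (c1 s - c1 t)" "0 \<le> (s - t) * (c2 s - c2 t)" using ts m by auto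
  ultimately have "\<bar>f t - f s - (B + c1 s - c2 s) * (t - s)\<bar> \<le> (s - t) * (c1 s - c1 t) + (s - t) * (c2 s - c2 t)"
    by linarith
  then show ?thesis using ts m by (simp add: algebra_simps)
qed

lemma slope_estimate_derivative:
  fixes f c1 c2 :: "real \<Rightarrow> real"
  assumes est: "\<And>s t. s \<in> {-\<rho>..\<rho>} \<Longrightarrow> t \<in> {-\<rho>..\<rho>} \<Longrightarrow> s \<le> t \<Longrightarrow>
      (t - s) * (B + c1 s - c2 t) \<le> f t - f s \<and> f t - f s \<le> (t - s) * (B + c1 t - c2 s)"
    and mono: "mono c1" "mono c2" and t: "t \<in> {-\<rho><..<\<rho>}" and cont: "isCont c1 t" "isCont c2 t"
  shows "(f has_real_derivative (B + c1 t - c2 t)) (at t)"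
proof -
  let ?F = "B + c1 t - c2 t"
  have "((\<lambda>x. (f x - f t - ?F * (x - t)) / (x - t)) \<longlongrightarrow> 0) (at t)"
  proof (rule Lim_null_comparison)
    have "eventually (\<lambda>x. x \<in> {-\<rho><..<\<rho>} - {t}) (at t)"
      using t by (intro eventually_at_in_open) auto
    then show "eventually (\<lambda>x. norm ((f x - f t - ?F * (x - t)) / (x - t)) \<le> \<bar>c1 x - c1 t\<bar> + \<bar>c2 x - c2 t\<bar>) (at t)"
    proof eventually_elim
      case (elim x)
      then have "\<bar>f x - f t - ?F * (x - t)\<bar> \<le> \<bar>x - t\<bar> * (\<bar>c1 x - c1 t\<bar> + \<bar>c2 x - c2 t\<bar>)"
        using t by (intro slope_estimate_error[OF est mono]) auto
      then show ?case using elim by (simp add: abs_divide pos_divide_le_eq mult.commute)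
    qed
    have "((\<lambda>x. \<bar>c1 x - c1 t\<bar> + \<bar>c2 x - c2 t\<bar>) \<longlongrightarrow> \<bar>c1 t - c1 t\<bar> + \<bar>c2 t - c2 t\<bar>) (at t)"
      using cont unfolding isCont_def by (intro tendsto_intros)
    then show "((\<lambda>x. \<bar>c1 x - c1 t\<bar> + \<bar>c2 x - c2 t\<bar>) \<longlongrightarrow> 0) (at t)" by simp
  qed
  then have lim: "((\<lambda>x. (f x - f t - ?F * (x - t)) / (x - t) + ?F) \<longlongrightarrow> 0 + ?F) (at t)"
    by (intro tendsto_add tendsto_const)
  have ev: "eventually (\<lambda>x. (f x - f t - ?F * (x - t)) / (x - t) + ?F = (f x - f t) / (x - t)) (at t)"
    unfolding eventually_at_filter by (rule always_eventually) (auto simp: diff_divide_distrib)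
  show ?thesis
    unfolding has_field_derivative_iff using Lim_transform_eventually[OF lim ev] by simp
qed

lemma slope_estimate_lipschitz:
  fixes f c1 c2 :: "real \<Rightarrow> real"
  assumes est: "\<And>s t. s \<in> {-\<rho>..\<rho>} \<Longrightarrow> t \<in> {-\<rho>..\<rho>} \<Longrightarrow> s \<le> t \<Longrightarrow>
      (t - s) * (B + c1 s - c2 t) \<le> f t - f s \<and> f t - f s \<le> (t - s) * (B + c1 t - c2 s)"
    and bound: "\<And>t. 0 \<le> c1 t \<and> c1 t \<le> M1" "\<And>t. 0 \<le> c2 t \<and> c2 t \<le> M2"
    and st: "s \<in> {-\<rho>..\<rho>}" "t \<in> {-\<rho>..\<rho>}"
  shows "\<bar>f t - f s\<bar> \<le> (\<bar>B\<bar> + M1 + M2) * \<bar>t - s\<bar>"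
proof -
  have *: "\<bar>f t - f s\<bar> \<le> (\<bar>B\<bar> + M1 + M2) * (t - s)" if "s \<in> {-\<rho>..\<rho>}" "t \<in> {-\<rho>..\<rho>}" "s \<le> t" for s t
  proof -
    have "(t - s) * (B + c1 t - c2 s) \<le> (t - s) * (\<bar>B\<bar> + M1 + M2)"
      using bound(1)[of t] bound(2)[of s] that by (intro mult_left_mono) auto
    moreover have "(t - s) * (- (\<bar>B\<bar> + M1 + M2)) \<le> (t - s) * (B + c1 s - c2 t)"
      using bound(1)[of s] bound(2)[of t] that by (intro mult_left_mono) auto
    moreover have "(t - s) * (- (\<bar>B\<bar> + M1 + M2)) = - ((\<bar>B\<bar> + M1 + M2) * (t - s))"
      by (simp only: mult_minus_right mult.commute)
    moreover have "(t - s) * (\<bar>B\<bar> + M1 + M2) = (\<bar>B\<bar> + M1 + M2) * (t - s)" by (rule mult.commute)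
    ultimately show ?thesis using est[OF that] unfolding abs_le_iff by linarith
  qed
  show ?thesis using *[of s t] *[of t s] st by (cases "s \<le> t") (auto simp: abs_minus_commute)
qed

text \<open>
  The slope \<open>F = B + c1 - c2\<close> is right continuous, so \<open>\<bar>F\<bar> = 1\<close> spreads from a dense set to all points. Having
  a right value and a left limit at \<open>0\<close>, it cannot jump between \<open>1\<close> and \<open>-1\<close> arbitrarily close to
  \<open>0\<close> on either side.
\<close>
lemma unit_slopes_piecewise_linear:
  fixes f c1 c2 :: "real \<Rightarrow> real"
  assumes \<rho>: "0 < \<rho>"
    and est: "\<And>s t. s \<in> {-\<rho>..\<rho>} \<Longrightarrow> t \<in> {-\<rho>..\<rho>} \<Longrightarrow> s \<le> t \<Longrightarrow>
      (t - s) * (B + c1 s - c2 t) \<le> f t - f s \<and> f t - f s \<le> (t - s) * (B + c1 t - c2 s)"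
    and mono: "mono c1" "mono c2"
    and right: "\<And>t. (c1 \<longlongrightarrow> c1 t) (at_right t)" "\<And>t. (c2 \<longlongrightarrow> c2 t) (at_right t)"
    and left: "(c1 \<longlongrightarrow> l1) (at_left 0)" "(c2 \<longlongrightarrow> l2) (at_left 0)"
    and dense: "\<And>a b. -\<rho> < a \<Longrightarrow> a < b \<Longrightarrow> b < \<rho> \<Longrightarrow> \<exists>t. a < t \<and> t < b \<and> \<bar>B + c1 t - c2 t\<bar> = 1"
  obtains \<delta> \<sigma> \<tau> where "0 < \<delta>" "\<delta> < \<rho>" "\<bar>\<sigma>\<bar> = 1" "\<bar>\<tau>\<bar> = (1::real)"
    "\<And>t. 0 \<le> t \<Longrightarrow> t \<le> \<delta> \<Longrightarrow> f t = f 0 + \<sigma> * t" "\<And>t. -\<delta> \<le> t \<Longrightarrow> t \<le> 0 \<Longrightarrow> f t = f 0 + \<tau> * t"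
proof -
  define F where "F t = B + c1 t - c2 t" for t
  have Fr: "(F \<longlongrightarrow> F t) (at_right t)" for t
    unfolding F_def[abs_def] by (intro tendsto_intros right)
  have Fl: "(F \<longlongrightarrow> B + l1 - l2) (at_left 0)"
    unfolding F_def[abs_def] by (intro tendsto_intros left)
  have unit: "\<bar>F t\<bar> = 1" if t: "-\<rho> < t" "t < \<rho>" for t
  proof (rule ccontr)
    assume ne: "\<bar>F t\<bar> \<noteq> 1"
    have "((\<lambda>x. \<bar>F x\<bar>) \<longlongrightarrow> \<bar>F t\<bar>) (at_right t)" by (intro tendsto_rabs Fr)
    then have "eventually (\<lambda>x. \<bar>F x\<bar> \<noteq> 1) (at_right t)" using ne by (rule tendsto_imp_eventually_ne)
    then obtain b where b: "b > t" "\<And>y. t < y \<Longrightarrow> y < b \<Longrightarrow> \<bar>F y\<bar> \<noteq> 1"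
      unfolding eventually_at_right_field by blast
    define b' where "b' = (t + min b \<rho>) / 2"
    have "t < b'" "b' < \<rho>" "b' < b" using b(1) t by (auto simp: b'_def)
    then obtain x where "t < x" "x < b'" "\<bar>F x\<bar> = 1" using dense[OF t(1)] unfolding F_def by blast
    then show False using b(2)[of x] \<open>b' < b\<close> by simp
  qed
  (* constant slope on the half-open interval gives linearity on the closed one *)
  have linear: "f t = f s + \<sigma> * (t - s)"
    if "s \<in> {-\<rho>..\<rho>}" "t \<in> {-\<rho>..\<rho>}" "s \<le> t" and \<sigma>: "\<And>x. s \<le> x \<Longrightarrow> x < t \<Longrightarrow> F x = \<sigma>" for s t \<sigma>
  proof -
    have "f t - \<sigma> * t = f s - \<sigma> * s"
    proof (rule increments_eq_if_bv_bound[where G="\<lambda>x. f x - \<sigma> * x" and V="\<lambda>x. c1 x + c2 x" and a=s and b=t])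
      fix x y assume xy: "x \<in> {s..t}" "y \<in> {s..t}" "x \<le> y"
      show "\<bar>f y - \<sigma> * y - (f x - \<sigma> * x)\<bar> \<le> (y - x) * (c1 y + c2 y - (c1 x + c2 x))"
      proof (cases "x = y")
        case False
        then have "F x = \<sigma>" using xy \<sigma> by simp
        moreover have "\<bar>f y - f x - F x * (y - x)\<bar> \<le> \<bar>y - x\<bar> * (\<bar>c1 y - c1 x\<bar> + \<bar>c2 y - c2 x\<bar>)"
          unfolding F_def using xy that by (intro slope_estimate_error[OF est mono]) auto
        moreover have "c1 x \<le> c1 y" "c2 x \<le> c2 y" using mono xy by (auto dest: monoD)
        ultimately show ?thesis using xy by (simp add: algebra_simps)
      qed simp
    qed (use that in auto)
    then show ?thesis by (simp add: algebra_simps)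
  qed
  have "eventually (\<lambda>x. dist (F x) (F 0) < 1) (at_right 0)" using Fr[of 0] by (rule tendstoD) simp
  then obtain b where b: "b > 0" "\<And>y. 0 < y \<Longrightarrow> y < b \<Longrightarrow> \<bar>F y - F 0\<bar> < 1"
    unfolding eventually_at_right_field dist_real_def by blast
  have "eventually (\<lambda>x. dist (F x) (B + l1 - l2) < 1/2) (at_left 0)" using Fl by (rule tendstoD) simp
  then obtain a where a: "a < 0" "\<And>y. a < y \<Longrightarrow> y < 0 \<Longrightarrow> \<bar>F y - (B + l1 - l2)\<bar> < 1/2"
    unfolding eventually_at_left_field dist_real_def by blast
  (* values in \<open>{1, -1}\<close> closer than \<open>2\<close> coincide; on the left two values are compared through
     the limit, hence the tolerance \<open>1/2\<close> there *)
  define \<delta> where "\<delta> = min (b / 2) (min (- a / 2) (\<rho> / 2))"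
  have \<delta>: "0 < \<delta>" "\<delta> < b" "\<delta> < - a" "\<delta> < \<rho>"
    using b(1) a(1) \<rho> unfolding \<delta>_def by linarith+
  have R: "F x = F 0" if "0 \<le> x" "x < \<delta>" for x
  proof (cases "x = 0")
    case False
    then have "\<bar>F x - F 0\<bar> < 1" using b(2)[of x] that \<delta> by simp
    moreover have "\<bar>F x\<bar> = 1" "\<bar>F 0\<bar> = 1" using unit[of x] unit[of 0] that \<delta> by auto
    ultimately show ?thesis by linarith
  qed simp
  have L: "F x = F (-\<delta>)" if "-\<delta> \<le> x" "x < 0" for x
  proof -
    have "\<bar>F x - (B + l1 - l2)\<bar> < 1/2" "\<bar>F (-\<delta>) - (B + l1 - l2)\<bar> < 1/2"
      using a(2)[of x] a(2)[of "-\<delta>"] that \<delta> by auto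
    moreover have "\<bar>F x\<bar> = 1" "\<bar>F (-\<delta>)\<bar> = 1" using unit[of x] unit[of "-\<delta>"] that \<delta> by auto
    ultimately show ?thesis by linarith
  qed
  show thesis
  proof (rule that[of \<delta> "F 0" "F (-\<delta>)"])
    show "\<bar>F 0\<bar> = 1" "\<bar>F (-\<delta>)\<bar> = 1" using unit[of 0] unit[of "-\<delta>"] \<delta> by auto
    show "f t = f 0 + F 0 * t" if t: "0 \<le> t" "t \<le> \<delta>" for t
    proof -
      have "f t = f 0 + F 0 * (t - 0)" proof (rule linear)
        show "F x = F 0" if "0 \<le> x" "x < t" for x by (rule R) (use that t in auto)
      qed (use t \<delta> in auto)
      then show ?thesis by simp
    qed
    show "f t = f 0 + F (-\<delta>) * t" if t: "-\<delta> \<le> t" "t \<le> 0" for t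
    proof -
      have "F x = F (-\<delta>)" if "t \<le> x" "x < 0" for x by (rule L) (use that t in auto)
      then have "f 0 = f t + F (-\<delta>) * (0 - t)" using t \<delta> by (intro linear) auto
      then show ?thesis by simp
    qed
  qed (use \<delta> in auto)
qed

section \<open>Weak and classical derivatives of Lipschitz functions\<close>

lemma lborel_integral_translate:
  fixes g :: "complex \<Rightarrow> real"
  assumes "g \<in> borel_measurable borel"
  shows "(LINT z|lborel. g (z + c)) = (LINT z|lborel. g z)"
    and "integrable lborel (\<lambda>z. g (z + c)) \<longleftrightarrow> integrable lborel g"
proof -
  have m: "(\<lambda>z. g (z + c)) \<in> borel_measurable borel" using assms by measurable
  show "(LINT z|lborel. g (z + c)) = (LINT z|lborel. g z)"
    using lborel_integral_reflect(1)[OF m, of 0] lborel_integral_reflect(1)[OF assms, of c] by simp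
  show "integrable lborel (\<lambda>z. g (z + c)) \<longleftrightarrow> integrable lborel g"
    using lborel_integral_reflect(2)[OF m, of 0] lborel_integral_reflect(2)[OF assms, of c] by simp
qed

text \<open>
  Difference quotients of a test function converge uniformly to the directional derivative.
\<close>
lemma difference_quotient_test_integral:
  fixes u \<phi> :: "complex \<Rightarrow> real"
  assumes u: "integrable lborel u" and \<phi>: "test_fun \<Omega> \<phi>"
  shows "(\<lambda>n. LINT z|lborel. (\<phi> (z + (1 / Suc n) *\<^sub>R v) - \<phi> z) / (1 / Suc n) * u z)
    \<longlonglongrightarrow> (LINT z|lborel. dir_deriv v \<phi> z * u z)"
proof (rule LIMSEQ_I)
  fix e :: real assume e: "0 < e"
  let ?N = "LINT z|lborel. norm (u z)"
  define e' where "e' = e / (2 * (norm v * ?N + 1))"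
  have N: "0 < norm v * ?N + 1" by (rule add_nonneg_pos) auto
  have e': "0 < e'" using e N by (simp add: e'_def)
  have "e' * (norm v * ?N) \<le> e' * (norm v * ?N + 1)" using e' by (intro mult_left_mono) auto
  also have "\<dots> = e / 2" using N by (simp add: e'_def field_simps)
  finally have e'N: "e' * (norm v * ?N) < e" using e by linarith
  obtain K where K: "compact K" "\<And>z. z \<notin> K \<Longrightarrow> \<phi> z = 0" and sm: "smooth_on UNIV \<phi>" using test_funE[OF \<phi>] by metis
  obtain d where d: "0 < d" "\<And>x v. norm v < d \<Longrightarrow> \<bar>\<phi> (x + v) - \<phi> x - dir_deriv v \<phi> x\<bar> \<le> e' * norm v"
    using uniform_linearization[OF sm K e'] by blast
  obtain n0 where n0: "norm v / d < real n0" using reals_Archimedean2 by blast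
  show "\<exists>n0. \<forall>n\<ge>n0. norm ((LINT z|lborel. (\<phi> (z + (1 / Suc n) *\<^sub>R v) - \<phi> z) / (1 / Suc n) * u z) -
      (LINT z|lborel. dir_deriv v \<phi> z * u z)) < e"
  proof (intro exI[of _ n0] allI impI)
    fix n assume n: "n0 \<le> n"
    define t where "t = 1 / real (Suc n)"
    have t: "0 < t" by (simp add: t_def)
    have "norm v < d * Suc n" using n0 n d(1) by (simp add: pos_divide_less_eq mult.commute) (smt (verit) mult_left_mono of_nat_mono)
    then have td: "norm (t *\<^sub>R v) < d" by (simp add: t_def pos_divide_less_eq)
    have close: "\<bar>(\<phi> (z + t *\<^sub>R v) - \<phi> z) / t - dir_deriv v \<phi> z\<bar> \<le> e' * norm v" for z
    proof -
      have "dir_deriv (t *\<^sub>R v) \<phi> z = t * dir_deriv v \<phi> z"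
        using linear_scale[OF has_derivative_linear[OF smooth_on_has_derivative[OF sm UNIV_I]]] by simp
      then have "\<bar>\<phi> (z + t *\<^sub>R v) - \<phi> z - t * dir_deriv v \<phi> z\<bar> \<le> e' * (t * norm v)"
        using d(2)[OF td, of z] t by simp
      moreover have "\<bar>(\<phi> (z + t *\<^sub>R v) - \<phi> z) / t - dir_deriv v \<phi> z\<bar> = \<bar>\<phi> (z + t *\<^sub>R v) - \<phi> z - t * dir_deriv v \<phi> z\<bar> / t"
        using t by (simp add: field_simps abs_divide[symmetric])
      ultimately show ?thesis using t by (simp add: pos_divide_le_eq mult.commute mult.left_commute)
    qed
    have m: "(\<lambda>z. (\<phi> (z + t *\<^sub>R v) - \<phi> z) / t - dir_deriv v \<phi> z) \<in> borel_measurable borel"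
    proof (rule borel_measurable_continuous_onI)
      have c: "continuous_on UNIV \<phi>" "continuous_on UNIV (dir_deriv v \<phi>)"
        using smooth_on_continuous sm smooth_on_dir_deriv by blast+
      have "continuous_on UNIV (\<lambda>z. \<phi> (z + t *\<^sub>R v))"
        by (rule continuous_on_compose2[OF c(1)]) (intro continuous_intros, simp)
      then show "continuous_on UNIV (\<lambda>z. (\<phi> (z + t *\<^sub>R v) - \<phi> z) / t - dir_deriv v \<phi> z)"
        using t c by (intro continuous_on_diff continuous_on_divide continuous_on_const) auto
    qed
    have i: "integrable lborel (\<lambda>z. ((\<phi> (z + t *\<^sub>R v) - \<phi> z) / t - dir_deriv v \<phi> z) * u z)"
      using integrable_bounded_scaleR[OF u m close] by simp
    have i2: "integrable lborel (\<lambda>z. dir_deriv v \<phi> z * u z)"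
      using test_integrable[OF u test_fun_dir_deriv[OF \<phi>]] by simp
    have i1: "integrable lborel (\<lambda>z. (\<phi> (z + t *\<^sub>R v) - \<phi> z) / t * u z)"
      using Bochner_Integration.integrable_add[OF i i2] by (simp add: algebra_simps)
    have "(LINT z|lborel. (\<phi> (z + t *\<^sub>R v) - \<phi> z) / t * u z) - (LINT z|lborel. dir_deriv v \<phi> z * u z) =
        (LINT z|lborel. ((\<phi> (z + t *\<^sub>R v) - \<phi> z) / t - dir_deriv v \<phi> z) * u z)"
      unfolding left_diff_distrib by (rule Bochner_Integration.integral_diff[OF i1 i2, symmetric])
    also have "norm \<dots> \<le> (LINT z|lborel. (e' * norm v) * norm (u z))"
      by (rule Bochner_Integration.integral_norm_bound_integral[OF i])
        (use u close in \<open>auto simp: abs_mult intro!: mult_right_mono\<close>)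
    also have "\<dots> = e' * (norm v * ?N)" by simp
    also have "\<dots> < e" by (rule e'N)
    finally show "norm ((LINT z|lborel. (\<phi> (z + (1 / Suc n) *\<^sub>R v) - \<phi> z) / (1 / Suc n) * u z) -
      (LINT z|lborel. dir_deriv v \<phi> z * u z)) < e" unfolding t_def .
  qed
qed

text \<open>
  The difference quotient is moved from the test function to \<open>u\<close> by a translation. The Lipschitz bound
  dominates the quotients of \<open>u\<close>, so they may converge under the integral.
\<close>
lemma weak_derivative_eq_classical:
  fixes u p d :: "complex \<Rightarrow> real"
  assumes u: "integrable lborel u" and p: "integrable lborel p" and d: "integrable lborel d"
    and weak: "\<And>\<phi>. test_fun (ball c R) \<phi> \<Longrightarrow>
      (LINT z|lborel. dir_deriv v \<phi> z * u z) = - (LINT z|lborel. \<phi> z * p z)"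
    and lip: "\<And>x y. x \<in> ball c R \<Longrightarrow> y \<in> ball c R \<Longrightarrow> \<bar>u x - u y\<bar> \<le> L * norm (x - y)"
    and deriv: "AE z in lborel. z \<in> ball c R \<longrightarrow>
      (\<lambda>n. (u (z - (1 / Suc n) *\<^sub>R v) - u z) / (1 / Suc n)) \<longlonglongrightarrow> - d z"
  shows "AE z in lborel. z \<in> ball c R \<longrightarrow> p z = d z"
proof -
  have um[measurable]: "u \<in> borel_measurable borel" using u by (auto dest: borel_measurable_integrable)
  have "AE z in lborel. z \<in> ball c R \<longrightarrow> p z - d z = 0"
  proof (rule fundamental_lemma)
    fix \<phi> assume \<phi>: "test_fun (ball c R) \<phi>"
    obtain K where K: "compact K" "K \<subseteq> ball c R" "\<And>z. z \<notin> K \<Longrightarrow> \<phi> z = 0" using test_funE[OF \<phi>] by metis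
    have \<phi>c: "continuous_on UNIV \<phi>" by (rule test_fun_continuous[OF \<phi>])
    have [measurable]: "\<phi> \<in> borel_measurable borel" using \<phi>c by (rule borel_measurable_continuous_onI)
    obtain r where r: "0 < r" "(\<Union>x\<in>K. cball x r) \<subseteq> ball c R"
      using compact_subset_open_imp_cball_epsilon_subset[OF K(1) open_ball K(2)] by blast
    define q where "q n z = \<phi> z * ((u (z - (1 / Suc n) *\<^sub>R v) - u z) / (1 / Suc n))" for n z
    have iu: "integrable lborel (\<lambda>z. \<phi> (z + w) * u z)" for w
    proof -
      obtain B where "\<And>z. \<bar>\<phi> z\<bar> \<le> B" using test_fun_bounded[OF \<phi>] by blast
      then show ?thesis
        using integrable_bounded_scaleR[OF u, of "\<lambda>z. \<phi> (z + w)" B] by simp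
    qed
    have shift: "(LINT z|lborel. \<phi> (z + w) * u z) = (LINT z|lborel. \<phi> z * u (z - w))"
      "integrable lborel (\<lambda>z. \<phi> z * u (z - w))" for w
      using lborel_integral_translate[of "\<lambda>z. \<phi> z * u (z - w)" w] iu[of w] by simp_all
    have eq: "(LINT z|lborel. (\<phi> (z + (1 / Suc n) *\<^sub>R v) - \<phi> z) / (1 / Suc n) * u z) = (LINT z|lborel. q n z)" for n
    proof -
      let ?t = "1 / real (Suc n)"
      have "(LINT z|lborel. (\<phi> (z + ?t *\<^sub>R v) - \<phi> z) / ?t * u z) =
          (LINT z|lborel. (\<phi> (z + ?t *\<^sub>R v) * u z - \<phi> (z + 0) * u z) / ?t)"
        by (simp add: algebra_simps del: of_nat_Suc)
      also have "\<dots> = (LINT z|lborel. (\<phi> z * u (z - ?t *\<^sub>R v) - \<phi> z * u (z - 0)) / ?t)"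
        using iu[of "?t *\<^sub>R v"] iu[of 0] shift[of "?t *\<^sub>R v"] shift[of 0]
        by (simp del: of_nat_Suc add_0_right diff_0_right)
      also have "\<dots> = (LINT z|lborel. q n z)" unfolding q_def by (simp add: algebra_simps del: of_nat_Suc)
      finally show ?thesis .
    qed
    (* from \<open>n0\<close> on, translating the support of \<open>\<phi>\<close> stays inside the ball, where \<open>u\<close> is Lipschitz *)
    obtain n0 where n0: "norm v / r < real n0" using reals_Archimedean2 by blast
    have "(\<lambda>n. LINT z|lborel. q (n + n0) z) \<longlonglongrightarrow> (LINT z|lborel. \<phi> z * - d z)"
    proof (rule integral_dominated_convergence[where w="\<lambda>z. \<bar>\<phi> z\<bar> * (L * norm v)"])
      show "integrable lborel (\<lambda>z. \<bar>\<phi> z\<bar> * (L * norm v))"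
        by (intro integrable_mult_left integrable_abs integrable_continuous_compact_support[OF \<phi>c K(1,3)])
      show "AE z in lborel. (\<lambda>n. q (n + n0) z) \<longlonglongrightarrow> \<phi> z * - d z"
        using deriv
      proof eventually_elim
        case (elim z)
        show ?case
        proof (cases "z \<in> ball c R")
          case True
          then have "(\<lambda>n. q n z) \<longlonglongrightarrow> \<phi> z * - d z" unfolding q_def using elim by (intro tendsto_mult tendsto_const) simp
          then show ?thesis by (rule LIMSEQ_ignore_initial_segment)
        next
          case False
          then have "\<phi> z = 0" using K by blast
          then show ?thesis by (simp add: q_def)
        qed
      qed
      show "AE z in lborel. norm (q (n + n0) z) \<le> \<bar>\<phi> z\<bar> * (L * norm v)" for n
      proof (rule AE_I2)
        fix z
        show "norm (q (n + n0) z) \<le> \<bar>\<phi> z\<bar> * (L * norm v)"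
        proof (cases "z \<in> K")
          case True
          define t where "t = 1 / real (Suc (n + n0))"
          have t: "0 < t" by (simp add: t_def)
          have "norm v < r * real n0" using n0 r(1) by (simp add: pos_divide_less_eq mult.commute)
          also have "\<dots> \<le> r * Suc (n + n0)" using r(1) by (intro mult_left_mono) auto
          finally have "norm (t *\<^sub>R v) < r" by (simp add: t_def pos_divide_less_eq)
          then have "z - t *\<^sub>R v \<in> cball z r" by (simp add: dist_norm)
          then have "z - t *\<^sub>R v \<in> ball c R" "z \<in> ball c R" using r True K(2) by blast+
          then have "\<bar>u (z - t *\<^sub>R v) - u z\<bar> \<le> L * norm (z - t *\<^sub>R v - z)" by (rule lip)
          also have "\<dots> = L * norm v * t" using t by simp
          finally have "\<bar>(u (z - t *\<^sub>R v) - u z) / t\<bar> \<le> L * norm v" using t by (simp add: abs_divide pos_divide_le_eq)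
          then show ?thesis unfolding q_def t_def by (simp add: abs_mult mult_left_mono del: of_nat_Suc)
        qed (simp add: q_def K(3))
      qed
      show "(\<lambda>z. \<phi> z * - d z) \<in> borel_measurable lborel" using d by (auto dest: borel_measurable_integrable)
      show "q (n + n0) \<in> borel_measurable lborel" for n unfolding q_def by measurable
    qed
    moreover have "(\<lambda>n. LINT z|lborel. q (n + n0) z) \<longlonglongrightarrow> (LINT z|lborel. dir_deriv v \<phi> z * u z)"
      using LIMSEQ_ignore_initial_segment[OF difference_quotient_test_integral[OF u \<phi>, of v], of n0] unfolding eq .
    ultimately have "(LINT z|lborel. dir_deriv v \<phi> z * u z) = (LINT z|lborel. \<phi> z * - d z)"
      by (rule LIMSEQ_unique[rotated])
    then have "(LINT z|lborel. \<phi> z * p z) = (LINT z|lborel. \<phi> z * d z)"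
      unfolding weak[OF \<phi>] by simp
    then show "(LINT z|lborel. \<phi> z * (p z - d z)) = 0"
      using test_integrable[OF p \<phi>] test_integrable[OF d \<phi>] by (simp add: right_diff_distrib)
  qed (use p d in auto)
  then show ?thesis by eventually_elim simp
qed

section \<open>The weak gradient of a stationary harmonic function\<close>

lemma integrable_lebesgue_on_1:
  assumes "open \<Omega>" "bounded \<Omega>" shows "integrable (lebesgue_on \<Omega>) (\<lambda>z::complex. 1::real)"
proof -
  have l: "\<Omega> \<in> lmeasurable" using assms by (intro bounded_set_imp_lmeasurable) auto
  have "integrable lebesgue (indicator \<Omega> :: complex \<Rightarrow> real)"
    using l by (auto simp: fmeasurable_def)
  moreover have "\<Omega> \<inter> space lebesgue \<in> sets lebesgue" using assms by auto
  ultimately show ?thesis by (subst integrable_restrict_space) simp_all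
qed

lemma L2_on_imp_integrable:
  assumes "open \<Omega>" "bounded \<Omega>" "L2_on \<Omega> f" shows "integrable (lebesgue_on \<Omega>) f"
proof (rule Bochner_Integration.integrable_bound[of _ "\<lambda>z. 1 + (f z)\<^sup>2"])
  show "integrable (lebesgue_on \<Omega>) (\<lambda>z. 1 + (f z)\<^sup>2)"
    using integrable_lebesgue_on_1[OF assms(1,2)] assms(3) by (auto simp: L2_on_def)
  have "\<bar>x\<bar> \<le> 1 + x\<^sup>2" for x :: real
  proof -
    have "0 \<le> (\<bar>x\<bar> - 1)\<^sup>2" by simp
    then show ?thesis by (simp add: power2_diff)
  qed
  then show "AE z in lebesgue_on \<Omega>. norm (f z) \<le> norm (1 + (f z)\<^sup>2)"
    by (intro AE_I2) (simp add: order_trans[OF _ abs_ge_self])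
qed (use assms in \<open>auto simp: L2_on_def\<close>)

lemma L2_on_mult_integrable:
  assumes "L2_on \<Omega> f" "L2_on \<Omega> g" shows "integrable (lebesgue_on \<Omega>) (\<lambda>z. f z * g z)"
proof (rule Bochner_Integration.integrable_bound[of _ "\<lambda>z. (f z)\<^sup>2 + (g z)\<^sup>2"])
  show "integrable (lebesgue_on \<Omega>) (\<lambda>z. (f z)\<^sup>2 + (g z)\<^sup>2)"
    using assms by (auto simp: L2_on_def)
  have "\<bar>x * y\<bar> \<le> x\<^sup>2 + y\<^sup>2" for x y :: real
  proof -
    have "0 \<le> (x + y)\<^sup>2 + (x\<^sup>2 + y\<^sup>2)" "0 \<le> (x - y)\<^sup>2 + (x\<^sup>2 + y\<^sup>2)" by auto
    then have "2 * (x * y) \<le> 2 * (x\<^sup>2 + y\<^sup>2)" "- (2 * (x * y)) \<le> 2 * (x\<^sup>2 + y\<^sup>2)"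
      by (simp_all add: power2_sum power2_diff)
    then show ?thesis by (simp add: abs_le_iff)
  qed
  then show "AE z in lebesgue_on \<Omega>. norm (f z * g z) \<le> norm ((f z)\<^sup>2 + (g z)\<^sup>2)"
    by (intro AE_I2) (simp add: order_trans[OF _ abs_ge_self])
qed (use assms in \<open>auto simp: L2_on_def\<close>)

lemma test_fun_borel: "test_fun \<Omega> \<phi> \<Longrightarrow> \<phi> \<in> borel_measurable borel"
  by (intro borel_measurable_continuous_onI test_fun_continuous)

lemma integrable_lebesgue_on_times_test:
  fixes f :: "complex \<Rightarrow> real"
  assumes "integrable (lebesgue_on \<Omega>) f" "test_fun \<Omega>' \<phi>"
  shows "integrable (lebesgue_on \<Omega>) (\<lambda>z. f z * \<phi> z)"
proof -
  obtain B where B: "\<And>z. \<bar>\<phi> z\<bar> \<le> B" using test_fun_bounded[OF assms(2)] by blast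
  have "\<phi> \<in> borel_measurable lebesgue"
    using test_fun_borel[OF assms(2)] by (intro measurable_completion) simp
  then have m: "\<phi> \<in> borel_measurable (lebesgue_on \<Omega>)" by (rule measurable_restrict_space1)
  show ?thesis
  proof (rule Bochner_Integration.integrable_bound[of _ "\<lambda>z. B * norm (f z)"])
    show "AE z in lebesgue_on \<Omega>. norm (f z * \<phi> z) \<le> norm (B * norm (f z))"
    proof (rule AE_I2)
      fix z
      have "norm (f z * \<phi> z) \<le> norm (f z) * B" using B[of z] by (simp add: abs_mult mult_left_mono)
      then show "norm (f z * \<phi> z) \<le> norm (B * norm (f z))" by (simp add: mult.commute order_trans[OF _ abs_ge_self])
    qed
  qed (use assms m in auto)
qed

lemma weak_deriv_spec:
  assumes "H1_on \<Omega> h" "v = 1 \<or> v = \<i>"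
  shows "L2_on \<Omega> (weak_deriv \<Omega> v h)" "is_weak_deriv \<Omega> v h (weak_deriv \<Omega> v h)"
proof -
  have "\<exists>g. L2_on \<Omega> g \<and> is_weak_deriv \<Omega> v h g" using assms unfolding H1_on_def by blast
  then have "L2_on \<Omega> (weak_deriv \<Omega> v h) \<and> is_weak_deriv \<Omega> v h (weak_deriv \<Omega> v h)"
    unfolding weak_deriv_def by (rule someI_ex)
  then show "L2_on \<Omega> (weak_deriv \<Omega> v h)" "is_weak_deriv \<Omega> v h (weak_deriv \<Omega> v h)" by auto
qed

lemma AE_lebesgue_on_iff:
  fixes \<Omega> :: "complex set"
  assumes "open \<Omega>" shows "(AE z in lebesgue_on \<Omega>. P z) \<longleftrightarrow> (AE z in lborel. z \<in> \<Omega> \<longrightarrow> P z)"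
  using assms by (subst AE_restrict_space_iff) (auto simp: AE_completion_iff)

text \<open>
  With \<open>A = p\<^sup>2 - q\<^sup>2\<close> and \<open>B = p q\<close> the rows of \<open>div T\<^sub>h = 0\<close> are \<open>\<partial>\<^sub>x A + 2 \<partial>\<^sub>y B = 0\<close> and
  \<open>\<partial>\<^sub>y A - 2 \<partial>\<^sub>x B = 0\<close> up to constant factors, the weak Cauchy-Riemann equations of
  \<open>A - 2 \<i> B = (p - \<i> q)\<^sup>2\<close>. So a holomorphic representative exists and the choice in \<open>omega\<close> is
  meaningful.
\<close>
lemma omega_spec:
  assumes \<Omega>: "open \<Omega>" and st: "stationary_harmonic \<Omega> h"
  shows "omega \<Omega> h holomorphic_on \<Omega>"
    and "AE z in lborel. z \<in> \<Omega> \<longrightarrow>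
      omega \<Omega> h z = (of_real (weak_deriv \<Omega> 1 h z) - \<i> * of_real (weak_deriv \<Omega> \<i> h z))\<^sup>2"
proof -
  let ?p = "weak_deriv \<Omega> 1 h" and ?q = "weak_deriv \<Omega> \<i> h"
  have H1: "H1_on \<Omega> h" using st by (simp add: stationary_harmonic_def)
  have L: "L2_on \<Omega> ?p" "L2_on \<Omega> ?q" using weak_deriv_spec[OF H1] by auto
  have int: "integrable (lebesgue_on \<Omega>) (\<lambda>z. (?p z)\<^sup>2 - (?q z)\<^sup>2)" "integrable (lebesgue_on \<Omega>) (\<lambda>z. ?p z * ?q z)"
    using L L2_on_mult_integrable[OF L] by (auto simp: L2_on_def)
  obtain A where A0: "integrable lborel A" "\<And>z. z \<notin> \<Omega> \<Longrightarrow> A z = 0" "AE z in lborel. z \<in> \<Omega> \<longrightarrow> A z = (?p z)\<^sup>2 - (?q z)\<^sup>2"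
    "\<And>\<phi>. \<phi> \<in> borel_measurable borel \<Longrightarrow>
      (LINT z|lebesgue_on \<Omega>. ((?p z)\<^sup>2 - (?q z)\<^sup>2) * \<phi> z) = (LINT z|lborel. \<phi> z * A z)"
    by (rule lebesgue_on_representative[OF \<Omega> int(1)]) (rule that)
  note A = A0(1,3,4)
  obtain B where B0: "integrable lborel B" "\<And>z. z \<notin> \<Omega> \<Longrightarrow> B z = 0" "AE z in lborel. z \<in> \<Omega> \<longrightarrow> B z = ?p z * ?q z"
    "\<And>\<phi>. \<phi> \<in> borel_measurable borel \<Longrightarrow>
      (LINT z|lebesgue_on \<Omega>. (?p z * ?q z) * \<phi> z) = (LINT z|lborel. \<phi> z * B z)"
    by (rule lebesgue_on_representative[OF \<Omega> int(2)]) (rule that)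
  note B = B0(1,3,4)
  define w where "w z = complex_of_real (A z) - 2 * \<i> * of_real (B z)" for z
  have wi: "integrable lborel w" unfolding w_def[abs_def] using A(1) B(1) by simp
  have test: "(LINT z|lborel. (of_real (dir_deriv 1 \<phi> z) + \<i> * of_real (dir_deriv \<i> \<phi> z)) * w z) = 0"
    if \<phi>: "test_fun \<Omega> \<phi>" for \<phi>
  proof -
    let ?x = "dir_deriv 1 \<phi>" and ?y = "dir_deriv \<i> \<phi>"
    note tx = test_fun_dir_deriv[OF \<phi>, of 1] and ty = test_fun_dir_deriv[OF \<phi>, of \<i>]
    have row: "(LINT z|lebesgue_on \<Omega>. stress_tensor \<Omega> h z $ i $ 1 * ?x z + stress_tensor \<Omega> h z $ i $ 2 * ?y z) = 0" for i
      using st \<phi> unfolding stationary_harmonic_def by blast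
    note iA = integrable_lebesgue_on_times_test[OF int(1)] and iB = integrable_lebesgue_on_times_test[OF int(2)]
    have "(LINT z|lebesgue_on \<Omega>. (-1/2) * (((?p z)\<^sup>2 - (?q z)\<^sup>2) * ?x z) - ?p z * ?q z * ?y z) = 0"
      using row[of 1] by (simp add: stress_tensor_def Let_def field_simps)
    then have r1: "(-1/2) * (LINT z|lborel. ?x z * A z) - (LINT z|lborel. ?y z * B z) = 0"
      using A(3)[OF test_fun_borel[OF tx]] B(3)[OF test_fun_borel[OF ty]]
      by (subst (asm) Bochner_Integration.integral_diff[OF integrable_mult_right[OF iA[OF tx]] iB[OF ty]]) simp
    have "(LINT z|lebesgue_on \<Omega>. (1/2) * (((?p z)\<^sup>2 - (?q z)\<^sup>2) * ?y z) - ?p z * ?q z * ?x z) = 0"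
      using row[of 2] by (simp add: stress_tensor_def Let_def field_simps)
    then have r2: "(1/2) * (LINT z|lborel. ?y z * A z) - (LINT z|lborel. ?x z * B z) = 0"
      using A(3)[OF test_fun_borel[OF ty]] B(3)[OF test_fun_borel[OF tx]]
      by (subst (asm) Bochner_Integration.integral_diff[OF integrable_mult_right[OF iA[OF ty]] iB[OF tx]]) simp
    have i: "integrable lborel (\<lambda>z. ?x z * A z)" "integrable lborel (\<lambda>z. ?y z * A z)"
      "integrable lborel (\<lambda>z. ?x z * B z)" "integrable lborel (\<lambda>z. ?y z * B z)"
      using test_integrable[OF A(1) tx] test_integrable[OF A(1) ty] test_integrable[OF B(1) tx] test_integrable[OF B(1) ty]
      by simp_all
    have "(LINT z|lborel. (of_real (?x z) + \<i> * of_real (?y z)) * w z) =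
        (LINT z|lborel. complex_of_real (?x z * A z + 2 * (?y z * B z)) + \<i> * of_real (?y z * A z - 2 * (?x z * B z)))"
      by (rule Bochner_Integration.integral_cong) (auto simp: w_def complex_eq_iff algebra_simps)
    also have "\<dots> = complex_of_real (LINT z|lborel. ?x z * A z + 2 * (?y z * B z)) +
        \<i> * of_real (LINT z|lborel. ?y z * A z - 2 * (?x z * B z))"
    proof -
      have "integrable lborel (\<lambda>z. complex_of_real (?x z * A z + 2 * (?y z * B z)))"
        "integrable lborel (\<lambda>z. complex_of_real (?y z * A z - 2 * (?x z * B z)))"
        by (intro integrable_of_real Bochner_Integration.integrable_add Bochner_Integration.integrable_diff
            integrable_mult_right i)+
      then show ?thesis
        by (subst Bochner_Integration.integral_add[OF _ integrable_mult_right])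
          (simp_all only: integral_mult_right_zero integral_complex_of_real)
    qed
    also have "(LINT z|lborel. ?x z * A z + 2 * (?y z * B z)) = 0"
    proof -
      have "(LINT z|lborel. ?x z * A z + 2 * (?y z * B z)) = (LINT z|lborel. ?x z * A z) + 2 * (LINT z|lborel. ?y z * B z)"
        using i by simp
      then show ?thesis using r1 by linarith
    qed
    also have "(LINT z|lborel. ?y z * A z - 2 * (?x z * B z)) = 0"
    proof -
      have "(LINT z|lborel. ?y z * A z - 2 * (?x z * B z)) = (LINT z|lborel. ?y z * A z) - 2 * (LINT z|lborel. ?x z * B z)"
        using i by simp
      then show ?thesis using r2 by linarith
    qed
    also have "complex_of_real 0 + \<i> * complex_of_real 0 = 0" by simp
    finally show ?thesis .
  qed
  obtain W where W: "W holomorphic_on \<Omega>" "AE z in lborel. z \<in> \<Omega> \<longrightarrow> w z = W z"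
    by (rule weyl_lemma_dbar[OF \<Omega> wi]) (rule test, assumption, rule that)
  have "AE z in lborel. z \<in> \<Omega> \<longrightarrow> W z = (of_real (?p z) - \<i> * of_real (?q z))\<^sup>2"
    using W(2) A(2) B(2)
    by eventually_elim (auto simp: w_def complex_eq_iff power2_eq_square mult.commute)
  then have "\<exists>w. w holomorphic_on \<Omega> \<and>
    (AE z in lebesgue_on \<Omega>. w z = (of_real (?p z) - \<i> * of_real (?q z))\<^sup>2)"
    using W(1) unfolding AE_lebesgue_on_iff[OF \<Omega>] by blast
  then have "omega \<Omega> h holomorphic_on \<Omega> \<and>
    (AE z in lebesgue_on \<Omega>. omega \<Omega> h z = (of_real (?p z) - \<i> * of_real (?q z))\<^sup>2)"
    unfolding omega_def by (rule someI_ex)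
  then show "omega \<Omega> h holomorphic_on \<Omega>"
    "AE z in lborel. z \<in> \<Omega> \<longrightarrow> omega \<Omega> h z = (of_real (?p z) - \<i> * of_real (?q z))\<^sup>2"
    unfolding AE_lebesgue_on_iff[OF \<Omega>] by blast+
qed

text \<open>
  The form in which the hypotheses on \<open>h\<close> are used: everything is extended by \<open>0\<close> and integrated
  against Lebesgue measure on the plane. Boundedness of \<open>\<Omega>\<close> makes square integrable functions integrable.
\<close>
lemma weak_gradient_lborel:
  assumes \<Omega>: "open \<Omega>" "bounded \<Omega>" and st: "stationary_harmonic \<Omega> h" and h: "continuous_on \<Omega> h"
  defines "u \<equiv> \<lambda>z. if z \<in> \<Omega> then h z else 0"
  obtains p q where "integrable lborel u" "integrable lborel p" "integrable lborel q"
    "\<And>\<phi>. test_fun \<Omega> \<phi> \<Longrightarrow> (LINT z|lborel. dir_deriv 1 \<phi> z * u z) = - (LINT z|lborel. \<phi> z * p z)"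
    "\<And>\<phi>. test_fun \<Omega> \<phi> \<Longrightarrow> (LINT z|lborel. dir_deriv \<i> \<phi> z * u z) = - (LINT z|lborel. \<phi> z * q z)"
    "AE z in lborel. z \<in> \<Omega> \<longrightarrow> omega \<Omega> h z = (of_real (p z) - \<i> * of_real (q z))\<^sup>2"
    "\<And>\<phi>. \<phi> \<in> borel_measurable borel \<Longrightarrow> (LINT z|lebesgue_on \<Omega>. h z * \<phi> z) = (LINT z|lborel. \<phi> z * u z)"
proof -
  have H1: "H1_on \<Omega> h" using st by (simp add: stationary_harmonic_def)
  have L: "L2_on \<Omega> h" using H1 by (simp add: H1_on_def)
  obtain g where g: "integrable lborel g" "\<And>z. z \<notin> \<Omega> \<Longrightarrow> g z = 0" "AE z in lborel. z \<in> \<Omega> \<longrightarrow> g z = h z"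
    "\<And>\<phi>. \<phi> \<in> borel_measurable borel \<Longrightarrow> (LINT z|lebesgue_on \<Omega>. h z * \<phi> z) = (LINT z|lborel. \<phi> z * g z)"
    by (rule lebesgue_on_representative[OF \<Omega>(1) L2_on_imp_integrable[OF \<Omega> L]]) (rule that)
  have um[measurable]: "u \<in> borel_measurable borel"
    unfolding u_def using \<Omega> h by (intro borel_measurable_continuous_on_if) auto
  have gm[measurable]: "g \<in> borel_measurable borel" using g(1) by (auto dest: borel_measurable_integrable)
  have gu: "AE z in lborel. g z = u z"
    using g(3) by eventually_elim (use g(2) in \<open>auto simp: u_def\<close>)
  have ui: "integrable lborel u" using g(1) integrable_cong_AE[OF _ _ gu] by simp
  have hu: "(LINT z|lebesgue_on \<Omega>. h z * \<phi> z) = (LINT z|lborel. \<phi> z * u z)" if [measurable]: "\<phi> \<in> borel_measurable borel" for \<phi>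
    unfolding g(4)[OF that] by (intro integral_cong_AE) (use gu in \<open>auto elim!: eventually_mono\<close>)
  have ex: "\<exists>p. integrable lborel p \<and> (AE z in lborel. z \<in> \<Omega> \<longrightarrow> p z = weak_deriv \<Omega> v h z) \<and>
      (\<forall>\<phi>. test_fun \<Omega> \<phi> \<longrightarrow> (LINT z|lborel. dir_deriv v \<phi> z * u z) = - (LINT z|lborel. \<phi> z * p z))"
    if v: "v = 1 \<or> v = \<i>" for v
  proof -
    obtain p where p0: "integrable lborel p" "\<And>z. z \<notin> \<Omega> \<Longrightarrow> p z = 0"
      "AE z in lborel. z \<in> \<Omega> \<longrightarrow> p z = weak_deriv \<Omega> v h z"
      "\<And>\<phi>. \<phi> \<in> borel_measurable borel \<Longrightarrow> (LINT z|lebesgue_on \<Omega>. weak_deriv \<Omega> v h z * \<phi> z) = (LINT z|lborel. \<phi> z * p z)"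
      by (rule lebesgue_on_representative[OF \<Omega>(1) L2_on_imp_integrable[OF \<Omega> weak_deriv_spec(1)[OF H1 v]]]) (rule that)
    note p = p0(1,3,4)
    have "(LINT z|lborel. dir_deriv v \<phi> z * u z) = - (LINT z|lborel. \<phi> z * p z)" if \<phi>: "test_fun \<Omega> \<phi>" for \<phi>
      using weak_deriv_spec(2)[OF H1 v] \<phi> hu[OF test_fun_borel[OF test_fun_dir_deriv[OF \<phi>]], of v]
        p(3)[OF test_fun_borel[OF \<phi>]] unfolding is_weak_deriv_def by simp
    then show ?thesis using p by blast
  qed
  obtain p where p: "integrable lborel p" "AE z in lborel. z \<in> \<Omega> \<longrightarrow> p z = weak_deriv \<Omega> 1 h z"
    "\<And>\<phi>. test_fun \<Omega> \<phi> \<Longrightarrow> (LINT z|lborel. dir_deriv 1 \<phi> z * u z) = - (LINT z|lborel. \<phi> z * p z)"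
    using ex[of 1] by blast
  obtain q where q: "integrable lborel q" "AE z in lborel. z \<in> \<Omega> \<longrightarrow> q z = weak_deriv \<Omega> \<i> h z"
    "\<And>\<phi>. test_fun \<Omega> \<phi> \<Longrightarrow> (LINT z|lborel. dir_deriv \<i> \<phi> z * u z) = - (LINT z|lborel. \<phi> z * q z)"
    using ex[of \<i>] by blast
  have ae: "AE z in lborel. z \<in> \<Omega> \<longrightarrow> omega \<Omega> h z = (of_real (p z) - \<i> * of_real (q z))\<^sup>2"
    using omega_spec(2)[OF \<Omega>(1) st] p(2) q(2) by eventually_elim simp
  show thesis by (rule that[OF ui p(1) q(1) p(3) q(3) ae hu])
qed

section \<open>Functions with prescribed squared gradient are constant on level lines\<close>

definition open_square :: "real \<Rightarrow> complex set" where "open_square s = box (Complex (- s) (- s)) (Complex s s)"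
definition closed_square :: "real \<Rightarrow> complex set" where "closed_square s = cbox (Complex (- s) (- s)) (Complex s s)"

lemma in_open_square: "\<zeta> \<in> open_square s \<longleftrightarrow> \<bar>Re \<zeta>\<bar> < s \<and> \<bar>Im \<zeta>\<bar> < s"
  by (auto simp: open_square_def in_box_complex_iff)

lemma in_closed_square: "\<zeta> \<in> closed_square s \<longleftrightarrow> \<bar>Re \<zeta>\<bar> \<le> s \<and> \<bar>Im \<zeta>\<bar> \<le> s"
  by (auto simp: closed_square_def in_cbox_complex_iff)

lemma compact_closed_square: "compact (closed_square s)" and open_square_open: "open (open_square s)"
  by (auto simp: closed_square_def open_square_def)

text \<open>
  A holomorphic coordinate \<open>g\<close> on \<open>U\<close> with inverse \<open>G\<close>, whose image contains a closed square around \<open>0\<close>.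
  Squares, not discs, because the test functions are products in the two coordinates.
\<close>
locale square_chart =
  fixes U :: "complex set" and g G :: "complex \<Rightarrow> complex" and r :: real
  assumes openU: "open U" and g: "g holomorphic_on U" and G: "G holomorphic_on g ` U"
    and Gg: "z \<in> U \<Longrightarrow> G (g z) = z" and r: "0 < r" and closed_square: "closed_square r \<subseteq> g ` U"
begin

lemma inj: "inj_on g U" using Gg by (rule inj_on_inverseI)

lemma open_image: "open (g ` U)" using open_mapping_thm3[OF g openU inj] .

lemma gG: "\<zeta> \<in> g ` U \<Longrightarrow> g (G \<zeta>) = \<zeta>" and G_in: "\<zeta> \<in> g ` U \<Longrightarrow> G \<zeta> \<in> U"
  using Gg by auto

lemma continuous_G: "S \<subseteq> g ` U \<Longrightarrow> continuous_on S G"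
  using holomorphic_on_imp_continuous_on[OF G] by (rule continuous_on_subset)

lemma continuous_g: "S \<subseteq> U \<Longrightarrow> continuous_on S g"
  using holomorphic_on_imp_continuous_on[OF g] by (rule continuous_on_subset)

definition "K = G ` closed_square r"

lemma compact_K: "compact K"
  unfolding K_def by (rule compact_continuous_image[OF continuous_G[OF closed_square] compact_closed_square])

lemma in_K: "z \<in> K \<longleftrightarrow> z \<in> U \<and> g z \<in> closed_square r"
  unfolding K_def using closed_square gG G_in Gg by (force simp: image_iff)

lemma K_subset: "K \<subseteq> U" using in_K by auto

lemma has_deriv_g: "z \<in> U \<Longrightarrow> (g has_field_derivative deriv g z) (at z)"
  by (rule holomorphic_derivI[OF g openU])

lemma has_deriv_G: "\<zeta> \<in> g ` U \<Longrightarrow> (G has_field_derivative deriv G \<zeta>) (at \<zeta>)"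
  by (rule holomorphic_derivI[OF G open_image])

lemma deriv_prod: assumes "z \<in> U" shows "deriv g z * deriv G (g z) = 1"
proof -
  have "((\<lambda>z. G (g z)) has_field_derivative deriv G (g z) * deriv g z) (at z)"
    by (rule DERIV_chain2[OF has_deriv_G has_deriv_g]) (use assms in auto)
  moreover have "((\<lambda>z. G (g z)) has_field_derivative 1) (at z)"
    by (rule has_field_derivative_transform_within_open[OF DERIV_ident openU assms]) (simp add: Gg)
  ultimately have "deriv G (g z) * deriv g z = 1" by (rule DERIV_unique)
  then show ?thesis by (simp add: mult.commute)
qed

lemma deriv_nonzero: "z \<in> U \<Longrightarrow> deriv g z \<noteq> 0"
  using deriv_prod by force

lemma continuous_deriv: "S \<subseteq> U \<Longrightarrow> continuous_on S (deriv g)"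
  using holomorphic_on_imp_continuous_on[OF holomorphic_deriv[OF g openU]] by (rule continuous_on_subset)

lemma open_preimage: "open B \<Longrightarrow> open {z \<in> U. g z \<in> B}"
  using continuous_open_preimage[OF continuous_g[OF subset_refl] openU, of B] by (simp add: vimage_def Int_def)

text \<open>
  The velocity of the level line \<open>y \<mapsto> G (x + \<i> y)\<close> at \<open>z\<close> is \<open>v = \<i> / g' z\<close>. At a nearby point
  \<open>w\<close> the weak gradient of \<open>u\<close> in this direction is \<open>\<plusminus>Re (g' w v)\<close>, which is small, since
  \<open>Re (g' z v) = Re \<i> = 0\<close> and \<open>g'\<close> is continuous. The unknown sign is harmless for the absolute
  value, so the mollification of \<open>u\<close> has small derivative along the line.
\<close>
lemma constant_on_levels:
  fixes u p q :: "complex \<Rightarrow> real"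
  assumes u: "integrable lborel u" and p: "integrable lborel p" and q: "integrable lborel q"
    and weak: "\<And>\<phi>. test_fun U \<phi> \<Longrightarrow> (LINT z|lborel. dir_deriv 1 \<phi> z * u z) = - (LINT z|lborel. \<phi> z * p z)"
      "\<And>\<phi>. test_fun U \<phi> \<Longrightarrow> (LINT z|lborel. dir_deriv \<i> \<phi> z * u z) = - (LINT z|lborel. \<phi> z * q z)"
    and ae: "AE z in lborel. z \<in> U \<longrightarrow> (deriv g z)\<^sup>2 = (of_real (p z) - \<i> * of_real (q z))\<^sup>2"
    and cont: "continuous_on U u"
    and x: "\<bar>x\<bar> \<le> r" and y: "\<bar>y1\<bar> \<le> r" "\<bar>y2\<bar> \<le> r"
  shows "u (G (Complex x y1)) = u (G (Complex x y2))"
proof -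
  obtain \<rho> where \<rho>: "0 < \<rho>" "(\<Union>z\<in>K. cball z \<rho>) \<subseteq> U"
    using compact_subset_open_imp_cball_epsilon_subset[OF compact_K openU K_subset] by blast
  (* mollification at points of \<open>K\<close> reads \<open>u\<close> on this larger compact set only *)
  define K' where "K' = {z + w |z w. z \<in> K \<and> w \<in> cball 0 \<rho>}"
  have K': "compact K'" unfolding K'_def by (intro compact_sums compact_K compact_cball)
  have K'U: "K' \<subseteq> U"
  proof
    fix y assume "y \<in> K'"
    then obtain z w where "y = z + w" "z \<in> K" "norm w \<le> \<rho>" unfolding K'_def by auto
    then have "y \<in> cball z \<rho>" by (simp add: dist_norm)
    then show "y \<in> U" using \<rho>(2) \<open>z \<in> K\<close> by blast
  qed
  have memK': "w \<in> K'" if "z \<in> K" "norm (w - z) \<le> \<rho>" for z w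
  proof -
    have "w = z + (w - z) \<and> z \<in> K \<and> w - z \<in> cball 0 \<rho>" using that by simp
    then show ?thesis unfolding K'_def by blast
  qed
  have "\<bar>u (G (Complex x y1)) - u (G (Complex x y2))\<bar> \<le> 2 * e + e * \<bar>y1 - y2\<bar>" if e: "0 < e" for e
  proof -
    have cK: "continuous_on K (\<lambda>z. inverse (deriv g z))"
      by (intro continuous_on_inverse continuous_deriv K_subset) (use deriv_nonzero K_subset in auto)
    have "compact ((\<lambda>z. inverse (deriv g z)) ` K)" by (rule compact_continuous_image[OF cK compact_K])
    then obtain C where C: "0 < C" "\<And>z. z \<in> K \<Longrightarrow> norm (inverse (deriv g z)) \<le> C"
      using compact_imp_bounded bounded_pos by (metis imageI)
    have "uniformly_continuous_on K' (deriv g)" by (rule compact_uniformly_continuous[OF continuous_deriv[OF K'U] K'])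
    moreover have "0 < e / C" using e C by simp
    ultimately obtain d1 where d1: "0 < d1"
      "\<And>z w. z \<in> K' \<Longrightarrow> w \<in> K' \<Longrightarrow> dist w z < d1 \<Longrightarrow> dist (deriv g w) (deriv g z) < e / C"
      by (rule uniformly_continuous_onE) (rule that)
    have "uniformly_continuous_on K' u" by (rule compact_uniformly_continuous[OF continuous_on_subset[OF cont K'U] K'])
    then obtain d2 where d2: "0 < d2"
      "\<And>z w. z \<in> K' \<Longrightarrow> w \<in> K' \<Longrightarrow> dist w z < d2 \<Longrightarrow> dist (u w) (u z) < e"
      by (rule uniformly_continuous_onE[OF _ e]) (rule that)
    define \<epsilon> where "\<epsilon> = min \<rho> (min d1 d2)"
    have \<epsilon>: "0 < \<epsilon>" "\<epsilon> \<le> \<rho>" "\<epsilon> \<le> d1" "\<epsilon> \<le> d2" using \<rho>(1) d1(1) d2(1) by (simp_all add: \<epsilon>_def)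
    let ?m = "mollify \<epsilon> u" and ?k = "radial_kernel \<epsilon>"
    have close: "\<bar>?m z - u z\<bar> \<le> e" if z: "z \<in> K" for z
    proof -
      have "norm (?m z - u z) \<le> e"
      proof (rule mollify_close[OF \<epsilon>(1) u])
        fix w assume w: "norm (w - z) < \<epsilon>"
        have "dist (u w) (u z) < e"
          using w \<epsilon> z \<rho>(1) by (intro d2(2) memK'[of z]) (auto simp: dist_norm)
        then show "norm (u w - u z) \<le> e" by (simp add: dist_norm)
      qed
      then show ?thesis by simp
    qed
    have ksm: "smooth_on UNIV ?k" by (rule smooth_radial_kernel[OF \<epsilon>(1)])
    let ?D = "\<lambda>z v. LINT w|lborel. dir_deriv v ?k (z - w) *\<^sub>R u w"
    have Dm: "(?m has_derivative ?D z) (at z)" for z by (rule mollify_deriv[OF \<epsilon>(1) u])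
    (* the derivative of the mollification along the level line *)
    have small: "\<bar>?D z (\<i> * inverse (deriv g z))\<bar> \<le> e" if z: "z \<in> K" for z
    proof -
      define v where "v = \<i> * inverse (deriv g z)"
      have zU: "z \<in> U" using z K_subset by auto
      have t: "test_fun U (\<lambda>w. ?k (z - w))"
      proof (rule radial_kernel_test_fun[OF \<epsilon>(1)])
        have "cball z \<epsilon> \<subseteq> cball z \<rho>" using \<epsilon> by auto
        then show "cball z \<epsilon> \<subseteq> U" using \<rho>(2) z by blast
      qed
      have D1: "?D z 1 = (LINT w|lborel. ?k (z - w) * p w)" and Di: "?D z \<i> = (LINT w|lborel. ?k (z - w) * q w)"
        using weak(1)[OF t] weak(2)[OF t] unfolding dir_deriv_reflect[OF ksm] by simp_all
      have lin: "linear (?D z)" using Dm by (rule has_derivative_linear)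
      have "?D z (Re v *\<^sub>R 1 + Im v *\<^sub>R \<i>) = Re v *\<^sub>R ?D z 1 + Im v *\<^sub>R ?D z \<i>"
        by (simp only: linear_add[OF lin] linear_scale[OF lin])
      moreover have "Re v *\<^sub>R 1 + Im v *\<^sub>R \<i> = v" by (simp add: complex_eq_iff)
      ultimately have "?D z v = Re v * ?D z 1 + Im v * ?D z \<i>" by simp
      have ip: "integrable lborel (\<lambda>w. ?k (z - w) * p w)" and iq: "integrable lborel (\<lambda>w. ?k (z - w) * q w)"
        using mollify_kernel_integrable[OF \<epsilon>(1) p, of z] mollify_kernel_integrable[OF \<epsilon>(1) q, of z] by simp_all
      have Dv: "?D z v = (LINT w|lborel. ?k (z - w) * (Re v * p w + Im v * q w))"
        unfolding \<open>?D z v = _\<close> D1 Di using ip iq by (simp add: algebra_simps)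
      have iv: "integrable lborel (\<lambda>w. ?k (z - w) * (Re v * p w + Im v * q w))"
      proof -
        have "integrable lborel (\<lambda>w. Re v * (?k (z - w) * p w) + Im v * (?k (z - w) * q w))"
          using ip iq by simp
        then show ?thesis by (simp add: algebra_simps)
      qed
      have "\<bar>?D z v\<bar> = norm (LINT w|lborel. ?k (z - w) * (Re v * p w + Im v * q w))" unfolding Dv by simp
      also have "\<dots> \<le> (LINT w|lborel. norm (?k (z - w) * (Re v * p w + Im v * q w)))"
        by (rule integral_norm_bound)
      also have "\<dots> \<le> (LINT w|lborel. ?k (z - w) * e)"
      proof (rule integral_mono_AE)
        show "integrable lborel (\<lambda>w. ?k (z - w) * e)"
          using lborel_integral_reflect(2)[of ?k z] radial_kernel_integrable[OF \<epsilon>(1)] by simp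
        show "AE w in lborel. norm (?k (z - w) * (Re v * p w + Im v * q w)) \<le> ?k (z - w) * e"
          using ae
        proof eventually_elim
          case (elim w)
          show ?case
          proof (cases "norm (w - z) < \<epsilon>")
            case True
            have wK: "w \<in> K'" "z \<in> K'" using True \<epsilon> z \<rho>(1) by (auto intro: memK'[of z])
            then have "w \<in> U" using K'U by auto
            then have "(of_real (p w) - \<i> * of_real (q w) - deriv g w) * (of_real (p w) - \<i> * of_real (q w) + deriv g w) = 0"
              using elim by (simp add: power2_eq_square algebra_simps)
            then obtain s :: real where s: "\<bar>s\<bar> = 1" "of_real (p w) - \<i> * of_real (q w) = of_real s * deriv g w"
            proof (cases "of_real (p w) - \<i> * of_real (q w) - deriv g w = 0")
              case True then show ?thesis using that[of 1] by simp
            next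
              case False
              then have "of_real (p w) - \<i> * of_real (q w) = - deriv g w"
                using \<open>_ * _ = 0\<close> by (simp add: add_eq_0_iff2)
              then show ?thesis using that[of "-1"] by simp
            qed
            have "Re v * p w + Im v * q w = Re ((of_real (p w) - \<i> * of_real (q w)) * v)" by simp
            also have "\<dots> = s * Re (deriv g w * v)" unfolding s(2) by (simp add: algebra_simps)
            also have "deriv g w * v = \<i> * (inverse (deriv g z) * (deriv g w - deriv g z)) + \<i>"
              using deriv_nonzero[OF zU] by (simp add: v_def algebra_simps)
            also have "Re \<dots> = Re (\<i> * (inverse (deriv g z) * (deriv g w - deriv g z)))" by simp
            finally have eq: "Re v * p w + Im v * q w = s * Re (\<i> * (inverse (deriv g z) * (deriv g w - deriv g z)))" .
            have "\<bar>Re v * p w + Im v * q w\<bar> = \<bar>Re (\<i> * (inverse (deriv g z) * (deriv g w - deriv g z)))\<bar>"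
              by (simp only: eq abs_mult s(1) mult_1)
            also have "\<dots> \<le> norm (\<i> * (inverse (deriv g z) * (deriv g w - deriv g z)))"
              by (rule abs_Re_le_cmod)
            also have "\<dots> = norm (inverse (deriv g z)) * norm (deriv g w - deriv g z)" by (simp add: norm_mult)
            also have "\<dots> \<le> C * (e / C)"
              using d1(2)[OF wK(2,1)] True \<epsilon> C z by (intro mult_mono) (auto simp: dist_norm)
            also have "\<dots> = e" using C by simp
            finally show ?thesis using radial_kernel_nonneg[OF \<epsilon>(1), of "z - w"]
              by (simp add: abs_mult mult_left_mono)
          next
            case False
            then have "?k (z - w) = 0" by (intro radial_kernel_eq_0[OF \<epsilon>(1)]) (simp add: norm_minus_commute)
            then show ?thesis by simp
          qed
        qed
      qed (rule integrable_norm[OF iv])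
      also have "\<dots> = e"
        using lborel_integral_reflect(1)[of ?k z] radial_kernel_integrable[OF \<epsilon>(1)] radial_kernel_integral[OF \<epsilon>(1)]
        by simp
      finally show ?thesis unfolding v_def .
    qed
    have memK: "G (Complex x y) \<in> K" if "\<bar>y\<bar> \<le> r" for y
      unfolding K_def using that x by (intro imageI) (simp add: in_closed_square)
    have der: "((\<lambda>y. ?m (G (Complex x y))) has_real_derivative
        ?D (G (Complex x y)) (\<i> * inverse (deriv g (G (Complex x y))))) (at y)" if y: "\<bar>y\<bar> \<le> r" for y
    proof -
      let ?\<zeta> = "Complex x y"
      have \<zeta>: "?\<zeta> \<in> g ` U" using closed_square x y by (auto simp: in_closed_square)
      have "deriv g (G ?\<zeta>) * deriv G ?\<zeta> = 1" using deriv_prod[OF G_in[OF \<zeta>]] unfolding gG[OF \<zeta>] .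
      then have inv: "deriv G ?\<zeta> = inverse (deriv g (G ?\<zeta>))" by (metis inverse_unique)
      have "((\<lambda>y. Complex x y) has_derivative (\<lambda>t. Complex 0 t)) (at y)"
      proof -
        have "((\<lambda>y. of_real x + \<i> * complex_of_real y) has_derivative (\<lambda>t. 0 + \<i> * complex_of_real t)) (at y)"
          by (intro derivative_intros)
        then show ?thesis by (simp add: Complex_eq)
      qed
      moreover have "(G has_derivative (*) (deriv G ?\<zeta>)) (at ?\<zeta>)"
        using has_deriv_G[OF \<zeta>] by (simp add: has_field_derivative_def)
      ultimately have "((\<lambda>y. G (Complex x y)) has_derivative (\<lambda>t. deriv G ?\<zeta> * Complex 0 t)) (at y)"
        by (rule has_derivative_compose)
      from has_derivative_compose[OF this Dm]
      have "((\<lambda>y. ?m (G (Complex x y))) has_derivative (\<lambda>t. ?D (G ?\<zeta>) (deriv G ?\<zeta> * Complex 0 t))) (at y)" .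
      moreover have "?D (G ?\<zeta>) (deriv G ?\<zeta> * Complex 0 t) = ?D (G ?\<zeta>) (\<i> * inverse (deriv g (G ?\<zeta>))) * t" for t
      proof -
        have lin: "linear (?D (G ?\<zeta>))" using Dm by (rule has_derivative_linear)
        have "deriv G ?\<zeta> * Complex 0 t = t *\<^sub>R (\<i> * inverse (deriv g (G ?\<zeta>)))"
          unfolding inv by (simp add: complex_eq_iff)
        then show ?thesis by (simp only: linear_scale[OF lin]) (simp add: mult.commute)
      qed
      ultimately show ?thesis unfolding has_field_derivative_def by (simp only:)
    qed
    have "norm (?m (G (Complex x y1)) - ?m (G (Complex x y2))) \<le> e * norm (y1 - y2)"
    proof (rule field_differentiable_bound[where S="{-r..r}" and f="\<lambda>y. ?m (G (Complex x y))"])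
      fix y assume "y \<in> {-r..r}"
      then have y: "\<bar>y\<bar> \<le> r" by auto
      show "((\<lambda>y. ?m (G (Complex x y))) has_real_derivative
        ?D (G (Complex x y)) (\<i> * inverse (deriv g (G (Complex x y))))) (at y within {-r..r})"
        by (rule has_field_derivative_at_within[OF der[OF y]])
      show "norm (?D (G (Complex x y)) (\<i> * inverse (deriv g (G (Complex x y))))) \<le> e"
        using small[OF memK[OF y]] by simp
    qed (use y in auto)
    then show ?thesis using close[OF memK[OF y(1)]] close[OF memK[OF y(2)]] by simp
  qed
  note * = this
  have "\<bar>u (G (Complex x y1)) - u (G (Complex x y2))\<bar> \<le> 0"
  proof (rule field_le_epsilon)
    fix e :: real assume e: "0 < e"
    define e' where "e' = e / (2 + \<bar>y1 - y2\<bar>)"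
    have pos: "0 < 2 + \<bar>y1 - y2\<bar>" by linarith
    have "0 < e'" unfolding e'_def using e pos by (rule divide_pos_pos)
    from *[OF this] have "\<bar>u (G (Complex x y1)) - u (G (Complex x y2))\<bar> \<le> e' * (2 + \<bar>y1 - y2\<bar>)"
      by (simp add: algebra_simps)
    also have "\<dots> = e" using pos by (simp add: e'_def)
    finally show "\<bar>u (G (Complex x y1)) - u (G (Complex x y2))\<bar> \<le> 0 + e" by simp
  qed
  then show ?thesis by simp
qed

end

section \<open>The Laplacian in a conformal chart\<close>

lemma smooth_real_derivative:
  fixes a :: "real \<Rightarrow> real"
  assumes "smooth_on UNIV a" shows "(a has_real_derivative dir_deriv 1 a t) (at t)"
proof -
  have d: "(a has_derivative (\<lambda>v. dir_deriv v a t)) (at t)" by (rule smooth_on_has_derivative[OF assms UNIV_I])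
  have "(\<lambda>v. dir_deriv v a t) = (*) (dir_deriv 1 a t)"
  proof
    fix v :: real
    have "dir_deriv (v *\<^sub>R 1) a t = v *\<^sub>R dir_deriv 1 a t"
      by (rule linear_scale[OF has_derivative_linear[OF d]])
    then show "dir_deriv v a t = dir_deriv 1 a t * v" unfolding real_scaleR_def mult_1_right mult.commute[of v] .
  qed
  then show ?thesis using d by (simp add: has_field_derivative_def)
qed

lemma has_real_derivative_imp_dir_deriv:
  fixes a :: "real \<Rightarrow> real"
  assumes "\<And>t. (a has_real_derivative a1 t) (at t)" shows "dir_deriv 1 a = a1"
  using dir_deriv_eqI[OF assms[unfolded has_field_derivative_def]] by auto

lemma derivative_zero_outside:
  fixes a :: "real \<Rightarrow> real"
  assumes "(a has_real_derivative d) (at t)" "open S" "t \<in> S" "\<And>t. t \<in> S \<Longrightarrow> a t = 0" shows "d = 0"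
proof -
  have "((\<lambda>t. 0) has_real_derivative d) (at t)"
    by (rule has_field_derivative_transform_within_open[OF assms(1-3)]) (rule assms(4))
  then show ?thesis using DERIV_const DERIV_unique by blast
qed

lemma integral_of_compactly_supported_derivative:
  fixes w w' :: "real \<Rightarrow> real"
  assumes d: "\<And>t. (w has_real_derivative w' t) (at t)" and c: "continuous_on UNIV w'"
    and z: "\<And>t. t \<notin> {\<alpha>..\<beta>} \<Longrightarrow> w t = 0"
  shows "(LINT t|lborel. w' t) = 0"
proof -
  have z': "w' t = 0" if t: "t \<notin> {\<alpha>..\<beta>}" for t
    by (rule derivative_zero_outside[OF d, where S="- {\<alpha>..\<beta>}"]) (use t z in auto)
  have i: "integrable lborel w'"
    by (rule integrable_continuous_compact_support[OF c compact_Icc z'])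
  let ?a = "min \<alpha> \<beta> - 1" and ?b = "max \<alpha> \<beta> + 1"
  have "(w' has_integral (w ?b - w ?a)) {?a..?b}"
    by (rule fundamental_theorem_of_calculus)
      (use d in \<open>auto simp: has_real_derivative_iff_has_vector_derivative[symmetric] intro: has_field_derivative_at_within\<close>)
  moreover have "w ?b = 0" "w ?a = 0" by (rule z, auto simp: max_def min_def)+
  ultimately have "(w' has_integral 0) {?a..?b}" by simp
  then have "(w' has_integral 0) UNIV"
  proof (rule has_integral_on_superset)
    show "w' x = 0" if "x \<notin> {?a..?b}" for x by (rule z') (use that in \<open>auto simp: min_def max_def split: if_splits\<close>)
  qed simp
  then show ?thesis using has_integral_integral_lborel[OF i] has_integral_unique by blast
qed

context square_chart
begin

text \<open>
  Products in the coordinates of the chart, extended by \<open>0\<close>; smooth if both factors vanish outside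
  \<open>(-r, r)\<close>.
\<close>
definition pull :: "(real \<Rightarrow> real) \<Rightarrow> (real \<Rightarrow> real) \<Rightarrow> complex \<Rightarrow> real" where
  "pull a b z = (if z \<in> U then a (Re (g z)) * b (Im (g z)) else 0)"

lemma product_chart_derivative:
  assumes z: "z \<in> U" and a: "(a has_real_derivative a1) (at (Re (g z)))" and b: "(b has_real_derivative b1) (at (Im (g z)))"
  shows "((\<lambda>z. a (Re (g z)) * b (Im (g z))) has_derivative
    (\<lambda>v. a (Re (g z)) * (b1 * Im (deriv g z * v)) + (a1 * Re (deriv g z * v)) * b (Im (g z)))) (at z)"
proof -
  have G: "(g has_derivative (\<lambda>v. deriv g z * v)) (at z)" using has_deriv_g[OF z] by (simp add: has_field_derivative_def)
  have A: "((\<lambda>z. a (Re (g z))) has_derivative (\<lambda>v. a1 * Re (deriv g z * v))) (at z)"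
    by (rule has_derivative_compose[OF has_derivative_Re[OF G] a[unfolded has_field_derivative_def]])
  have B: "((\<lambda>z. b (Im (g z))) has_derivative (\<lambda>v. b1 * Im (deriv g z * v))) (at z)"
    by (rule has_derivative_compose[OF has_derivative_Im[OF G] b[unfolded has_field_derivative_def]])
  show ?thesis by (rule has_derivative_mult[OF A B])
qed

lemma dir_deriv_pull:
  assumes z: "z \<in> U" and a: "(a has_real_derivative a1) (at (Re (g z)))" and b: "(b has_real_derivative b1) (at (Im (g z)))"
  shows "dir_deriv v (pull a b) z = a (Re (g z)) * (b1 * Im (deriv g z * v)) + (a1 * Re (deriv g z * v)) * b (Im (g z))"
proof -
  have "dir_deriv v (pull a b) z = dir_deriv v (\<lambda>z. a (Re (g z)) * b (Im (g z))) z"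
    by (rule dir_deriv_cong[OF openU z]) (simp add: pull_def)
  then show ?thesis using dir_deriv_eqI[OF product_chart_derivative[OF assms]] by simp
qed

lemma pull_outside:
  assumes "\<And>t. r \<le> \<bar>t\<bar> \<Longrightarrow> a t = 0" "\<And>t. r \<le> \<bar>t\<bar> \<Longrightarrow> b t = 0" "z \<notin> K"
  shows "pull a b z = 0"
  using assms unfolding pull_def in_K in_closed_square by (metis linorder_linear mult_eq_0_iff)

lemma test_fun_pull:
  assumes a: "smooth_on UNIV a" "\<And>t. r \<le> \<bar>t\<bar> \<Longrightarrow> a t = 0" and b: "smooth_on UNIV b" "\<And>t. r \<le> \<bar>t\<bar> \<Longrightarrow> b t = 0"
  shows "test_fun U (pull a b)"
proof (rule test_funI[OF _ compact_K K_subset])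
  show "pull a b z = 0" if "z \<notin> K" for z by (rule pull_outside[OF a(2) b(2) that])
  have gs: "smooth_on U g" by (rule holomorphic_smooth_on[OF openU g])
  have "smooth_on U (\<lambda>z. a (Re (g z)) * b (Im (g z)))"
    by (intro smooth_on_mult openU smooth_on_compose[OF openU open_UNIV _ a(1)] smooth_on_compose[OF openU open_UNIV _ b(1)]
        smooth_on_bounded_linear[OF openU _ gs] bounded_linear_Re bounded_linear_Im subset_UNIV)
  then have 1: "smooth_on U (pull a b)"
    by (rule smooth_on_cong[OF openU, rotated]) (simp add: pull_def)
  have o: "open (- K)" using compact_K by (simp add: compact_imp_closed open_Compl)
  have 2: "smooth_on (- K) (pull a b)"
    by (rule smooth_on_cong[OF o _ smooth_on_const[of _ 0]]) (use pull_outside[OF a(2) b(2)] in auto)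
  show "smooth_on UNIV (pull a b)"
  proof (rule smooth_on_local)
    fix z show "\<exists>V. open V \<and> z \<in> V \<and> smooth_on V (pull a b)"
      using 1 2 o openU K_subset by (cases "z \<in> U") blast+
  qed
qed

text \<open>
  Conformal covariance: \<open>\<Delta>(\<psi> \<circ> g) = \<bar>g'\<bar>\<^sup>2 (\<Delta>\<psi>) \<circ> g\<close> for \<open>\<psi>(x, y) = a x b y\<close>.
\<close>
lemma laplacian_pull:
  assumes z: "z \<in> U"
    and a: "\<And>t. (a has_real_derivative a1 t) (at t)" "\<And>t. (a1 has_real_derivative a2 t) (at t)"
    and b: "\<And>t. (b has_real_derivative b1 t) (at t)" "\<And>t. (b1 has_real_derivative b2 t) (at t)"
  shows "laplacian (pull a b) z = (norm (deriv g z))\<^sup>2 * (a2 (Re (g z)) * b (Im (g z)) + a (Re (g z)) * b2 (Im (g z)))"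
proof -
  let ?X = "Re (g z)" and ?Y = "Im (g z)" and ?d = "deriv g z" and ?dd = "deriv (deriv g) z"
  have dd: "(deriv g has_derivative (\<lambda>v. ?dd * v)) (at z)"
    using holomorphic_derivI[OF holomorphic_deriv[OF g openU] openU z] by (simp add: has_field_derivative_def)
  have second: "dir_deriv v (dir_deriv v (pull a b)) z =
      (a ?X * (b2 ?Y * Im (?d * v)) + (a1 ?X * Re (?d * v)) * b1 ?Y) * Im (?d * v) + a ?X * b1 ?Y * Im (?dd * v * v) +
      ((a1 ?X * (b1 ?Y * Im (?d * v)) + (a2 ?X * Re (?d * v)) * b ?Y) * Re (?d * v) + a1 ?X * b ?Y * Re (?dd * v * v))" for v
  proof -
    let ?f = "\<lambda>z. (a (Re (g z)) * b1 (Im (g z))) * Im (deriv g z * v) + (a1 (Re (g z)) * b (Im (g z))) * Re (deriv g z * v)"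
    have "dir_deriv v (dir_deriv v (pull a b)) z = dir_deriv v ?f z"
      by (rule dir_deriv_cong[OF openU z]) (simp add: dir_deriv_pull[OF _ a(1) b(1)])
    have m: "((\<lambda>z. deriv g z * v) has_derivative (\<lambda>w. ?dd * w * v)) (at z)"
      by (rule has_derivative_mult_left[OF dd])
    have "(?f has_derivative (\<lambda>w. (a ?X * b1 ?Y * Im (?dd * w * v) +
         (a ?X * (b2 ?Y * Im (?d * w)) + (a1 ?X * Re (?d * w)) * b1 ?Y) * Im (?d * v)) +
         (a1 ?X * b ?Y * Re (?dd * w * v) +
         (a1 ?X * (b1 ?Y * Im (?d * w)) + (a2 ?X * Re (?d * w)) * b ?Y) * Re (?d * v)))) (at z)"
      by (intro has_derivative_add has_derivative_mult product_chart_derivative z a b has_derivative_Re has_derivative_Im m)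
    from dir_deriv_eqI[OF this, of v] show ?thesis unfolding \<open>dir_deriv v (dir_deriv v (pull a b)) z = _\<close> by simp
  qed
  show ?thesis
    unfolding laplacian_def second cmod_power2
    by (simp add: power2_eq_square algebra_simps)
qed

lemma laplacian_pull_outside:
  assumes "\<And>t. r \<le> \<bar>t\<bar> \<Longrightarrow> a t = 0" "\<And>t. r \<le> \<bar>t\<bar> \<Longrightarrow> b t = 0" "z \<notin> K"
  shows "laplacian (pull a b) z = 0"
proof -
  have cK: "closed K" using compact_K by (rule compact_imp_closed)
  have d: "dir_deriv v (pull a b) z = 0" if "z \<notin> K" for v z
    by (rule dir_deriv_eq_0[OF cK pull_outside[OF assms(1,2)] that])
  have "dir_deriv v (dir_deriv v (pull a b)) z = 0" for v
    by (rule dir_deriv_eq_0[OF cK d assms(3)])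
  then show ?thesis unfolding laplacian_def by simp
qed

text \<open>
  The factor \<open>\<bar>g'\<bar>\<^sup>2\<close> is the Jacobian, so the integral becomes one over the square, of
  \<open>f x (a'' x b y + a x b'' y)\<close>. The second summand integrates to \<open>0\<close> because \<open>f\<close> does not depend on
  \<open>y\<close> and \<open>b\<close> has compact support.
\<close>
lemma laplacian_test_identity:
  fixes u :: "complex \<Rightarrow> real" and f :: "real \<Rightarrow> real"
  assumes uf: "\<And>\<zeta>. \<zeta> \<in> closed_square r \<Longrightarrow> u (G \<zeta>) = f (Re \<zeta>)" and f: "continuous_on {-r..r} f"
    and a: "smooth_on UNIV a" "\<And>t. r \<le> \<bar>t\<bar> \<Longrightarrow> a t = 0"
      "\<And>t. (a has_real_derivative a1 t) (at t)" "\<And>t. (a1 has_real_derivative a2 t) (at t)"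
    and b: "smooth_on UNIV b" "\<And>t. r \<le> \<bar>t\<bar> \<Longrightarrow> b t = 0"
  shows "(LINT z|lborel. laplacian (pull a b) z * u z) =
    (LINT t|lborel. (indicator {-r..r} t * f t) * a2 t) * (LINT t|lborel. b t)"
proof -
  define b1 where "b1 = dir_deriv 1 b"
  define b2 where "b2 = dir_deriv 1 b1"
  have sb1: "smooth_on UNIV b1" unfolding b1_def by (rule smooth_on_dir_deriv[OF b(1)])
  have db: "(b has_real_derivative b1 t) (at t)" "(b1 has_real_derivative b2 t) (at t)" for t
    unfolding b2_def using smooth_real_derivative[OF b(1)] smooth_real_derivative[OF sb1] by (auto simp: b1_def)
  have b2c: "continuous_on UNIV b2" unfolding b2_def by (rule smooth_on_continuous[OF smooth_on_dir_deriv[OF sb1]])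
  have "smooth_on UNIV a1" using smooth_on_dir_deriv[OF a(1), of 1] has_real_derivative_imp_dir_deriv[OF a(3)] by simp
  then have a2c: "continuous_on UNIV a2"
    using smooth_on_continuous[OF smooth_on_dir_deriv[of UNIV a1 1]] has_real_derivative_imp_dir_deriv[OF a(4)] by simp
  have ac: "continuous_on UNIV a" by (rule smooth_on_continuous[OF a(1)])
  have bc: "continuous_on UNIV b" by (rule smooth_on_continuous[OF b(1)])
  have o: "open {t::real. r < \<bar>t\<bar>}" by (intro open_Collect_less continuous_intros)
  have out1: "a1 t = 0" "b1 t = 0" if "t \<in> {t. r < \<bar>t\<bar>}" for t
    using derivative_zero_outside[OF a(3) o that] derivative_zero_outside[OF db(1) o that] a(2) b(2) by auto
  have out2: "a2 t = 0" "b2 t = 0" if "r < \<bar>t\<bar>" for t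
    using derivative_zero_outside[OF a(4) o _ out1(1)] derivative_zero_outside[OF db(2) o _ out1(2)] that by auto
  define fs where "fs t = indicator {-r..r} t * f t" for t
  have fa2: "integrable lborel (\<lambda>t. fs t * a2 t)"
    using borel_integrable_compact[OF compact_Icc continuous_on_mult[OF f continuous_on_subset[OF a2c]]]
    by (simp add: fs_def mult.assoc)
  have fa: "integrable lborel (\<lambda>t. fs t * a t)"
    using borel_integrable_compact[OF compact_Icc continuous_on_mult[OF f continuous_on_subset[OF ac]]]
    by (simp add: fs_def mult.assoc)
  have bi: "integrable lborel b" and b2i: "integrable lborel b2"
    by (rule integrable_continuous_compact_support[OF bc compact_Icc[of "-r" r]], rule b(2), force)
      (rule integrable_continuous_compact_support[OF b2c compact_Icc[of "-r" r]], rule out2(2), force)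
  have b20: "(LINT t|lborel. b2 t) = 0"
    by (rule integral_of_compactly_supported_derivative[OF db(2) b2c, of "-r" r]) (rule out1(2), force)
  define F where "F \<zeta> = (fs (Re \<zeta>) * a2 (Re \<zeta>)) * b (Im \<zeta>) + (fs (Re \<zeta>) * a (Re \<zeta>)) * b2 (Im \<zeta>)" for \<zeta>
  note p1 = lebesgue_integral_product_complex[OF fa2 bi] and p2 = lebesgue_integral_product_complex[OF fa b2i]
  have Fi: "integrable lborel F" unfolding F_def[abs_def] using p1(1) p2(1) by simp
  have Fint: "(LINT \<zeta>|lborel. F \<zeta>) = (LINT t|lborel. fs t * a2 t) * (LINT t|lborel. b t)"
    unfolding F_def using p1 p2 b20 by simp
  have Fout: "F \<zeta> = 0" if "\<zeta> \<notin> closed_square r" for \<zeta>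
    using that b(2)[of "Im \<zeta>"] out2(2)[of "Im \<zeta>"] unfolding F_def fs_def in_closed_square by (auto simp: indicator_def)
  have Find: "(\<lambda>\<zeta>. indicator (g ` U) \<zeta> * F \<zeta>) = F"
  proof
    fix \<zeta> show "indicator (g ` U) \<zeta> * F \<zeta> = F \<zeta>"
      using Fout[of \<zeta>] closed_square by (cases "\<zeta> \<in> closed_square r") auto
  qed
  have "laplacian (pull a b) z * u z = indicator U z * ((norm (deriv g z))\<^sup>2 * F (g z))" for z
  proof (cases "z \<in> K")
    case True
    then have z: "z \<in> U" "g z \<in> closed_square r" by (auto simp: in_K)
    have "u z = f (Re (g z))" using uf[OF z(2)] Gg[OF z(1)] by simp
    moreover have "fs (Re (g z)) = f (Re (g z))"
    proof -
      have "Re (g z) \<in> {-r..r}" using z(2) by (auto simp: in_closed_square)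
      then show ?thesis by (simp add: fs_def)
    qed
    ultimately show ?thesis
      using z(1) unfolding laplacian_pull[OF z(1) a(3,4) db] F_def by (simp add: algebra_simps)
  next
    case False
    have "indicator U z * ((norm (deriv g z))\<^sup>2 * F (g z)) = 0"
      using False Fout[of "g z"] by (auto simp: in_K indicator_def)
    then show ?thesis using laplacian_pull_outside[OF a(2) b(2) False] by simp
  qed
  then have "(LINT z|lborel. laplacian (pull a b) z * u z) = (LINT z|lborel. indicator U z * ((norm (deriv g z))\<^sup>2 * F (g z)))"
    by simp
  also have "\<dots> = (LINT \<zeta>|lborel. indicator (g ` U) \<zeta> * F \<zeta>)"
    using Fi by (intro conformal_change_of_variables openU g inj) (simp add: Find)
  also have "\<dots> = (LINT t|lborel. fs t * a2 t) * (LINT t|lborel. b t)" unfolding Find by (rule Fint)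
  finally show ?thesis unfolding fs_def .
qed

text \<open>
  Only the part over the compact set \<open>K\<close>, the preimage of the closed square, is transported, since \<open>M\<close>
  may be infinite near the boundary of \<open>\<Omega>\<close>.
\<close>
definition push :: "complex measure \<Rightarrow> complex measure" where
  "push M = distr (restrict_space M K) borel g"

text \<open>
  The image of \<open>M\<close> is a finite Borel measure on the plane that determines \<open>M\<close> on \<open>K\<close>, because \<open>g\<close> is
  a homeomorphism between \<open>K\<close> and the closed square.
\<close>
lemma
  assumes M: "radon_on \<Omega> M" and U\<Omega>: "U \<subseteq> \<Omega>" and \<Omega>: "open \<Omega>"
  shows sets_push: "sets (push M) = sets borel"
    and finite_push: "finite_measure (push M)"
    and AE_push: "AE \<zeta> in push M. \<zeta> \<in> closed_square r"
    and integral_push: "\<And>a b. continuous_on UNIV a \<Longrightarrow> continuous_on UNIV b \<Longrightarrow> (\<And>t. r \<le> \<bar>t\<bar> \<Longrightarrow> a t = 0) \<Longrightarrow>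
      (\<And>t. r \<le> \<bar>t\<bar> \<Longrightarrow> b t = 0) \<Longrightarrow> (LINT \<zeta>|push M. a (Re \<zeta>) * b (Im \<zeta>)) = (LINT z|M. pull a b z)"
    and borel_chart_image: "\<And>A. A \<in> sets borel \<Longrightarrow> A \<subseteq> K \<Longrightarrow> g ` A \<in> sets borel"
    and emeasure_push: "\<And>A. A \<in> sets borel \<Longrightarrow> A \<subseteq> K \<Longrightarrow> emeasure (push M) (g ` A) = emeasure M A"
proof -
  have Mb: "sets M = sets (restrict_space borel \<Omega>)" and fin: "emeasure M K < \<infinity>"
    using M compact_K K_subset U\<Omega> by (auto simp: radon_on_def)
  have spM: "space M = \<Omega>" using sets_eq_imp_space_eq[OF Mb] by (simp add: space_restrict_space)
  have KM: "K \<inter> space M = K" using K_subset U\<Omega> by (auto simp: spM)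
  have setsM: "A \<in> sets M" if "A \<in> sets borel" "A \<subseteq> \<Omega>" for A
    using that unfolding Mb sets_restrict_space by (intro image_eqI[of _ _ A]) auto
  have K\<Omega>: "K \<subseteq> \<Omega>" using K_subset U\<Omega> by auto
  have KsM: "K \<in> sets M" by (rule setsM[OF _ K\<Omega>]) (simp add: borel_closed compact_imp_closed compact_K)
  have sK: "sets (restrict_space M K) = sets (restrict_space borel K)"
  proof -
    have "sets (restrict_space M K) = sets (restrict_space (restrict_space borel \<Omega>) K)"
      by (rule sets_restrict_space_cong[OF Mb])
    also have "\<dots> = sets (restrict_space borel K)"
      using \<Omega> K\<Omega> by (subst restrict_restrict_space) (auto simp: Int_absorb1 borel_closed compact_imp_closed compact_K)
    finally show ?thesis .
  qed
  have gm: "g \<in> restrict_space M K \<rightarrow>\<^sub>M borel"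
    using borel_measurable_continuous_on_restrict[OF continuous_g[OF K_subset]] measurable_cong_sets[OF sK refl] by blast
  show sp: "sets (push M) = sets borel" by (simp add: push_def)
  have finK: "finite_measure (restrict_space M K)"
    using fin KM KsM by (intro finite_measureI) (simp add: space_restrict_space emeasure_restrict_space less_top)
  show "finite_measure (push M)" unfolding push_def by (rule finite_measure.finite_measure_distr[OF finK gm])
  show "AE \<zeta> in push M. \<zeta> \<in> closed_square r"
    unfolding push_def using compact_closed_square by (subst AE_distr_iff[OF gm])
      (auto simp: space_restrict_space in_K borel_closed compact_imp_closed intro!: AE_I2)
  show "(LINT \<zeta>|push M. a (Re \<zeta>) * b (Im \<zeta>)) = (LINT z|M. pull a b z)"
    if ab: "continuous_on UNIV a" "continuous_on UNIV b" "\<And>t. r \<le> \<bar>t\<bar> \<Longrightarrow> a t = 0" "\<And>t. r \<le> \<bar>t\<bar> \<Longrightarrow> b t = 0" for a b :: "real \<Rightarrow> real"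
  proof -
    have [measurable]: "a \<in> borel_measurable borel" "b \<in> borel_measurable borel"
      using ab by (auto intro: borel_measurable_continuous_onI)
    have "(LINT \<zeta>|push M. a (Re \<zeta>) * b (Im \<zeta>)) = (LINT z|restrict_space M K. a (Re (g z)) * b (Im (g z)))"
      unfolding push_def by (rule integral_distr[OF gm]) measurable
    also have "\<dots> = (LINT z|M. indicator K z *\<^sub>R (a (Re (g z)) * b (Im (g z))))"
      using KM KsM by (intro integral_restrict_space) simp
    also have "\<dots> = (LINT z|M. pull a b z)"
    proof (rule Bochner_Integration.integral_cong[OF refl])
      fix z
      have "pull a b z = 0" if "z \<notin> K"
        by (rule pull_outside) (use ab that in auto)
      then show "indicator K z *\<^sub>R (a (Re (g z)) * b (Im (g z))) = pull a b z"
        using K_subset by (cases "z \<in> K") (auto simp: pull_def)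
    qed
    finally show ?thesis .
  qed
  show img: "g ` A \<in> sets borel" if A: "A \<in> sets borel" "A \<subseteq> K" for A
  proof -
    have "g ` A = {\<zeta> \<in> closed_square r. G \<zeta> \<in> A}"
      using A(2) closed_square gG Gg by (auto simp: in_K subset_iff image_iff) (metis in_K K_subset Gg)+
    moreover have "{\<zeta> \<in> closed_square r. G \<zeta> \<in> A} \<in> sets borel"
    proof -
      have "G \<in> borel_measurable (restrict_space borel (closed_square r))"
        by (rule borel_measurable_continuous_on_restrict[OF continuous_G[OF closed_square]])
      from measurable_sets[OF this A(1)]
      have "G -` A \<inter> closed_square r \<in> sets (restrict_space borel (closed_square r))" by (simp add: space_restrict_space)
      moreover have "closed_square r \<in> sets borel" using compact_closed_square by (simp add: borel_closed compact_imp_closed)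
      ultimately have "G -` A \<inter> closed_square r \<in> sets borel" by (simp add: sets_restrict_space_iff)
      moreover have "{\<zeta> \<in> closed_square r. G \<zeta> \<in> A} = G -` A \<inter> closed_square r" by auto
      ultimately show ?thesis by simp
    qed
    ultimately show ?thesis by simp
  qed
  show "emeasure (push M) (g ` A) = emeasure M A" if A: "A \<in> sets borel" "A \<subseteq> K" for A
  proof -
    have "g -` (g ` A) \<inter> space (restrict_space M K) = A"
      using A(2) inj K_subset KM by (auto simp: space_restrict_space inj_on_def subset_iff)
    then have "emeasure (push M) (g ` A) = emeasure (restrict_space M K) A"
      unfolding push_def by (subst emeasure_distr[OF gm img[OF A]]) simp
    then show ?thesis using A KM KsM by (simp add: emeasure_restrict_space)
  qed
qed

end

section \<open>Existence of charts and the slope of the profile\<close>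

text \<open>
  A square root of \<open>w\<close> on a disc without zeros of \<open>w\<close>, a primitive of it, and the inverse function
  theorem.
\<close>
lemma square_chart_exists:
  assumes \<Omega>: "open \<Omega>" and w: "w holomorphic_on \<Omega>" and z0: "z0 \<in> \<Omega>" "w z0 \<noteq> 0"
  obtains U g G r where "square_chart U g G r" "U \<subseteq> \<Omega>" "z0 \<in> U" "g z0 = 0"
    "\<And>z. z \<in> U \<Longrightarrow> (deriv g z)\<^sup>2 = w z"
proof -
  have "open (\<Omega> \<inter> w -` (- {0}))"
    by (rule continuous_open_preimage[OF holomorphic_on_imp_continuous_on[OF w] \<Omega>]) auto
  then obtain e where e: "0 < e" "ball z0 e \<subseteq> \<Omega> \<inter> w -` (- {0})"
    using z0 unfolding open_contains_ball by blast
  let ?B = "ball z0 e"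
  have con: "contractible ?B" by (rule convex_imp_contractible) simp
  have wB: "w holomorphic_on ?B" by (rule holomorphic_on_subset[OF w]) (use e(2) in auto)
  have nz: "w z \<noteq> 0" if "z \<in> ?B" for z using e(2) that by auto
  obtain s where s: "s holomorphic_on ?B" "\<And>z. z \<in> ?B \<Longrightarrow> w z = s z ^ 2"
    by (rule contractible_imp_holomorphic_sqrt[OF wB con nz]) (assumption, rule that)
  obtain g0 where g0: "\<And>x. x \<in> ?B \<Longrightarrow> (g0 has_field_derivative s x) (at x within ?B)"
    by (rule holomorphic_convex_primitive'[OF convex_ball open_ball s(1)]) (rule that)
  define g where "g z = g0 z - g0 z0" for z
  have dg: "(g has_field_derivative s z) (at z)" if "z \<in> ?B" for z
  proof -
    have "(g0 has_field_derivative s z) (at z)" using g0[OF that] at_within_open[OF that open_ball] by simp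
    then show ?thesis unfolding g_def[abs_def] by (auto intro!: derivative_eq_intros)
  qed
  have gh: "g holomorphic_on ?B"
    unfolding holomorphic_on_def field_differentiable_def using dg has_field_derivative_at_within by blast
  have derg: "deriv g z = s z" if "z \<in> ?B" for z using DERIV_imp_deriv[OF dg[OF that]] .
  have z0B: "z0 \<in> ?B" using e(1) by simp
  have "s z0 \<noteq> 0" using s(2)[OF z0B] z0(2) by auto
  then have "deriv g z0 \<noteq> 0" using derg[OF z0B] by simp
  then obtain r1 where r1: "r1 > 0" "ball z0 r1 \<subseteq> ?B" "inj_on g (ball z0 r1)"
    using has_complex_derivative_locally_injective[OF gh z0B open_ball \<open>deriv g z0 \<noteq> 0\<close>] by metis
  let ?U = "ball z0 r1"
  have gU: "g holomorphic_on ?U" using gh r1(2) by (rule holomorphic_on_subset)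
  obtain G where G: "G holomorphic_on (g ` ?U)" "\<And>z. z \<in> ?U \<Longrightarrow> deriv g z * deriv G (g z) = 1"
    "\<And>z. z \<in> ?U \<Longrightarrow> G (g z) = z"
    by (rule holomorphic_has_inverse[OF gU open_ball r1(3)]) (rule that)
  have "open (g ` ?U)" using open_mapping_thm3[OF gU open_ball r1(3)] .
  moreover have "0 \<in> g ` ?U" using r1(1) by (intro image_eqI[of _ _ z0]) (auto simp: g_def)
  ultimately obtain d where d: "0 < d" "cball 0 d \<subseteq> g ` ?U" unfolding open_contains_cball by blast
  have "closed_square (d / 2) \<subseteq> cball 0 d"
  proof
    fix \<zeta> assume "\<zeta> \<in> closed_square (d / 2)"
    then show "\<zeta> \<in> cball 0 d" using cmod_le[of \<zeta>] by (simp add: in_closed_square)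
  qed
  then have "square_chart ?U g G (d / 2)"
    using gU G(1,3) d by unfold_locales auto
  moreover have "?U \<subseteq> \<Omega>" using r1(2) e(2) by blast
  moreover have "(deriv g z)\<^sup>2 = w z" if "z \<in> ?U" for z
    using derg[of z] s(2)[of z] r1(2) that by auto
  ultimately show thesis using that[of ?U g G "d / 2"] r1(1) by (simp add: g_def)
qed

context square_chart
begin

text \<open>
  The inverse of the chart maps countably many vertical lines, a null set, to a null set.
\<close>
lemma AE_not_on_countably_many_levels:
  assumes "countable C" shows "AE z in lborel. z \<in> U \<longrightarrow> Re (g z) \<notin> C"
proof -
  let ?N = "{\<zeta> \<in> g ` U. Re \<zeta> \<in> C}"
  have "negligible (\<Union>((\<lambda>c. {\<zeta>::complex. \<zeta> \<bullet> 1 = c}) ` C))"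
  proof (rule negligible_countable_Union)
    show "countable ((\<lambda>c. {\<zeta>::complex. \<zeta> \<bullet> 1 = c}) ` C)" using assms by (rule countable_image)
    fix S assume "S \<in> (\<lambda>c. {\<zeta>::complex. \<zeta> \<bullet> 1 = c}) ` C"
    then obtain c where "S = {\<zeta>. \<zeta> \<bullet> 1 = c}" by blast
    moreover have "(1::complex) \<in> Basis" by (simp add: Basis_complex_def)
    ultimately show "negligible S" using negligible_standard_hyperplane by blast
  qed
  then have "negligible ?N" by (rule negligible_subset) auto
  moreover have "G differentiable_on ?N"
    unfolding differentiable_on_def
    using has_deriv_G field_differentiable_imp_differentiable differentiable_at_withinI
    unfolding field_differentiable_def by blast
  ultimately have "negligible (G ` ?N)" by (intro negligible_differentiable_image_negligible) auto
  then have "G ` ?N \<in> null_sets lebesgue" by (simp add: negligible_iff_null_sets)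
  then have "AE z in lebesgue. z \<notin> G ` ?N" by (rule AE_not_in)
  then have "AE z in lborel. z \<notin> G ` ?N" by (simp add: AE_completion_iff)
  then show ?thesis
  proof eventually_elim
    case (elim z)
    show ?case
    proof (intro impI notI)
      assume "z \<in> U" "Re (g z) \<in> C"
      then have "z \<in> G ` ?N" using Gg by (intro image_eqI[of _ _ "g z"]) auto
      then show False using elim by simp
    qed
  qed
qed

text \<open>
  Outside countably many levels \<open>u = f \<circ> Re g\<close> is classically differentiable with gradient
  \<open>F (Re g)\<close> times that of \<open>Re g\<close>. As \<open>u\<close> is Lipschitz, this is almost everywhere the weak
  gradient, whose square is prescribed; comparison gives \<open>F (Re g)\<^sup>2 = 1\<close> almost everywhere.
\<close>
lemma unit_slope_dense:
  fixes u p q :: "complex \<Rightarrow> real" and f F :: "real \<Rightarrow> real"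
  assumes u: "integrable lborel u" and p: "integrable lborel p" and q: "integrable lborel q"
    and weak: "\<And>\<phi>. test_fun U \<phi> \<Longrightarrow> (LINT z|lborel. dir_deriv 1 \<phi> z * u z) = - (LINT z|lborel. \<phi> z * p z)"
      "\<And>\<phi>. test_fun U \<phi> \<Longrightarrow> (LINT z|lborel. dir_deriv \<i> \<phi> z * u z) = - (LINT z|lborel. \<phi> z * q z)"
    and ae: "AE z in lborel. z \<in> U \<longrightarrow> (deriv g z)\<^sup>2 = (of_real (p z) - \<i> * of_real (q z))\<^sup>2"
    and uf: "\<And>\<zeta>. \<zeta> \<in> closed_square r \<Longrightarrow> u (G \<zeta>) = f (Re \<zeta>)"
    and F: "F \<in> borel_measurable borel" "\<And>t. \<bar>F t\<bar> \<le> L"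
    and lip: "\<And>s t. s \<in> {-\<rho>..\<rho>} \<Longrightarrow> t \<in> {-\<rho>..\<rho>} \<Longrightarrow> \<bar>f t - f s\<bar> \<le> L * \<bar>t - s\<bar>"
    and C: "countable C" and der: "\<And>t. t \<in> {-\<rho><..<\<rho>} - C \<Longrightarrow> (f has_real_derivative F t) (at t)"
    and \<rho>: "\<rho> \<le> r" and ab: "-\<rho> < \<alpha>" "\<alpha> < \<beta>" "\<beta> < \<rho>"
  shows "\<exists>t. \<alpha> < t \<and> t < \<beta> \<and> \<bar>F t\<bar> = 1"
proof -
  have L: "0 \<le> L" using F(2)[of 0] by linarith
  define W where "W = {z \<in> U. g z \<in> box (Complex \<alpha> (-r)) (Complex \<beta> r)}"
  have W: "open W" unfolding W_def by (rule open_preimage[OF open_box])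
  have inW: "z \<in> W \<longleftrightarrow> z \<in> U \<and> \<alpha> < Re (g z) \<and> Re (g z) < \<beta> \<and> \<bar>Im (g z)\<bar> < r" for z
    by (auto simp: W_def in_box_complex_iff)
  define z1 where "z1 = G (Complex ((\<alpha> + \<beta>) / 2) 0)"
  have c0: "Complex ((\<alpha> + \<beta>) / 2) 0 \<in> g ` U" by (rule subsetD[OF closed_square]) (use ab \<rho> r in \<open>auto simp: in_closed_square abs_le_iff\<close>)
  have z1: "z1 \<in> W" using ab r unfolding inW z1_def gG[OF c0] by (auto simp: G_in[OF c0])
  obtain R where R: "0 < R" "cball z1 R \<subseteq> W" using W z1 unfolding open_contains_cball by blast
  let ?B = "ball z1 R"
  have WU: "W \<subseteq> U" by (auto simp: W_def)
  have BW: "?B \<subseteq> W" using R(2) by auto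
  have uW: "u z = f (Re (g z))" if "z \<in> W" for z
  proof -
    have "g z \<in> closed_square r" using that ab \<rho> by (auto simp: inW in_closed_square abs_le_iff)
    then show ?thesis using uf[of "g z"] Gg[of z] that WU by auto
  qed
  have "compact (deriv g ` cball z1 R)"
    using R WU by (intro compact_continuous_image continuous_deriv) auto
  then obtain D where D: "0 < D" "\<And>z. z \<in> cball z1 R \<Longrightarrow> norm (deriv g z) \<le> D"
    using compact_imp_bounded bounded_pos by (metis imageI)
  have glip: "norm (g x - g y) \<le> D * norm (x - y)" if "x \<in> ?B" "y \<in> ?B" for x y
  proof (rule field_differentiable_bound[OF convex_ball _ _ that, where f'="deriv g"])
    fix z assume z: "z \<in> ?B"
    then have "z \<in> U" using BW WU by auto
    then show "(g has_field_derivative deriv g z) (at z within ?B)" by (rule has_field_derivative_at_within[OF has_deriv_g])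
    show "norm (deriv g z) \<le> D" using D(2) z by auto
  qed
  have ulip: "\<bar>u x - u y\<bar> \<le> (L * D) * norm (x - y)" if xy: "x \<in> ?B" "y \<in> ?B" for x y
  proof -
    have "x \<in> W" "y \<in> W" using xy BW by auto
    then have "\<bar>u x - u y\<bar> \<le> L * \<bar>Re (g x) - Re (g y)\<bar>"
      unfolding uW[OF \<open>x \<in> W\<close>] uW[OF \<open>y \<in> W\<close>] using ab by (intro lip) (auto simp: inW)
    also have "\<dots> \<le> L * norm (g x - g y)" using abs_Re_le_cmod[of "g x - g y"] L by (intro mult_left_mono) auto
    also have "\<dots> \<le> L * (D * norm (x - y))" using glip[OF xy] L by (intro mult_left_mono) auto
    finally show ?thesis by simp
  qed
  define d where "d v z = indicator ?B z * (F (Re (g z)) * Re (deriv g z * v))" for v z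
  have di: "integrable lborel (d v)" for v
  proof -
    define g0 where "g0 z = (if z \<in> U then g z else 0)" for z
    define dg0 where "dg0 z = (if z \<in> U then deriv g z else 0)" for z
    have [measurable]: "g0 \<in> borel_measurable borel" "dg0 \<in> borel_measurable borel"
      unfolding g0_def[abs_def] dg0_def[abs_def]
      using openU continuous_g[OF subset_refl] continuous_deriv[OF subset_refl]
      by (auto intro!: borel_measurable_continuous_on_if)
    have [measurable]: "F \<in> borel_measurable borel" "?B \<in> sets borel" using F(1) by auto
    have "(\<lambda>z. indicator ?B z * (F (Re (g0 z)) * Re (dg0 z * v))) \<in> borel_measurable lborel"
      by measurable
    moreover have "(\<lambda>z. indicator ?B z * (F (Re (g0 z)) * Re (dg0 z * v))) = d v"
    proof
      fix z show "indicator ?B z * (F (Re (g0 z)) * Re (dg0 z * v)) = d v z"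
        using BW WU by (cases "z \<in> ?B") (auto simp: d_def g0_def dg0_def)
    qed
    ultimately have m: "d v \<in> borel_measurable lborel" by (simp only:)
    have "integrable lborel (\<lambda>z. indicator ?B z * (L * (D * norm v)))"
    proof -
      have "emeasure lborel ?B < \<infinity>" using emeasure_bounded_finite[of ?B] by simp
      then show ?thesis by (intro integrable_mult_left) simp
    qed
    then show ?thesis
    proof (rule Bochner_Integration.integrable_bound[OF _ m], intro AE_I2)
      fix z
      show "norm (d v z) \<le> norm (indicator ?B z * (L * (D * norm v)))"
      proof (cases "z \<in> ?B")
        case True
        have "\<bar>Re (deriv g z * v)\<bar> \<le> norm (deriv g z) * norm v" using abs_Re_le_cmod[of "deriv g z * v"] by (simp add: norm_mult)
        also have "\<dots> \<le> D * norm v" using D(2)[of z] True by (intro mult_right_mono) auto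
        finally have "\<bar>F (Re (g z))\<bar> * \<bar>Re (deriv g z * v)\<bar> \<le> L * (D * norm v)" using F(2) L by (intro mult_mono) auto
        then show ?thesis using True L D(1) by (simp add: d_def abs_mult)
      qed (simp add: d_def)
    qed
  qed
  have dlim: "AE z in lborel. z \<in> ?B \<longrightarrow> (\<lambda>n. (u (z - (1 / Suc n) *\<^sub>R v) - u z) / (1 / Suc n)) \<longlonglongrightarrow> - d v z" for v
    using AE_not_on_countably_many_levels[OF C]
  proof eventually_elim
    case (elim z)
    show ?case
    proof
      assume z: "z \<in> ?B"
      then have zW: "z \<in> W" and zU: "z \<in> U" using BW WU by auto
      let ?t = "Re (g z)"
      have "(f has_real_derivative F ?t) (at ?t)" using elim zU zW ab by (intro der) (auto simp: inW)
      then have df: "(f has_derivative (*) (F ?t)) (at ?t)" by (simp add: has_field_derivative_def)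
      have dgz: "(g has_derivative (\<lambda>v. deriv g z * v)) (at z)" using has_deriv_g[OF zU] by (simp add: has_field_derivative_def)
      have "((\<lambda>z. f (Re (g z))) has_derivative (\<lambda>v. F ?t * Re (deriv g z * v))) (at z)"
        by (rule has_derivative_compose[OF has_derivative_Re[OF dgz] df])
      then have du: "(u has_derivative (\<lambda>v. F ?t * Re (deriv g z * v))) (at z)"
        by (rule has_derivative_transform_within_open[OF _ W zW]) (simp add: uW)
      have line: "((\<lambda>s::real. z - s *\<^sub>R v) has_derivative (\<lambda>s. - (s *\<^sub>R v))) (at 0)"
        by (auto intro!: derivative_eq_intros)
      have "(u has_derivative (\<lambda>v. F ?t * Re (deriv g z * v))) (at (z - 0 *\<^sub>R v))"
        using du unfolding scale_zero_left diff_zero .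
      from has_derivative_compose[OF line this]
      have "((\<lambda>s::real. u (z - s *\<^sub>R v)) has_derivative (\<lambda>s. F ?t * Re (deriv g z * - (s *\<^sub>R v)))) (at 0)" .
      moreover have "(\<lambda>s. F ?t * Re (deriv g z * - (s *\<^sub>R v))) = (*) (- d v z)"
        using z by (auto simp: d_def algebra_simps)
      ultimately have "((\<lambda>s::real. u (z - s *\<^sub>R v)) has_real_derivative - d v z) (at 0)"
        by (simp add: has_field_derivative_def)
      then have "((\<lambda>s. (u (z - s *\<^sub>R v) - u z) / s) \<longlongrightarrow> - d v z) (at 0)"
        by (simp add: has_field_derivative_iff)
      moreover have "filterlim (\<lambda>n. 1 / real (Suc n)) (at 0) sequentially"
        by (intro filterlim_atI LIMSEQ_Suc[OF lim_1_over_n] always_eventually) auto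
      ultimately show "(\<lambda>n. (u (z - (1 / Suc n) *\<^sub>R v) - u z) / (1 / Suc n)) \<longlonglongrightarrow> - d v z"
        by (rule filterlim_compose)
    qed
  qed
  have BU: "?B \<subseteq> U" using BW WU by auto
  have "AE z in lborel. z \<in> ?B \<longrightarrow> p z = d 1 z"
    by (rule weak_derivative_eq_classical[OF u p di weak(1)[OF test_fun_mono[OF _ BU]] ulip dlim])
  moreover have "AE z in lborel. z \<in> ?B \<longrightarrow> q z = d \<i> z"
    by (rule weak_derivative_eq_classical[OF u q di weak(2)[OF test_fun_mono[OF _ BU]] ulip dlim])
  ultimately have "AE z in lborel. z \<in> ?B \<longrightarrow> \<bar>F (Re (g z))\<bar> = 1"
    using ae
  proof eventually_elim
    case (elim z)
    show ?case
    proof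
      assume z: "z \<in> ?B"
      then have zU: "z \<in> U" using BU by auto
      have "of_real (p z) - \<i> * of_real (q z) = of_real (F (Re (g z))) * deriv g z"
        using elim z by (simp add: d_def complex_eq_iff)
      then have "(deriv g z)\<^sup>2 = of_real (F (Re (g z))) ^ 2 * (deriv g z)\<^sup>2"
        using elim zU by (simp add: power_mult_distrib)
      then have "complex_of_real ((F (Re (g z)))\<^sup>2) = 1" using deriv_nonzero[OF zU] by simp
      then have "(F (Re (g z)))\<^sup>2 = 1" by (simp only: of_real_eq_1_iff)
      then show "\<bar>F (Re (g z))\<bar> = 1" by (simp add: abs_square_eq_1)
    qed
  qed
  from open_nonempty_not_null[OF open_ball centre_in_ball[THEN iffD2, OF R(1)] this]
  obtain z where "z \<in> ?B" "\<bar>F (Re (g z))\<bar> = 1" by blast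
  then show ?thesis using BW by (auto simp: inW intro!: exI[of _ "Re (g z)"])
qed

end

section \<open>The Laplacian as a measure\<close>

lemma integral_linear_times_second_derivative:
  fixes a a1 a2 :: "real \<Rightarrow> real"
  assumes d: "\<And>t. (a has_real_derivative a1 t) (at t)" "\<And>t. (a1 has_real_derivative a2 t) (at t)"
    and c: "continuous_on UNIV a2" and z: "\<And>t. t \<notin> {\<alpha>..\<beta>} \<Longrightarrow> a t = 0"
  shows "(LINT t|lborel. (k + s * t) * a2 t) = 0"
proof (rule integral_of_compactly_supported_derivative[where w="\<lambda>t. (k + s * t) * a1 t - s * a t"])
  show "((\<lambda>t. (k + s * t) * a1 t - s * a t) has_real_derivative (k + s * t) * a2 t) (at t)" for t
    by (auto intro!: derivative_eq_intros d)
  show "continuous_on UNIV (\<lambda>t. (k + s * t) * a2 t)" by (intro continuous_intros c)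
  show "(k + s * t) * a1 t - s * a t = 0" if t: "t \<notin> {\<alpha>..\<beta>}" for t
  proof -
    have "a1 t = 0" by (rule derivative_zero_outside[OF d(1), where S="- {\<alpha>..\<beta>}"]) (use t z in auto)
    then show ?thesis using z[OF t] by simp
  qed
qed

lemma integral_abs_times_second_derivative:
  fixes a a1 a2 :: "real \<Rightarrow> real"
  assumes d: "\<And>t. (a has_real_derivative a1 t) (at t)" "\<And>t. (a1 has_real_derivative a2 t) (at t)"
    and c: "continuous_on UNIV a2" and \<eta>: "0 < \<eta>" and z: "\<And>t. t \<notin> {-\<eta>..\<eta>} \<Longrightarrow> a t = 0"
  shows "(LINT t|lborel. \<bar>t\<bar> * a2 t) = 2 * a 0"
proof -
  have z1: "a1 t = 0" if t: "t \<notin> {-\<eta>..\<eta>}" for t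
    by (rule derivative_zero_outside[OF d(1), where S="- {-\<eta>..\<eta>}"]) (use t z in auto)
  have z2: "a2 t = 0" if t: "t \<notin> {-\<eta>..\<eta>}" for t
    by (rule derivative_zero_outside[OF d(2), where S="- {-\<eta>..\<eta>}"]) (use t z1 in auto)
  have i: "integrable lborel (\<lambda>t. \<bar>t\<bar> * a2 t)"
    by (rule integrable_continuous_compact_support[OF _ compact_Icc[of "-\<eta>" \<eta>]])
      (auto intro!: continuous_intros c simp: z2)
  let ?w = "\<lambda>t. t * a1 t - a t"
  have dw: "(?w has_vector_derivative t * a2 t) (at t within S)" for t S
  proof -
    have "(?w has_real_derivative t * a2 t) (at t)" by (auto intro!: derivative_eq_intros d)
    then show ?thesis by (simp add: has_real_derivative_iff_has_vector_derivative has_vector_derivative_at_within)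
  qed
  have e: "a (\<eta> + 1) = 0" "a1 (\<eta> + 1) = 0" "a (-(\<eta> + 1)) = 0" "a1 (-(\<eta> + 1)) = 0" by (rule z z1, simp)+
  have "((\<lambda>t. t * a2 t) has_integral (?w (\<eta> + 1) - ?w 0)) {0..\<eta> + 1}"
    using \<eta> by (intro fundamental_theorem_of_calculus dw) simp
  then have "((\<lambda>t. t * a2 t) has_integral a 0) {0..\<eta> + 1}" using e by simp
  then have R: "((\<lambda>t. \<bar>t\<bar> * a2 t) has_integral a 0) {0..\<eta> + 1}"
    by (rule has_integral_eq[rotated]) simp
  have "((\<lambda>t. t * a2 t) has_integral (?w 0 - ?w (-(\<eta> + 1)))) {-(\<eta> + 1)..0}"
    using \<eta> by (intro fundamental_theorem_of_calculus dw) simp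
  then have "((\<lambda>t. t * a2 t) has_integral - a 0) {-(\<eta> + 1)..0}" using e by simp
  then have "((\<lambda>t. - (t * a2 t)) has_integral - (- a 0)) {-(\<eta> + 1)..0}" by (rule has_integral_neg)
  then have Lf: "((\<lambda>t. \<bar>t\<bar> * a2 t) has_integral - (- a 0)) {-(\<eta> + 1)..0}"
    by (rule has_integral_eq[rotated]) simp
  have "((\<lambda>t. \<bar>t\<bar> * a2 t) has_integral (- (- a 0) + a 0)) {-(\<eta> + 1)..\<eta> + 1}"
    using \<eta> by (intro has_integral_combine[OF _ _ Lf R]) auto
  then have "((\<lambda>t. \<bar>t\<bar> * a2 t) has_integral (- (- a 0) + a 0)) UNIV"
  proof (rule has_integral_on_superset)
    fix t assume "t \<notin> {-(\<eta> + 1)..\<eta> + 1}"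
    then have "a2 t = 0" by (intro z2) auto
    then show "\<bar>t\<bar> * a2 t = 0" by simp
  qed simp
  then have "((\<lambda>t. \<bar>t\<bar> * a2 t) has_integral 2 * a 0) UNIV" by simp
  then show ?thesis using has_integral_integral_lborel[OF i] has_integral_unique by blast
qed

lemma smooth_second_derivatives:
  fixes a :: "real \<Rightarrow> real"
  assumes "smooth_on UNIV a"
  obtains a1 a2 where "\<And>t. (a has_real_derivative a1 t) (at t)" "\<And>t. (a1 has_real_derivative a2 t) (at t)"
    "continuous_on UNIV a2"
  using that[OF smooth_real_derivative[OF assms] smooth_real_derivative[OF smooth_on_dir_deriv[OF assms]]
      smooth_on_continuous[OF smooth_on_dir_deriv[OF smooth_on_dir_deriv[OF assms]]]] by blast

text \<open>
  Integrating out the second coordinate against \<open>b\<close> turns integrals of products \<open>a (Re \<zeta>) b (Im \<zeta>)\<close> into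
  integrals of \<open>a\<close> over the line.
\<close>
lemma weighted_marginal:
  fixes Q :: "complex measure" and b :: "real \<Rightarrow> real"
  assumes Q: "finite_measure Q" "sets Q = sets borel" and b: "continuous_on UNIV b" "\<And>t. 0 \<le> b t" "\<And>t. b t \<le> B"
    and supp: "AE \<zeta> in Q. \<bar>Re \<zeta>\<bar> \<le> r"
  defines "m \<equiv> distr (density Q (\<lambda>\<zeta>. ennreal (b (Im \<zeta>)))) borel Re"
  shows "finite_borel_measure m" "AE t in m. \<bar>t\<bar> \<le> r"
    "\<And>a. continuous_on UNIV a \<Longrightarrow> (LINT t|m. a t) = (LINT \<zeta>|Q. a (Re \<zeta>) * b (Im \<zeta>) :: real)"
proof -
  interpret Q: finite_measure Q by fact
  have [measurable_cong]: "sets Q = sets borel" by fact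
  have [measurable]: "b \<in> borel_measurable borel" using b(1) by (rule borel_measurable_continuous_onI)
  have "integrable Q (\<lambda>\<zeta>. b (Im \<zeta>))"
    by (rule Q.integrable_const_bound[where B=B]) (use b in auto)
  then have "(\<integral>\<^sup>+ \<zeta>. ennreal (b (Im \<zeta>)) \<partial>Q) < \<infinity>"
    using b(2) by (simp add: integrable_iff_bounded)
  then have "finite_measure (density Q (\<lambda>\<zeta>. ennreal (b (Im \<zeta>))))"
    by (intro finite_measureI) (simp add: emeasure_density cong: nn_integral_cong)
  then have "finite_measure m" unfolding m_def by (rule finite_measure.finite_measure_distr) measurable
  then show "finite_borel_measure m"
    by (simp add: finite_borel_measure_def finite_borel_measure_axioms_def m_def)
  show "AE t in m. \<bar>t\<bar> \<le> r"
    unfolding m_def using supp by (subst AE_distr_iff) (auto simp: AE_density elim!: eventually_mono)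
  show "(LINT t|m. a t) = (LINT \<zeta>|Q. a (Re \<zeta>) * b (Im \<zeta>))" if "continuous_on UNIV a" for a
  proof -
    have [measurable]: "a \<in> borel_measurable borel" using that by (rule borel_measurable_continuous_onI)
    have "(LINT t|m. a t) = (LINT \<zeta>|density Q (\<lambda>\<zeta>. ennreal (b (Im \<zeta>))). a (Re \<zeta>))"
      unfolding m_def by (rule integral_distr) measurable
    also have "\<dots> = (LINT \<zeta>|Q. b (Im \<zeta>) *\<^sub>R a (Re \<zeta>))"
      by (rule integral_density) (use b(2) in auto)
    finally show ?thesis by (simp add: mult.commute)
  qed
qed

text \<open>
  A function with distributional Laplacian \<open>\<mu>\<close> that depends on the first coordinate of the chart only.
\<close>
locale charted_laplacian = square_chart +
  fixes \<Omega> :: "complex set" and \<mu> :: signed_measure and u :: "complex \<Rightarrow> real" and f :: "real \<Rightarrow> real"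
  assumes \<Omega>: "open \<Omega>" and U\<Omega>: "U \<subseteq> \<Omega>" and \<mu>: "signed_radon_on \<Omega> \<mu>"
    and lap: "test_fun U \<phi> \<Longrightarrow> (LINT z|lborel. laplacian \<phi> z * u z) = signed_integral \<mu> \<phi>"
    and uf: "\<zeta> \<in> closed_square r \<Longrightarrow> u (G \<zeta>) = f (Re \<zeta>)" and f: "continuous_on {-r..r} f"
begin

lemma radon: "radon_on \<Omega> (fst \<mu>)" "radon_on \<Omega> (snd \<mu>)"
  using \<mu> by (auto simp: signed_radon_on_def)

lemma signed_integral_pull:
  assumes a: "smooth_on UNIV a" "\<And>t. r \<le> \<bar>t\<bar> \<Longrightarrow> a t = 0"
      "\<And>t. (a has_real_derivative a1 t) (at t)" "\<And>t. (a1 has_real_derivative a2 t) (at t)"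
    and b: "smooth_on UNIV b" "\<And>t. r \<le> \<bar>t\<bar> \<Longrightarrow> b t = 0"
  shows "signed_integral \<mu> (pull a b) = (LINT t|lborel. (indicator {-r..r} t * f t) * a2 t) * (LINT t|lborel. b t)"
  using laplacian_test_identity[OF uf f a b] lap[OF test_fun_pull[OF a(1,2) b]] by simp

text \<open>
  With \<open>b\<close> of integral one, the test identity says that \<open>f''\<close> is the difference of the weighted marginals of
  the two parts of \<open>\<mu>\<close>.
\<close>
lemma slope_estimate:
  assumes \<rho>: "0 < \<rho>" "\<rho> < r"
  obtains m1 m2 B where "finite_borel_measure m1" "finite_borel_measure m2"
    "\<And>s t. s \<in> {-\<rho>..\<rho>} \<Longrightarrow> t \<in> {-\<rho>..\<rho>} \<Longrightarrow> s \<le> t \<Longrightarrow>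
      (t - s) * (B + cdf m1 s - cdf m2 t) \<le> f t - f s \<and> f t - f s \<le> (t - s) * (B + cdf m1 t - cdf m2 s)"
proof -
  let ?b0 = "bump 1 (-r) r"
  define c where "c = (LINT t|lborel. ?b0 t)"
  have b0c: "continuous_on UNIV ?b0" by (rule continuous_bump) simp
  have b0i: "integrable lborel ?b0"
    by (rule integrable_continuous_compact_support[OF b0c compact_Icc[of "-r" r]]) (auto simp: bump_def)
  have c: "0 < c" unfolding c_def
    by (rule integral_continuous_nonneg_pos[OF b0c b0i bump_nonneg, of 0]) (use r in \<open>auto intro: bump_pos\<close>)
  define b where "b t = ?b0 t * (1 / c)" for t
  have bs: "smooth_on UNIV b" unfolding b_def[abs_def] by (intro smooth_on_mult smooth_bump smooth_on_const) auto
  have bc: "continuous_on UNIV b" by (rule smooth_on_continuous[OF bs])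
  have bn: "0 \<le> b t" "b t \<le> 1 / c" for t
    using c bump_nonneg[of 1 "-r" r t] bump_le_1[of 1 "-r" r t] by (auto simp: b_def field_simps)
  have bz: "b t = 0" if "r \<le> \<bar>t\<bar>" for t using that by (auto simp: b_def bump_def)
  have b1: "(LINT t|lborel. b t) = 1" unfolding b_def using c by (simp add: c_def)
  let ?m = "\<lambda>M. distr (density (push M) (\<lambda>\<zeta>. ennreal (b (Im \<zeta>)))) borel Re"
  have marg: "finite_borel_measure (?m M)" "AE t in ?m M. \<bar>t\<bar> \<le> r"
    "\<And>a. continuous_on UNIV a \<Longrightarrow> (LINT t|?m M. a t) = (LINT \<zeta>|push M. a (Re \<zeta>) * b (Im \<zeta>) :: real)"
    if M: "radon_on \<Omega> M" for M
  proof -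
    have "AE \<zeta> in push M. \<bar>Re \<zeta>\<bar> \<le> r"
      using AE_push[OF M U\<Omega> \<Omega>] by eventually_elim (simp add: in_closed_square)
    from weighted_marginal[OF finite_push[OF M U\<Omega> \<Omega>] sets_push[OF M U\<Omega> \<Omega>] bc bn this]
    show "finite_borel_measure (?m M)" "AE t in ?m M. \<bar>t\<bar> \<le> r"
      "\<And>a. continuous_on UNIV a \<Longrightarrow> (LINT t|?m M. a t) = (LINT \<zeta>|push M. a (Re \<zeta>) * b (Im \<zeta>) :: real)" by blast+
  qed
  have test: "(LINT t|?m (fst \<mu>). a t) - (LINT t|?m (snd \<mu>). a t) = (LINT t|lborel. (indicator {-r..r} t * f t) * a2 t)"
    if a: "smooth_on UNIV a" "\<And>t. (a has_real_derivative a1 t) (at t)" "\<And>t. (a1 has_real_derivative a2 t) (at t)"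
      "\<And>t. r \<le> \<bar>t\<bar> \<Longrightarrow> a t = 0" for a a1 a2
  proof -
    have ac: "continuous_on UNIV a" by (rule smooth_on_continuous[OF a(1)])
    have "(LINT t|?m M. a t) = (LINT z|M. pull a b z)" if M: "radon_on \<Omega> M" for M
      using marg(3)[OF M ac] integral_push[OF M U\<Omega> \<Omega> ac bc a(4) bz] by (rule trans)
    from this[OF radon(1)] this[OF radon(2)] show ?thesis
      using signed_integral_pull[OF a(1,4,2,3) bs bz] unfolding signed_integral_def b1 by simp
  qed
  obtain B where "\<And>s t. -\<rho> \<le> s \<Longrightarrow> s \<le> t \<Longrightarrow> t \<le> \<rho> \<Longrightarrow>
      (t - s) * (B + cdf (?m (fst \<mu>)) s - cdf (?m (snd \<mu>)) t) \<le> f t - f s \<and>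
      f t - f s \<le> (t - s) * (B + cdf (?m (fst \<mu>)) t - cdf (?m (snd \<mu>)) s)"
    by (rule slope_estimate_of_measure_second_derivative[OF marg(1,2)[OF radon(1)] marg(1,2)[OF radon(2)] f \<rho> test])
      (assumption, assumption, assumption, assumption, rule that)
  then show thesis
    by (intro that[OF marg(1)[OF radon(1)] marg(1)[OF radon(2)], of B]) auto
qed

lemma piecewise_linear_profile:
  fixes p q :: "complex \<Rightarrow> real"
  assumes u: "integrable lborel u" and p: "integrable lborel p" and q: "integrable lborel q"
    and weak: "\<And>\<phi>. test_fun U \<phi> \<Longrightarrow> (LINT z|lborel. dir_deriv 1 \<phi> z * u z) = - (LINT z|lborel. \<phi> z * p z)"
      "\<And>\<phi>. test_fun U \<phi> \<Longrightarrow> (LINT z|lborel. dir_deriv \<i> \<phi> z * u z) = - (LINT z|lborel. \<phi> z * q z)"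
    and ae: "AE z in lborel. z \<in> U \<longrightarrow> (deriv g z)\<^sup>2 = (of_real (p z) - \<i> * of_real (q z))\<^sup>2"
  obtains \<delta> \<sigma> \<tau> where "0 < \<delta>" "\<delta> < r" "\<bar>\<sigma>\<bar> = 1" "\<bar>\<tau>\<bar> = (1::real)"
    "\<And>t. 0 \<le> t \<Longrightarrow> t \<le> \<delta> \<Longrightarrow> f t = f 0 + \<sigma> * t" "\<And>t. -\<delta> \<le> t \<Longrightarrow> t \<le> 0 \<Longrightarrow> f t = f 0 + \<tau> * t"
proof -
  define \<rho> where "\<rho> = r / 2"
  have \<rho>: "0 < \<rho>" "\<rho> < r" using r by (auto simp: \<rho>_def)
  obtain m1 m2 B where m: "finite_borel_measure m1" "finite_borel_measure m2"
    and est: "\<And>s t. s \<in> {-\<rho>..\<rho>} \<Longrightarrow> t \<in> {-\<rho>..\<rho>} \<Longrightarrow> s \<le> t \<Longrightarrow>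
      (t - s) * (B + cdf m1 s - cdf m2 t) \<le> f t - f s \<and> f t - f s \<le> (t - s) * (B + cdf m1 t - cdf m2 s)"
    by (rule slope_estimate[OF \<rho>]) (rule that)
  interpret m1: finite_borel_measure m1 by (rule m(1))
  interpret m2: finite_borel_measure m2 by (rule m(2))
  let ?M1 = "measure m1 (space m1)" and ?M2 = "measure m2 (space m2)"
  let ?F = "\<lambda>t. B + cdf m1 t - cdf m2 t" and ?L = "\<bar>B\<bar> + ?M1 + ?M2"
  have mono: "mono (cdf m1)" "mono (cdf m2)"
    using m1.cdf_nondecreasing m2.cdf_nondecreasing by (auto intro: monoI)
  have bound: "\<And>t. 0 \<le> cdf m1 t \<and> cdf m1 t \<le> ?M1" "\<And>t. 0 \<le> cdf m2 t \<and> cdf m2 t \<le> ?M2"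
    using m1.cdf_nonneg m1.cdf_bounded m2.cdf_nonneg m2.cdf_bounded by auto
  let ?C = "{t. \<not> isCont (cdf m1) t} \<union> {t. \<not> isCont (cdf m2) t}"
  have C: "countable ?C" using mono_ctble_discont[OF mono(1)] mono_ctble_discont[OF mono(2)] by simp
  have der: "(f has_real_derivative ?F t) (at t)" if "t \<in> {-\<rho><..<\<rho>} - ?C" for t
    by (rule slope_estimate_derivative[OF est mono]) (use that in auto)
  have lip: "\<bar>f t - f s\<bar> \<le> ?L * \<bar>t - s\<bar>" if "s \<in> {-\<rho>..\<rho>}" "t \<in> {-\<rho>..\<rho>}" for s t
    by (rule slope_estimate_lipschitz[OF est bound that])
  have Fm: "?F \<in> borel_measurable borel"
    using borel_measurable_mono[OF mono(1)] borel_measurable_mono[OF mono(2)] by measurable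
  have Fb: "\<bar>?F t\<bar> \<le> ?L" for t using bound(1)[of t] bound(2)[of t] by linarith
  have dense: "\<exists>t. \<alpha> < t \<and> t < \<beta> \<and> \<bar>?F t\<bar> = 1" if "-\<rho> < \<alpha>" "\<alpha> < \<beta>" "\<beta> < \<rho>" for \<alpha> \<beta>
    by (rule unit_slope_dense[OF u p q weak ae uf Fm Fb lip C der less_imp_le[OF \<rho>(2)] that])
  have right: "(cdf m1 \<longlongrightarrow> cdf m1 t) (at_right t)" "(cdf m2 \<longlongrightarrow> cdf m2 t) (at_right t)" for t
    using m1.cdf_is_right_cont m2.cdf_is_right_cont by (auto simp: continuous_within)
  obtain \<delta> \<sigma> \<tau> where ds: "0 < \<delta>" "\<delta> < \<rho>" "\<bar>\<sigma>\<bar> = 1" "\<bar>\<tau>\<bar> = (1::real)"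
    "\<And>t. 0 \<le> t \<Longrightarrow> t \<le> \<delta> \<Longrightarrow> f t = f 0 + \<sigma> * t" "\<And>t. -\<delta> \<le> t \<Longrightarrow> t \<le> 0 \<Longrightarrow> f t = f 0 + \<tau> * t"
    by (rule unit_slopes_piecewise_linear[OF \<rho>(1) est mono right m1.cdf_at_left m2.cdf_at_left dense])
      (assumption, assumption, assumption, assumption, assumption, assumption, rule that)
  have "\<delta> < r" using ds(2) \<rho>(2) by linarith
  then show thesis by (rule that[OF ds(1) _ ds(3,4,5,6)])
qed

text \<open>
  Testing an affine \<open>f\<close> against \<open>a''\<close> gives \<open>0\<close>, so the images of the two parts of \<open>\<mu>\<close> agree on
  bumps in the strip.
\<close>
lemma no_mass_on_linear_strip:
  assumes lin: "\<And>t. \<alpha> \<le> t \<Longrightarrow> t \<le> \<beta> \<Longrightarrow> f t = k + s * t" and \<alpha>\<beta>: "-r \<le> \<alpha>" "\<beta> \<le> r"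
    and A: "A \<in> sets borel" "A \<subseteq> {z \<in> U. \<alpha> < Re (g z) \<and> Re (g z) < \<beta> \<and> \<bar>Im (g z)\<bar> < r}"
  shows "emeasure (fst \<mu>) A = emeasure (snd \<mu>) A"
proof -
  have AK: "A \<subseteq> K" using A(2) \<alpha>\<beta> by (auto simp: in_K in_closed_square subset_iff abs_le_iff)
  have "emeasure (push (fst \<mu>)) (g ` A) = emeasure (push (snd \<mu>)) (g ` A)"
  proof (rule emeasure_eq_if_bumps_agree[OF finite_push[OF radon(1) U\<Omega> \<Omega>] finite_push[OF radon(2) U\<Omega> \<Omega>]
        sets_push[OF radon(1) U\<Omega> \<Omega>] sets_push[OF radon(2) U\<Omega> \<Omega>]])
    show "g ` A \<in> sets borel" by (rule borel_chart_image[OF radon(1) U\<Omega> \<Omega> A(1) AK])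
    show "g ` A \<subseteq> box (Complex \<alpha> (-r)) (Complex \<beta> r)"
    proof (rule image_subsetI)
      fix z assume "z \<in> A"
      then have "\<alpha> < Re (g z) \<and> Re (g z) < \<beta> \<and> \<bar>Im (g z)\<bar> < r" using A(2) by blast
      then show "g z \<in> box (Complex \<alpha> (-r)) (Complex \<beta> r)" by (auto simp: in_box_complex_iff)
    qed
    fix e a' b' c' d' :: real
    assume *: "0 < e" "\<alpha> \<le> a'" "a' < b'" "b' \<le> \<beta>" "-r \<le> c'" "c' < d'" "d' \<le> r"
    let ?a = "bump e a' b'" and ?b = "bump e c' d'"
    have sm: "smooth_on UNIV ?a" "smooth_on UNIV ?b" using *(1) by (auto intro: smooth_bump)
    have za: "?a t = 0" if "r \<le> \<bar>t\<bar>" for t by (rule bump_eq_0) (use that * \<alpha>\<beta> in linarith)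
    have zb: "?b t = 0" if "r \<le> \<bar>t\<bar>" for t by (rule bump_eq_0) (use that * in linarith)
    obtain a1 a2 where d: "\<And>t. (?a has_real_derivative a1 t) (at t)" "\<And>t. (a1 has_real_derivative a2 t) (at t)"
      "continuous_on UNIV a2" by (rule smooth_second_derivatives[OF sm(1)]) (rule that)
    have z0: "?a t = 0" if "t \<notin> {a'..b'}" for t using that by (auto simp: bump_def)
    have z1: "a1 t = 0" if t: "t \<notin> {a'..b'}" for t
      by (rule derivative_zero_outside[OF d(1), where S="- {a'..b'}"]) (use t z0 in auto)
    have z2: "a2 t = 0" if t: "t \<notin> {a'..b'}" for t
      by (rule derivative_zero_outside[OF d(2), where S="- {a'..b'}"]) (use t z1 in auto)
    have "(indicator {-r..r} t * f t) * a2 t = (k + s * t) * a2 t" for t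
      using z2[of t] lin[of t] * \<alpha>\<beta> by (cases "t \<in> {a'..b'}") auto
    then have "(LINT t|lborel. (indicator {-r..r} t * f t) * a2 t) = (LINT t|lborel. (k + s * t) * a2 t)"
      by (rule Bochner_Integration.integral_cong[OF refl])
    also have "\<dots> = 0" by (rule integral_linear_times_second_derivative[OF d z0])
    finally have "(LINT t|lborel. (indicator {-r..r} t * f t) * a2 t) = 0" .
    then have "signed_integral \<mu> (pull ?a ?b) = 0"
      using signed_integral_pull[OF sm(1) za d(1,2) sm(2) zb] by simp
    moreover have "(LINT z|push M. ?a (Re z) * ?b (Im z)) = (LINT z|M. pull ?a ?b z)" if "radon_on \<Omega> M" for M
      by (rule integral_push[OF that U\<Omega> \<Omega> smooth_on_continuous[OF sm(1)] smooth_on_continuous[OF sm(2)] za zb])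
    ultimately show "(LINT z|push (fst \<mu>). ?a (Re z) * ?b (Im z)) = (LINT z|push (snd \<mu>). ?a (Re z) * ?b (Im z))"
      using radon unfolding signed_integral_def by simp
  qed
  then show ?thesis
    unfolding emeasure_push[OF radon(1) U\<Omega> \<Omega> A(1) AK] emeasure_push[OF radon(2) U\<Omega> \<Omega> A(1) AK] .
qed

text \<open>
  The second derivative of \<open>\<sigma>\<bar>t\<bar>\<close> is \<open>2\<sigma>\<close> times the point mass at \<open>0\<close>. A product of bumps
  around \<open>g z\<close> therefore has integral \<open>2 \<sigma> a(0) \<integral>b \<noteq> 0\<close>, although \<open>\<mu>\<close> vanishes on its support.
\<close>
lemma mass_on_fold:
  assumes fold: "\<And>t. \<bar>t\<bar> \<le> \<delta> \<Longrightarrow> f t = \<sigma> * \<bar>t\<bar>" and \<sigma>: "\<sigma> \<noteq> 0" and \<delta>: "0 < \<delta>" "\<delta> \<le> r"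
    and V: "open V" "V \<subseteq> U" "z \<in> V" and z: "Re (g z) = 0" "\<bar>Im (g z)\<bar> < r"
    and vanish: "\<And>A. A \<in> sets borel \<Longrightarrow> A \<subseteq> V \<Longrightarrow> emeasure (fst \<mu>) A = emeasure (snd \<mu>) A"
  shows False
proof -
  let ?y = "Im (g z)"
  have gV: "open (g ` V)"
    using open_mapping_thm3[OF holomorphic_on_subset[OF g V(2)] V(1) inj_on_subset[OF inj V(2)]] .
  have "g z \<in> g ` V" using V(3) by auto
  then obtain e where e: "0 < e" "cball (g z) e \<subseteq> g ` V" using gV unfolding open_contains_cball by blast
  (* small enough for the product of bumps to be supported in \<open>V\<close>, in the fold and in the square *)
  define \<eta> where "\<eta> = min (e / 2) (min (\<delta> / 2) ((r - \<bar>?y\<bar>) / 2))"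
  have "0 < \<eta>" using e(1) \<delta>(1) z(2) by (simp add: \<eta>_def)
  moreover have "\<eta> \<le> e / 2" unfolding \<eta>_def by (rule min.cobounded1)
  moreover have "\<eta> \<le> \<delta> / 2" unfolding \<eta>_def by (rule min.coboundedI2, rule min.cobounded1)
  moreover have "\<eta> \<le> (r - \<bar>?y\<bar>) / 2" unfolding \<eta>_def by (rule min.coboundedI2, rule min.cobounded2)
  ultimately have \<eta>: "0 < \<eta>" "\<eta> \<le> e / 2" "\<eta> \<le> \<delta> / 2" "\<eta> \<le> (r - \<bar>?y\<bar>) / 2" by blast+
  let ?a = "bump 1 (-\<eta>) \<eta>" and ?b = "bump 1 (?y - \<eta>) (?y + \<eta>)"
  have sm: "smooth_on UNIV ?a" "smooth_on UNIV ?b" by (auto intro: smooth_bump)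
  have za: "?a t = 0" if "r \<le> \<bar>t\<bar>" for t by (rule bump_eq_0) (use that \<eta> \<delta> in linarith)
  have yb: "?y + \<eta> \<le> r" "- r \<le> ?y - \<eta>" using \<eta>(1,4) by (simp_all add: field_simps abs_if split: if_splits)
  have zb: "?b t = 0" if "r \<le> \<bar>t\<bar>" for t by (rule bump_eq_0) (use that yb in linarith)
  obtain a1 a2 where d: "\<And>t. (?a has_real_derivative a1 t) (at t)" "\<And>t. (a1 has_real_derivative a2 t) (at t)"
    "continuous_on UNIV a2" by (rule smooth_second_derivatives[OF sm(1)]) (rule that)
  have z0: "?a t = 0" if "t \<notin> {-\<eta>..\<eta>}" for t using that by (auto simp: bump_def)
  have z1: "a1 t = 0" if t: "t \<notin> {-\<eta>..\<eta>}" for t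
    by (rule derivative_zero_outside[OF d(1), where S="- {-\<eta>..\<eta>}"]) (use t z0 in auto)
  have z2: "a2 t = 0" if t: "t \<notin> {-\<eta>..\<eta>}" for t
    by (rule derivative_zero_outside[OF d(2), where S="- {-\<eta>..\<eta>}"]) (use t z1 in auto)
  have "(indicator {-r..r} t * f t) * a2 t = \<sigma> * (\<bar>t\<bar> * a2 t)" for t
  proof (cases "t \<in> {-\<eta>..\<eta>}")
    case True
    then have "\<bar>t\<bar> \<le> \<delta>" "t \<in> {-r..r}" using \<eta> \<delta> by (auto simp: abs_le_iff)
    then show ?thesis using fold[of t] by simp
  qed (simp add: z2)
  then have "(LINT t|lborel. (indicator {-r..r} t * f t) * a2 t) = (LINT t|lborel. \<sigma> * (\<bar>t\<bar> * a2 t))"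
    by (rule Bochner_Integration.integral_cong[OF refl])
  also have "\<dots> = \<sigma> * (LINT t|lborel. \<bar>t\<bar> * a2 t)" by (rule integral_mult_right_zero)
  also have "(LINT t|lborel. \<bar>t\<bar> * a2 t) = 2 * ?a 0"
    by (rule integral_abs_times_second_derivative[OF d \<eta>(1) z0])
  finally have "(LINT t|lborel. (indicator {-r..r} t * f t) * a2 t) = \<sigma> * (2 * ?a 0)" .
  then have si: "signed_integral \<mu> (pull ?a ?b) = \<sigma> * (2 * ?a 0) * (LINT t|lborel. ?b t)"
    using signed_integral_pull[OF sm(1) za d(1,2) sm(2) zb] by simp
  have "0 < ?a 0" using \<eta>(1) by (intro bump_pos) auto
  moreover have "0 < (LINT t|lborel. ?b t)"
  proof (rule integral_continuous_nonneg_pos[OF continuous_bump _ bump_nonneg, of _ _ _ ?y])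
    show "integrable lborel ?b"
      by (rule integrable_continuous_compact_support[OF continuous_bump compact_Icc[of "?y - \<eta>" "?y + \<eta>"]])
        (auto simp: bump_def)
    show "0 < ?b ?y" using \<eta>(1) by (intro bump_pos) auto
  qed simp
  ultimately have "signed_integral \<mu> (pull ?a ?b) \<noteq> 0" using \<sigma> si by simp
  moreover have "signed_integral \<mu> (pull ?a ?b) = 0"
  proof -
    have Mb: "sets M = sets (restrict_space borel \<Omega>)" if "radon_on \<Omega> M" for M using that by (simp add: radon_on_def)
    have spM: "space M = \<Omega>" if "radon_on \<Omega> M" for M
      using sets_eq_imp_space_eq[OF Mb[OF that]] by (simp add: space_restrict_space)
    have V\<Omega>: "V \<subseteq> \<Omega>" using V U\<Omega> by auto
    have VM: "V \<inter> space M \<in> sets M" if "radon_on \<Omega> M" for M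
      using V(1) V\<Omega> unfolding spM[OF that] Mb[OF that] sets_restrict_space by (intro image_eqI[of _ _ V]) auto
    have "restrict_space (fst \<mu>) V = restrict_space (snd \<mu>) V"
    proof (rule measure_eqI)
      show "sets (restrict_space (fst \<mu>) V) = sets (restrict_space (snd \<mu>) V)"
        using Mb[OF radon(1)] Mb[OF radon(2)] by (intro sets_restrict_space_cong) simp
      fix A assume A: "A \<in> sets (restrict_space (fst \<mu>) V)"
      then have AV: "A \<subseteq> V" and "A \<in> sets (fst \<mu>)" using sets_restrict_space_iff[OF VM[OF radon(1)]] by auto
      then have "A \<in> sets borel" using \<Omega> unfolding Mb[OF radon(1)] by (simp add: sets_restrict_space_iff)
      then show "emeasure (restrict_space (fst \<mu>) V) A = emeasure (restrict_space (snd \<mu>) V) A"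
        using vanish AV by (simp add: emeasure_restrict_space[OF VM[OF radon(1)]] emeasure_restrict_space[OF VM[OF radon(2)]])
    qed
    moreover have pV: "indicator V w *\<^sub>R pull ?a ?b w = pull ?a ?b w" for w
    proof (cases "pull ?a ?b w = 0")
      case False
      then have w: "w \<in> U" "bump 1 (-\<eta>) \<eta> (Re (g w)) \<noteq> 0" "?b (Im (g w)) \<noteq> 0" by (auto simp: pull_def split: if_splits)
      then have "\<bar>Re (g w - g z)\<bar> < \<eta>" "\<bar>Im (g w - g z)\<bar> < \<eta>"
        using bump_eq_0[of "Re (g w)" "-\<eta>" \<eta> 1] bump_eq_0[of "Im (g w)" "?y - \<eta>" "?y + \<eta>" 1] z(1) by force+
      then have "dist (g z) (g w) \<le> e" using cmod_le[of "g w - g z"] \<eta>(2) by (simp add: dist_norm norm_minus_commute)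
      then have "g w \<in> g ` V" using e(2) by auto
      then have "w \<in> V" using Gg w(1) V(2) by (metis imageE subsetD)
      then show ?thesis by simp
    qed simp
    moreover have "(LINT w|M. pull ?a ?b w) = (LINT w|restrict_space M V. pull ?a ?b w)" if "radon_on \<Omega> M" for M
      unfolding integral_restrict_space[OF VM[OF that]] pV ..
    ultimately show ?thesis using radon by (simp add: signed_integral_def)
  qed
  ultimately show False by simp
qed

end

section \<open>The nodal line and the local structure\<close>

lemma real_tanh_deriv: "(tanh has_real_derivative 1 - (tanh t)\<^sup>2) (at (t::real))"
  using has_field_derivative_tanh[OF _ DERIV_ident, of t] by simp

text \<open>
  The hyperbolic tangent maps the line diffeomorphically onto \<open>(-1, 1)\<close>; it parametrizes the nodal line by
  all of \<open>\<real>\<close>.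
\<close>
lemma smooth_tanh: "smooth_on UNIV (tanh :: real \<Rightarrow> real)"
  unfolding smooth_on_def
proof
  fix k show "Ck_on k UNIV (tanh :: real \<Rightarrow> real)"
  proof (induction k)
    case 0
    have "continuous_on UNIV (tanh :: real \<Rightarrow> real)"
      by (intro continuous_on_tanh continuous_on_id) simp
    then show ?case by simp
  next
    case (Suc k)
    show ?case
    proof (rule Ck_on_real_SucI[where f'="\<lambda>t::real. 1 - tanh t * tanh t"])
      show "(tanh has_vector_derivative 1 - tanh t * tanh t) (at t)" for t :: real
        using real_tanh_deriv[of t]
        by (simp add: has_real_derivative_iff_has_vector_derivative power2_eq_square)
      show "Ck_on k UNIV (\<lambda>t::real. 1 - tanh t * tanh t)"
        by (intro Ck_on_diff Ck_on_const Ck_on_mult open_UNIV Suc)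
    qed simp
  qed
qed

lemma smooth_artanh: "smooth_on {-1<..<1} (artanh :: real \<Rightarrow> real)"
proof (rule smooth_on_real_antiderivative)
  show "open {-1<..<1::real}" by simp
  show "(artanh has_real_derivative 1 / (1 - t\<^sup>2)) (at t)" if "t \<in> {-1<..<1}" for t :: real
    by (rule artanh_real_has_field_derivative) (use that in auto)
  have nz: "1 - t\<^sup>2 \<noteq> 0" if "t \<in> {-1<..<1}" for t :: real
    using that abs_square_less_1[of t] by auto
  show "smooth_on {-1<..<1} (\<lambda>t::real. 1 / (1 - t\<^sup>2))"
    unfolding smooth_on_def
  proof
    fix k show "Ck_on k {-1<..<1} (\<lambda>t::real. 1 / (1 - t\<^sup>2))"
    proof (induction k)
      case 0
      have "continuous_on {-1<..<1} (\<lambda>t::real. 1 / (1 - t\<^sup>2))"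
        using nz by (intro continuous_intros) auto
      then show ?case by simp
    next
      case (Suc k)
      show ?case
      proof (rule Ck_on_real_SucI[where f'="\<lambda>t::real. (2 * t) * ((1 / (1 - t\<^sup>2)) * (1 / (1 - t\<^sup>2)))"])
        show "((\<lambda>t. 1 / (1 - t\<^sup>2)) has_vector_derivative (2 * t) * ((1 / (1 - t\<^sup>2)) * (1 / (1 - t\<^sup>2)))) (at t)"
          if "t \<in> {-1<..<1}" for t :: real
        proof -
          have "((\<lambda>t. 1 / (1 - t\<^sup>2)) has_real_derivative (2 * t) * ((1 / (1 - t\<^sup>2)) * (1 / (1 - t\<^sup>2)))) (at t)"
            using nz[OF that] by (auto intro!: derivative_eq_intros)
          then show ?thesis by (simp only: has_real_derivative_iff_has_vector_derivative)
        qed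
        show "Ck_on k {-1<..<1} (\<lambda>t::real. (2 * t) * ((1 / (1 - t\<^sup>2)) * (1 / (1 - t\<^sup>2))))"
          by (intro Ck_on_mult Suc Ck_on_const Ck_on_id) auto
      qed simp
    qed
  qed
qed

lemma tanh_range: "\<bar>y\<bar> < 1 \<Longrightarrow> \<exists>t::real. tanh t = y"
proof -
  assume y: "\<bar>y\<bar> < 1"
  have "eventually (\<lambda>t. tanh t < y) (at_bot :: real filter)"
    using tanh_real_at_bot y by (intro order_tendstoD(2)[of _ "-1"]) auto
  moreover have "eventually (\<lambda>t. y < tanh t) (at_top :: real filter)"
    using tanh_real_at_top y by (intro order_tendstoD(1)[of _ 1]) auto
  ultimately obtain a b where a: "tanh a < y" "a \<le> 0" and b: "y < tanh b" "0 \<le> (b::real)"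
    unfolding eventually_at_bot_linorder eventually_at_top_linorder
    by (metis linear max.cobounded1 max.cobounded2 min.cobounded1 min.cobounded2)
  have "\<exists>t\<ge>a. t \<le> b \<and> tanh t = y"
    using a b by (intro IVT') (auto intro!: continuous_on_tanh continuous_on_id)
  then show ?thesis by blast
qed

context square_chart
begin

lemma re_chart_harmonic:
  assumes "V \<subseteq> U"
  shows "harmonic_on V (\<lambda>z. Re (g z))"
    and "z \<in> U \<Longrightarrow> grad (\<lambda>z. Re (g z)) z = cnj (deriv g z)"
proof -
  have first: "dir_deriv v (\<lambda>z. Re (g z)) z = Re (deriv g z * v)" if "z \<in> U" for v z
  proof -
    have "(g has_derivative (\<lambda>v. deriv g z * v)) (at z)" using has_deriv_g[OF that] by (simp add: has_field_derivative_def)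
    from dir_deriv_eqI[OF has_derivative_Re[OF this]] show ?thesis .
  qed
  have second: "dir_deriv v (dir_deriv v (\<lambda>z. Re (g z))) z = Re (deriv (deriv g) z * v * v)" if z: "z \<in> U" for v z
  proof -
    have "dir_deriv v (dir_deriv v (\<lambda>z. Re (g z))) z = dir_deriv v (\<lambda>z. Re (deriv g z * v)) z"
      by (rule dir_deriv_cong[OF openU z]) (rule first)
    moreover have "(deriv g has_derivative (\<lambda>v. deriv (deriv g) z * v)) (at z)"
      using holomorphic_derivI[OF holomorphic_deriv[OF g openU] openU z] by (simp add: has_field_derivative_def)
    from dir_deriv_eqI[OF has_derivative_Re[OF has_derivative_mult_left[OF this]]]
    have "dir_deriv v (\<lambda>z. Re (deriv g z * v)) z = Re (deriv (deriv g) z * v * v)" .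
    ultimately show ?thesis by simp
  qed
  have "Ck_on 2 V (\<lambda>z. Re (g z))"
    by (rule Ck_on_subset[OF Ck_on_bounded_linear[OF openU bounded_linear_Re holomorphic_Ck_on[OF openU g]] assms])
  moreover have "laplacian (\<lambda>z. Re (g z)) z = 0" if "z \<in> V" for z
    using that assms unfolding laplacian_def by (subst (1 2) second) auto
  ultimately show "harmonic_on V (\<lambda>z. Re (g z))" by (simp add: harmonic_on_def)
  show "grad (\<lambda>z. Re (g z)) z = cnj (deriv g z)" if "z \<in> U"
    unfolding grad_def first[OF that] by (simp add: complex_eq_iff)
qed

text \<open>
  The parametrization \<open>t \<mapsto> G (\<i> \<delta> tanh t)\<close> has the inverse \<open>artanh (Im g / \<delta>)\<close>, which is
  defined and smooth on a neighbourhood of the curve and not merely on the curve.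
\<close>
lemma nodal_line:
  assumes \<delta>: "0 < \<delta>" "\<delta> \<le> r"
  defines "Z \<equiv> {z \<in> U. Re (g z) = 0 \<and> \<bar>Im (g z)\<bar> < \<delta>}"
  shows "smooth_simple_curve Z" and "diffeomorphic Z (UNIV :: real set)"
proof -
  let ?l = "\<lambda>t::real. \<i> * complex_of_real (\<delta> * tanh t)"
  define \<gamma> where "\<gamma> t = G (?l t)" for t :: real
  have th: "\<bar>tanh t\<bar> < 1" for t :: real using tanh_real_lt_1[of t] tanh_real_gt_neg1[of t] by (simp add: abs_less_iff)
  have small: "\<bar>\<delta> * tanh t\<bar> < \<delta>" for t :: real
    using mult_strict_left_mono[OF th \<delta>(1)] \<delta>(1) by (simp add: abs_mult)
  have l: "?l t \<in> g ` U" for t :: real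
    by (rule subsetD[OF closed_square]) (use small[of t] \<delta> r in \<open>auto simp: in_closed_square\<close>)
  have ls: "smooth_on UNIV ?l"
  proof -
    have "bounded_linear (\<lambda>x::real. \<i> * complex_of_real x)"
      by (intro bounded_linear_const_mult bounded_linear_of_real)
    from smooth_on_bounded_linear[OF open_UNIV this smooth_on_mult[OF open_UNIV smooth_on_const smooth_tanh]]
    show ?thesis .
  qed
  have \<gamma>s: "smooth_on UNIV \<gamma>"
    unfolding \<gamma>_def[abs_def]
    by (rule smooth_on_compose[OF open_UNIV open_image ls holomorphic_smooth_on[OF open_image G]]) (use l in blast)
  have g\<gamma>: "g (\<gamma> t) = ?l t" for t unfolding \<gamma>_def by (rule gG[OF l])
  have inj\<gamma>: "inj \<gamma>"
  proof (rule injI)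
    fix s t assume "\<gamma> s = \<gamma> t"
    then have "?l s = ?l t" using g\<gamma> by metis
    then have "tanh s = tanh t" using \<delta>(1) by (simp add: complex_eq_iff)
    then show "s = t" using artanh_tanh_real by metis
  qed
  have vel: "vector_derivative \<gamma> (at t) \<noteq> 0" for t
  proof -
    have d: "((\<lambda>t. \<delta> * tanh t) has_real_derivative \<delta> * (1 - (tanh t)\<^sup>2)) (at t)"
      by (rule DERIV_cmult[OF real_tanh_deriv])
    have "((\<lambda>t. of_real (\<delta> * tanh t)) has_vector_derivative (of_real (\<delta> * (1 - (tanh t)\<^sup>2)) :: complex)) (at t)"
      by (rule has_vector_derivative_of_real[OF d])
    then have "(?l has_vector_derivative \<i> * of_real (\<delta> * (1 - (tanh t)\<^sup>2))) (at t)"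
      by (rule has_vector_derivative_mult_right)
    from field_vector_diff_chain_at[OF this has_deriv_G[OF l]]
    have "(\<gamma> has_vector_derivative \<i> * of_real (\<delta> * (1 - (tanh t)\<^sup>2)) * deriv G (?l t)) (at t)"
      by (simp add: \<gamma>_def[abs_def] o_def)
    then have "vector_derivative \<gamma> (at t) = \<i> * of_real (\<delta> * (1 - (tanh t)\<^sup>2)) * deriv G (?l t)"
      by (rule vector_derivative_at)
    moreover have "deriv g (\<gamma> t) * deriv G (?l t) = 1"
      using deriv_prod[OF G_in[OF l]] unfolding \<gamma>_def gG[OF l] .
    then have "deriv G (?l t) \<noteq> 0" by auto
    moreover have "\<delta> * (1 - (tanh t)\<^sup>2) \<noteq> 0"
      using th[of t] abs_square_less_1[of "tanh t"] \<delta>(1) by simp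
    ultimately show ?thesis
      by (simp only: mult_eq_0_iff of_real_eq_0_iff complex_i_not_zero simp_thms)
  qed
  have inZ: "\<gamma> t \<in> Z" for t
    unfolding Z_def using g\<gamma>[of t] small[of t] G_in[OF l] by (simp add: \<gamma>_def)
  have inverse_at: "\<bar>Im (g z) / \<delta>\<bar> < 1" "\<gamma> (artanh (Im (g z) / \<delta>)) = z" if z: "z \<in> Z" for z
  proof -
    show b: "\<bar>Im (g z) / \<delta>\<bar> < 1" using z \<delta>(1) by (simp add: Z_def abs_divide)
    obtain t where t: "tanh t = Im (g z) / \<delta>" using tanh_range[OF b] by blast
    then have "artanh (Im (g z) / \<delta>) = t" using artanh_tanh_real by metis
    moreover have "?l t = g z" using z \<delta>(1) t by (simp add: Z_def complex_eq_iff)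
    ultimately show "\<gamma> (artanh (Im (g z) / \<delta>)) = z"
      unfolding \<gamma>_def using Gg z by (simp add: Z_def)
  qed
  have range: "range \<gamma> = Z" using inZ inverse_at(2) by (metis image_subset_iff rangeI subsetI subset_antisym)
  show "smooth_simple_curve Z"
    unfolding smooth_simple_curve_def using \<gamma>s inj\<gamma> vel range by blast
  let ?f = "\<lambda>z. artanh (Im (g z) / \<delta>)"
  (* the neighbourhood on which the inverse parametrization is smooth *)
  define V where "V = {z \<in> U. g z \<in> open_square \<delta>}"
  have oV: "open V" unfolding V_def by (rule open_preimage[OF open_square_open])
  have gV: "smooth_on V g" by (rule smooth_on_subset[OF holomorphic_smooth_on[OF openU g]]) (auto simp: V_def)
  have "bounded_linear (\<lambda>z. Im z / \<delta>)" by (rule bounded_linear_compose[OF bounded_linear_divide bounded_linear_Im])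
  from smooth_on_bounded_linear[OF oV this gV] have gV': "smooth_on V (\<lambda>z. Im (g z) / \<delta>)" .
  have fs: "smooth_on V ?f"
  proof (rule smooth_on_compose[OF oV _ gV' smooth_artanh])
    show "(\<lambda>z. Im (g z) / \<delta>) ` V \<subseteq> {-1<..<1}"
    proof (rule image_subsetI)
      fix z assume "z \<in> V"
      then have "\<bar>Im (g z) / \<delta>\<bar> < 1" using \<delta>(1) by (simp add: V_def in_open_square abs_divide)
      then show "Im (g z) / \<delta> \<in> {-1<..<1}" by (auto simp only: abs_less_iff greaterThanLessThan_iff)
    qed
  qed simp
  have ZV: "Z \<subseteq> V" using \<delta>(1) by (auto simp: Z_def V_def in_open_square)
  have f\<gamma>: "?f (\<gamma> t) = t" for t
    unfolding g\<gamma> using \<delta>(1) by (simp add: artanh_tanh_real)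
  have "smooth_map_on Z ?f"
    unfolding smooth_map_on_def using oV fs ZV by blast
  moreover have "smooth_map_on (UNIV :: real set) \<gamma>"
    unfolding smooth_map_on_def using \<gamma>s by (intro ballI exI[of _ UNIV] exI[of _ \<gamma>]) auto
  moreover have "?f ` Z = UNIV"
  proof (rule UNIV_eq_I[symmetric])
    fix t show "t \<in> ?f ` Z" by (rule image_eqI[of _ _ "\<gamma> t"]) (simp_all only: f\<gamma> inZ)
  qed
  ultimately show "diffeomorphic Z (UNIV :: real set)"
    unfolding diffeomorphic_def using range inverse_at(2) f\<gamma>
    by (intro exI[of _ ?f] exI[of _ \<gamma>] conjI) auto
qed

end

text \<open>
  The open sets in the support of the restriction are open subsets of \<open>V\<close>, and there the restriction and \<open>\<mu>\<close>
  vanish together.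
\<close>
lemma signed_supp_restrict_iff:
  assumes \<mu>: "signed_radon_on \<Omega> \<mu>" and V: "open V" "V \<subseteq> \<Omega>"
  shows "z \<in> signed_supp (signed_restrict \<mu> V) \<longleftrightarrow>
    z \<in> V \<and> \<not> (\<exists>W. open W \<and> W \<subseteq> V \<and> z \<in> W \<and> vanishes_on \<mu> W)"
proof -
  have Mb: "sets M = sets (restrict_space borel \<Omega>)" if "radon_on \<Omega> M" for M using that by (simp add: radon_on_def)
  have spM: "space M = \<Omega>" if "radon_on \<Omega> M" for M
    using sets_eq_imp_space_eq[OF Mb[OF that]] by (simp add: space_restrict_space)
  have VM: "V \<inter> space M \<in> sets M" if "radon_on \<Omega> M" for M
    using V unfolding spM[OF that] Mb[OF that] sets_restrict_space by (intro image_eqI[of _ _ V]) auto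
  have rad: "radon_on \<Omega> (fst \<mu>)" "radon_on \<Omega> (snd \<mu>)" using \<mu> by (auto simp: signed_radon_on_def)
  have sp: "space (fst (signed_restrict \<mu> V)) = V"
    using V(2) spM[OF rad(1)] by (auto simp: signed_restrict_def space_restrict_space)
  have "vanishes_on (signed_restrict \<mu> V) W \<longleftrightarrow> vanishes_on \<mu> W" if "W \<subseteq> V" for W
  proof -
    have "emeasure (restrict_space M V) A = emeasure M A" if "radon_on \<Omega> M" "A \<subseteq> W" for M A
      using emeasure_restrict_space[OF VM[OF that(1)], of A] that(2) \<open>W \<subseteq> V\<close> by auto
    then show ?thesis using rad unfolding vanishes_on_def signed_restrict_def by auto
  qed
  then show ?thesis unfolding signed_supp_def sp by blast
qed

theorem theorem1p1:
  fixes \<Omega> :: "complex set" and \<mu> :: signed_measure and h :: "complex \<Rightarrow> real" and z0 :: complex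
  assumes "open \<Omega>" and "bounded \<Omega>"
    and "signed_radon_on \<Omega> \<mu>" and "signed_in_Hminus1 \<Omega> \<mu>"
    and "H1_on \<Omega> h" and "stationary_harmonic \<Omega> h" and "continuous_on \<Omega> h"
    and "distr_laplacian_eq \<Omega> h \<mu>"
    and "z0 \<in> signed_supp \<mu>" and "omega \<Omega> h z0 \<noteq> 0" and "h z0 = 0"
  shows "\<exists>V H. open V \<and> z0 \<in> V \<and> V \<subseteq> \<Omega> \<and> harmonic_on V H \<and>
    ((\<forall>z\<in>V. h z = \<bar>H z\<bar>) \<or> (\<forall>z\<in>V. h z = - \<bar>H z\<bar>)) \<and>
    signed_supp (signed_restrict \<mu> V) = {z\<in>V. H z = 0} \<and>
    grad H z0 \<noteq> 0 \<and>
    smooth_simple_curve {z\<in>V. H z = 0} \<and>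
    diffeomorphic {z\<in>V. H z = 0} (UNIV :: real set)"
proof -
  have sp: "space (fst \<mu>) = \<Omega>"
    using assms(3) sets_eq_imp_space_eq[of "fst \<mu>" "restrict_space borel \<Omega>"]
    by (simp add: signed_radon_on_def radon_on_def space_restrict_space)
  have z0: "z0 \<in> \<Omega>" and supp: "\<And>W. open W \<Longrightarrow> W \<subseteq> \<Omega> \<Longrightarrow> z0 \<in> W \<Longrightarrow> \<not> vanishes_on \<mu> W"
    using assms(9) unfolding signed_supp_def sp by blast+
  define u where "u z = (if z \<in> \<Omega> then h z else 0)" for z
  obtain p q where pq: "integrable lborel u" "integrable lborel p" "integrable lborel q"
    "\<And>\<phi>. test_fun \<Omega> \<phi> \<Longrightarrow> (LINT z|lborel. dir_deriv 1 \<phi> z * u z) = - (LINT z|lborel. \<phi> z * p z)"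
    "\<And>\<phi>. test_fun \<Omega> \<phi> \<Longrightarrow> (LINT z|lborel. dir_deriv \<i> \<phi> z * u z) = - (LINT z|lborel. \<phi> z * q z)"
    "AE z in lborel. z \<in> \<Omega> \<longrightarrow> omega \<Omega> h z = (of_real (p z) - \<i> * of_real (q z))\<^sup>2"
    "\<And>\<phi>. \<phi> \<in> borel_measurable borel \<Longrightarrow> (LINT z|lebesgue_on \<Omega>. h z * \<phi> z) = (LINT z|lborel. \<phi> z * u z)"
    by (rule weak_gradient_lborel[OF assms(1,2,6,7), folded u_def]) (rule that)
  obtain U g G r where chart: "square_chart U g G r" and U: "U \<subseteq> \<Omega>" "z0 \<in> U" "g z0 = 0"
    "\<And>z. z \<in> U \<Longrightarrow> (deriv g z)\<^sup>2 = omega \<Omega> h z"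
    by (rule square_chart_exists[OF assms(1) omega_spec(1)[OF assms(1,6)] z0 assms(10)]) (rule that)
  interpret square_chart U g G r by (rule chart)
  have weak1: "(LINT z|lborel. dir_deriv 1 \<phi> z * u z) = - (LINT z|lborel. \<phi> z * p z)" if "test_fun U \<phi>" for \<phi>
    by (rule pq(4)[OF test_fun_mono[OF that U(1)]])
  have weak2: "(LINT z|lborel. dir_deriv \<i> \<phi> z * u z) = - (LINT z|lborel. \<phi> z * q z)" if "test_fun U \<phi>" for \<phi>
    by (rule pq(5)[OF test_fun_mono[OF that U(1)]])
  have ae: "AE z in lborel. z \<in> U \<longrightarrow> (deriv g z)\<^sup>2 = (of_real (p z) - \<i> * of_real (q z))\<^sup>2"
    using pq(6) by eventually_elim (use U(1,4) in auto)
  have uc: "continuous_on U u"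
    by (rule continuous_on_eq[OF continuous_on_subset[OF assms(7) U(1)]]) (use U(1) in \<open>auto simp: u_def\<close>)
  (* the profile: \<open>u\<close> on the line \<open>Im g = 0\<close>, which meets every level once *)
  define f where "f t = u (G (Complex t 0))" for t
  have uf: "u (G \<zeta>) = f (Re \<zeta>)" if "\<zeta> \<in> closed_square r" for \<zeta>
    using constant_on_levels[OF pq(1-3) weak1 weak2 ae uc, of "Re \<zeta>" "Im \<zeta>" 0] that r
    by (simp add: f_def in_closed_square)
  have fc: "continuous_on {-r..r} f"
  proof -
    have line: "(\<lambda>t. Complex t 0) ` {-r..r} \<subseteq> g ` U"
      by (rule subset_trans[OF _ closed_square]) (use r in \<open>auto simp: in_closed_square\<close>)
    have "continuous_on {-r..r} (\<lambda>t. Complex t 0)" by (intro continuous_on_Complex continuous_intros)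
    then have "continuous_on {-r..r} (\<lambda>t. G (Complex t 0))"
      by (rule continuous_on_compose2[OF continuous_G[OF subset_refl] _ line])
    then show ?thesis
      unfolding f_def by (rule continuous_on_compose2[OF uc]) (use line G_in in auto)
  qed
  have lap: "(LINT z|lborel. laplacian \<phi> z * u z) = signed_integral \<mu> \<phi>" if "test_fun U \<phi>" for \<phi>
  proof -
    have \<phi>: "test_fun \<Omega> \<phi>" by (rule test_fun_mono[OF that U(1)])
    have "laplacian \<phi> \<in> borel_measurable borel"
      unfolding laplacian_def[abs_def]
      by (intro borel_measurable_add test_fun_borel[OF test_fun_dir_deriv[OF test_fun_dir_deriv[OF \<phi>]]])
    from pq(7)[OF this] show ?thesis using assms(8) \<phi> unfolding distr_laplacian_eq_def by simp
  qed
  interpret charted_laplacian U g G r \<Omega> \<mu> u f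
    by unfold_locales (rule assms(1) U(1) assms(3) lap uf fc; assumption?)+
  obtain \<delta> \<sigma> \<tau> where \<delta>: "0 < \<delta>" "\<delta> < r" and \<sigma>\<tau>: "\<bar>\<sigma>\<bar> = 1" "\<bar>\<tau>\<bar> = (1::real)"
    and right: "\<And>t. 0 \<le> t \<Longrightarrow> t \<le> \<delta> \<Longrightarrow> f t = f 0 + \<sigma> * t"
    and left: "\<And>t. -\<delta> \<le> t \<Longrightarrow> t \<le> 0 \<Longrightarrow> f t = f 0 + \<tau> * t"
    by (rule piecewise_linear_profile[OF pq(1-3) weak1 weak2 ae]) (assumption, assumption, rule that)
  have f0: "f 0 = 0"
  proof -
    have "Complex 0 0 = g z0" using U(3) by (simp add: complex_eq_iff)
    then have "f 0 = u z0" unfolding f_def using Gg[OF U(2)] by simp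
    then show ?thesis using assms(11) z0 by (simp add: u_def)
  qed
  define V where "V = {z \<in> U. g z \<in> open_square \<delta>}"
  have oV: "open V" unfolding V_def by (rule open_preimage[OF open_square_open])
  have VU: "V \<subseteq> U" and V\<Omega>: "V \<subseteq> \<Omega>" and z0V: "z0 \<in> V"
    using U \<delta>(1) by (auto simp: V_def in_open_square)
  (* equal slopes on both sides would leave no mass near \<open>z0\<close> *)
  have opposite: "\<tau> = - \<sigma>"
  proof (rule ccontr)
    assume "\<tau> \<noteq> - \<sigma>"
    then have "\<tau> = \<sigma>" using \<sigma>\<tau> by linarith
    have lin: "f t = 0 + \<sigma> * t" if "-\<delta> \<le> t" "t \<le> \<delta>" for t
    proof (cases "0 \<le> t")
      case True then show ?thesis using right[OF True that(2)] f0 by simp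
    next
      case False then show ?thesis using left[OF that(1)] f0 \<open>\<tau> = \<sigma>\<close> by simp
    qed
    have "vanishes_on \<mu> V"
      unfolding vanishes_on_def
    proof (intro ballI impI)
      fix A assume A: "A \<in> sets borel" "A \<subseteq> V"
      show "emeasure (fst \<mu>) A = emeasure (snd \<mu>) A"
      proof (rule no_mass_on_linear_strip[OF lin _ _ A(1)])
        show "A \<subseteq> {z \<in> U. - \<delta> < Re (g z) \<and> Re (g z) < \<delta> \<and> \<bar>Im (g z)\<bar> < r}"
          using A(2) \<delta>(2) by (auto simp: V_def in_open_square abs_less_iff)
      qed (use \<delta> in auto)
    qed
    then show False using supp[OF oV V\<Omega> z0V] by simp
  qed
  have fold: "f t = \<sigma> * \<bar>t\<bar>" if "\<bar>t\<bar> \<le> \<delta>" for t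
  proof (cases "0 \<le> t")
    case True then show ?thesis using right[of t] that f0 by simp
  next
    case False then show ?thesis using left[of t] that f0 opposite by simp
  qed
  define H where "H z = Re (g z)" for z
  have hH: "h z = \<sigma> * \<bar>H z\<bar>" if z: "z \<in> V" for z
  proof -
    have "g z \<in> closed_square r" "\<bar>Re (g z)\<bar> \<le> \<delta>" using z \<delta> by (auto simp: V_def in_open_square in_closed_square)
    then have "u (G (g z)) = \<sigma> * \<bar>Re (g z)\<bar>" using uf fold by simp
    moreover have "G (g z) = z" "z \<in> \<Omega>" using Gg z VU V\<Omega> by blast+
    ultimately show ?thesis by (simp add: u_def H_def)
  qed
  have zero_set: "{z \<in> V. H z = 0} = {z \<in> U. Re (g z) = 0 \<and> \<bar>Im (g z)\<bar> < \<delta>}"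
    using \<delta>(1) by (auto simp: V_def H_def in_open_square)
  (* off the zero set \<open>f\<close> is linear near \<open>H z\<close>, on it \<open>f\<close> has a fold *)
  have supp_eq: "signed_supp (signed_restrict \<mu> V) = {z \<in> V. H z = 0}"
  proof (rule set_eqI)
    fix z
    have "(\<exists>W. open W \<and> W \<subseteq> V \<and> z \<in> W \<and> vanishes_on \<mu> W) \<longleftrightarrow> H z \<noteq> 0" if z: "z \<in> V"
    proof
      assume "\<exists>W. open W \<and> W \<subseteq> V \<and> z \<in> W \<and> vanishes_on \<mu> W"
      then obtain W where W: "open W" "W \<subseteq> V" "z \<in> W" "vanishes_on \<mu> W" by blast
      show "H z \<noteq> 0"
      proof
        assume "H z = 0"
        have "\<bar>Im (g z)\<bar> < r" using z \<delta>(2) by (auto simp: V_def in_open_square)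
        moreover have "\<sigma> \<noteq> 0" using \<sigma>\<tau>(1) by auto
        ultimately show False
          using mass_on_fold[OF fold _ \<delta>(1) less_imp_le[OF \<delta>(2)] W(1) subset_trans[OF W(2) VU] W(3)]
            W(4) \<open>H z = 0\<close> unfolding vanishes_on_def H_def by blast
      qed
    next
      assume nz: "H z \<noteq> 0"
      define W where "W = {w \<in> V. (if 0 < H z then 0 < Re (g w) else Re (g w) < 0)}"
      have "W = (if 0 < H z then {w \<in> U. g w \<in> open_square \<delta> \<inter> {\<zeta>. 0 < Re \<zeta>}} else {w \<in> U. g w \<in> open_square \<delta> \<inter> {\<zeta>. Re \<zeta> < 0}})"
        by (auto simp: W_def V_def)
      moreover have "open {w \<in> U. g w \<in> open_square \<delta> \<inter> {\<zeta>. 0 < Re \<zeta>}}" "open {w \<in> U. g w \<in> open_square \<delta> \<inter> {\<zeta>. Re \<zeta> < 0}}"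
        by (intro open_preimage open_Int open_square_open open_halfspace_Re_gt open_halfspace_Re_lt)+
      ultimately have "open W" by simp
      moreover have "W \<subseteq> V" "z \<in> W" using z nz by (auto simp: W_def H_def)
      moreover have "vanishes_on \<mu> W"
        unfolding vanishes_on_def
      proof (intro ballI impI)
        fix A assume A: "A \<in> sets borel" "A \<subseteq> W"
        have AV: "A \<subseteq> {w \<in> U. \<bar>Re (g w)\<bar> < \<delta> \<and> \<bar>Im (g w)\<bar> < r}"
          using A(2) \<delta>(2) by (auto simp: W_def V_def in_open_square)
        show "emeasure (fst \<mu>) A = emeasure (snd \<mu>) A"
        proof (cases "0 < H z")
          case True
          show ?thesis
          proof (rule no_mass_on_linear_strip[OF right _ _ A(1)])
            show "A \<subseteq> {w \<in> U. 0 < Re (g w) \<and> Re (g w) < \<delta> \<and> \<bar>Im (g w)\<bar> < r}"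
              using AV A(2) True by (auto simp: W_def)
          qed (use \<delta> in auto)
        next
          case False
          show ?thesis
          proof (rule no_mass_on_linear_strip[OF left _ _ A(1)])
            show "A \<subseteq> {w \<in> U. - \<delta> < Re (g w) \<and> Re (g w) < 0 \<and> \<bar>Im (g w)\<bar> < r}"
              using AV A(2) False by (auto simp: W_def abs_less_iff)
          qed (use \<delta> in auto)
        qed
      qed
      ultimately show "\<exists>W. open W \<and> W \<subseteq> V \<and> z \<in> W \<and> vanishes_on \<mu> W" by blast
    qed
    then show "z \<in> signed_supp (signed_restrict \<mu> V) \<longleftrightarrow> z \<in> {z \<in> V. H z = 0}"
      unfolding signed_supp_restrict_iff[OF assms(3) oV V\<Omega>] by blast
  qed
  have sign: "(\<forall>z\<in>V. h z = \<bar>H z\<bar>) \<or> (\<forall>z\<in>V. h z = - \<bar>H z\<bar>)"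
  proof (cases "\<sigma> = 1")
    case True then show ?thesis using hH by simp
  next
    case False
    then have "\<sigma> = -1" using \<sigma>\<tau>(1) by linarith
    then show ?thesis using hH by simp
  qed
  have harm: "harmonic_on V H" unfolding H_def[abs_def] by (rule re_chart_harmonic(1)[OF VU])
  have gr: "grad H z0 \<noteq> 0"
    unfolding H_def[abs_def] re_chart_harmonic(2)[OF VU U(2)] using deriv_nonzero[OF U(2)] by simp
  have "smooth_simple_curve {z \<in> V. H z = 0}" "diffeomorphic {z \<in> V. H z = 0} (UNIV :: real set)"
    unfolding zero_set by (rule nodal_line[OF \<delta>(1) less_imp_le[OF \<delta>(2)]])+
  with oV z0V V\<Omega> harm sign supp_eq gr show ?thesis
    by (intro exI[of _ V] exI[of _ H] conjI)
qed

end
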